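(* There is an $O(|V|+|A|)$-time certifying algorithm to recognize strongly chordal reflexive multipartite tournaments.
   Context: Digraphs are finite, without parallel arcs. A reflexive multipartite tournament is obtained from a complete multipartite graph by orienting each edge in exactly one direction and adding a loop at every vertex. A strong ordering of a digraph $D=(V,A)$ is a linear ordering $v_1,\dots,v_n$ of $V$ such that for all $i<j$ and $k<\ell$ (not necessarily distinct), if $(v_i,v_k),(v_i,v_\ell),(v_j,v_k)\in A$ then $(v_j,v_\ell)\in A$. A digraph is strongly chordal if it has a strong ordering. The input is a digraph $D=(V,A)$, and the algorithm decides whether $D$ is a strongly chordal reflexive multipartite tournament. Certifying means that it also outputs a certificate: on a positive answer, a strong ordering of $D$; on a negative answer, one of: a vertex without a loop, an induced $K_1+K_2$ (an edge plus an isolated vertex) or an induced $C_4$ in the underlying graph, a directed cycle (other than a loop), or an induced subdigraph isomorphic to $T_{202}$, $T_{1111}$ or $T_{10101}$. Here $T_{c_0c_1\cdots c_m}$ denotes the reflexive digraph whose vertex set is partitioned into $\{t_1,\dots,t_m\}$ and an independent set $S$ which is partitioned into classes $S_0,\dots,S_m$ with $|S_i|=c_i$, and whose arcs are all loops, $(t_p,t_q)$ for $p<q$, and, for each $s\in S_i$, the arcs $(t_p,s)$ for $p\le i$ and $(s,t_p)$ for $p>i$. *)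

theory Defs
  imports
    "Graph_Theory.Graph_Theory"
    "HOL-Library.Disjoint_Sets"
    "HOL-Library.Landau_Symbols"
begin

section \<open>Digraphs\<close>

text \<open>
  A finite digraph without parallel arcs, loops allowed, is a pair digraph \<open>D\<close> with
  \<^prop>\<open>pair_fin_digraph D\<close>. Undirected simple graphs are loop-free symmetric pair digraphs.
\<close>

definition strong_ordering :: "'a pair_pre_digraph \<Rightarrow> 'a list \<Rightarrow> bool" where
  "strong_ordering D vs \<longleftrightarrow>
     distinct vs \<and> set vs = pverts D \<and>
     (\<forall>i j k l. i < j \<and> j < length vs \<and> k < l \<and> l < length vs \<and>
        (vs ! i, vs ! k) \<in> parcs D \<and> (vs ! i, vs ! l) \<in> parcs D \<and> (vs ! j, vs ! k) \<in> parcs D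
        \<longrightarrow> (vs ! j, vs ! l) \<in> parcs D)"

definition strongly_chordal :: "'a pair_pre_digraph \<Rightarrow> bool" where
  "strongly_chordal D \<longleftrightarrow> (\<exists>vs. strong_ordering D vs)"

text \<open>The number of parts is arbitrary; edgeless graphs (one part) are included.\<close>

definition complete_multipartite :: "'a pair_pre_digraph \<Rightarrow> bool" where
  "complete_multipartite G \<longleftrightarrow>
     (\<exists>P. partition_on (pverts G) P \<and>
        parcs G = {(u, v). u \<in> pverts G \<and> v \<in> pverts G \<and> \<not> (\<exists>X\<in>P. u \<in> X \<and> v \<in> X)})"

definition orientation_of :: "('a \<times> 'a) set \<Rightarrow> 'a pair_pre_digraph \<Rightarrow> bool" where
  "orientation_of O' G \<longleftrightarrow>
     O' \<subseteq> parcs G \<and> (\<forall>(u, v) \<in> parcs G. ((u, v) \<in> O') \<noteq> ((v, u) \<in> O'))"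

definition reflexive_multipartite_tournament :: "'a pair_pre_digraph \<Rightarrow> bool" where
  "reflexive_multipartite_tournament D \<longleftrightarrow>
     (\<exists>G O'. complete_multipartite G \<and> orientation_of O' G \<and>
        pverts D = pverts G \<and> parcs D = O' \<union> Id_on (pverts G))"

definition underlying_graph :: "'a pair_pre_digraph \<Rightarrow> 'a pair_pre_digraph" where
  "underlying_graph D = \<lparr> pverts = pverts D, parcs = parcs (mk_symmetric (with_proj D)) - Id \<rparr>"

definition K1_plus_K2 :: "nat pair_pre_digraph" where
  "K1_plus_K2 = \<lparr> pverts = {0, 1, 2}, parcs = {(1, 2), (2, 1)} \<rparr>"

definition C4 :: "nat pair_pre_digraph" where
  "C4 = \<lparr> pverts = {..<4},
          parcs = {(i, j). i < 4 \<and> j < 4 \<and> (j = (i + 1) mod 4 \<or> i = (j + 1) mod 4)} \<rparr>"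

text \<open>
  \<open>T_digraph [c\<^sub>0, \<dots>, c\<^sub>m]\<close> is the digraph usually written with the list as subscripts of \<open>T\<close>:
  \<open>Inl p\<close> is the vertex \<open>t\<^sub>p\<close>, and the elements of \<open>S\<^sub>i\<close> are \<open>Inr (i, j)\<close> for \<open>j < c\<^sub>i\<close>.
\<close>

definition T_verts :: "nat list \<Rightarrow> nat set" where
  "T_verts c = {1..length c - 1}"

definition S_verts :: "nat list \<Rightarrow> (nat \<times> nat) set" where
  "S_verts c = {(i, j). i < length c \<and> j < c ! i}"

definition T_digraph :: "nat list \<Rightarrow> (nat + nat \<times> nat) pair_pre_digraph" where
  "T_digraph c =
     \<lparr> pverts = Inl ` T_verts c \<union> Inr ` S_verts c,
       parcs = Id_on (Inl ` T_verts c \<union> Inr ` S_verts c)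
         \<union> {(Inl p, Inl q) | p q. p \<in> T_verts c \<and> q \<in> T_verts c \<and> p < q}
         \<union> {(Inl p, Inr (i, j)) | p i j. p \<in> T_verts c \<and> (i, j) \<in> S_verts c \<and> p \<le> i}
         \<union> {(Inr (i, j), Inl p) | p i j. p \<in> T_verts c \<and> (i, j) \<in> S_verts c \<and> p > i} \<rparr>"

definition induces_copy :: "'a pair_pre_digraph \<Rightarrow> 'a list \<Rightarrow> 'b pair_pre_digraph \<Rightarrow> bool" where
  "induces_copy D vs H \<longleftrightarrow>
     distinct vs \<and> set vs \<subseteq> pverts D \<and>
     digraph_iso (with_proj H) (induce_subgraph (with_proj D) (set vs))"

text \<open>
  A directed cycle is given by its vertices in cyclic order; it may have length two,
  when both orientations of an edge are present.
\<close>

definition directed_nonloop_cycle :: "'a pair_pre_digraph \<Rightarrow> 'a list \<Rightarrow> bool" where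
  "directed_nonloop_cycle D vs \<longleftrightarrow>
     2 \<le> length vs \<and> pre_digraph.cycle (with_proj D) (zip vs (rotate1 vs))"


section \<open>Answers and certificates\<close>

datatype obstruction =
    Missing_Loop nat
  | Induced_K1_plus_K2 "nat list"
  | Induced_C4 "nat list"
  | Directed_Cycle "nat list"
  | Induced_T202 "nat list"
  | Induced_T1111 "nat list"
  | Induced_T10101 "nat list"

datatype answer = Yes "nat list" | No obstruction

primrec valid_obstruction :: "nat pair_pre_digraph \<Rightarrow> obstruction \<Rightarrow> bool" where
  "valid_obstruction D (Missing_Loop v) \<longleftrightarrow> v \<in> pverts D \<and> (v, v) \<notin> parcs D"
| "valid_obstruction D (Induced_K1_plus_K2 vs) \<longleftrightarrow>
     induces_copy (underlying_graph D) vs K1_plus_K2"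
| "valid_obstruction D (Induced_C4 vs) \<longleftrightarrow> induces_copy (underlying_graph D) vs C4"
| "valid_obstruction D (Directed_Cycle vs) \<longleftrightarrow> directed_nonloop_cycle D vs"
| "valid_obstruction D (Induced_T202 vs) \<longleftrightarrow> induces_copy D vs (T_digraph [2, 0, 2])"
| "valid_obstruction D (Induced_T1111 vs) \<longleftrightarrow> induces_copy D vs (T_digraph [1, 1, 1, 1])"
| "valid_obstruction D (Induced_T10101 vs) \<longleftrightarrow> induces_copy D vs (T_digraph [1, 0, 1, 0, 1])"

primrec correct_answer :: "nat pair_pre_digraph \<Rightarrow> answer \<Rightarrow> bool" where
  "correct_answer D (Yes vs) \<longleftrightarrow>
     reflexive_multipartite_tournament D \<and> strongly_chordal D \<and> strong_ordering D vs"
| "correct_answer D (No ob) \<longleftrightarrow>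
     \<not> (reflexive_multipartite_tournament D \<and> strongly_chordal D) \<and> valid_obstruction D ob"


section \<open>A word RAM\<close>

text \<open>
  Programs work on registers and arrays of natural numbers. A fixed program mentions only
  finitely many registers and arrays, so interleaving them in a single memory turns this into
  an ordinary random access machine, with constant overhead. Every operation takes one unit of
  time. All numbers that arise, addresses included, must be at most the word bound \<open>w\<close>:
  otherwise the program has no execution. The only arithmetic is addition and truncated
  subtraction.
\<close>

datatype expr =
    Num nat
  | Reg nat
  | Cell nat expr
  | Add expr expr
  | Sub expr expr

datatype test =
    Less expr expr
  | Equal expr expr
  | Neg test
  | Conj test test

datatype prog =
    Skip
  | Assign nat expr
  | Store nat expr expr
  | Seq prog prog
  | Cond test prog prog
  | While test prog

record store =
  regs :: "nat \<Rightarrow> nat"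
  arrs :: "nat \<Rightarrow> nat \<Rightarrow> nat"

primrec eval_expr :: "store \<Rightarrow> expr \<Rightarrow> nat" where
  "eval_expr s (Num n) = n"
| "eval_expr s (Reg x) = regs s x"
| "eval_expr s (Cell a e) = arrs s a (eval_expr s e)"
| "eval_expr s (Add e f) = eval_expr s e + eval_expr s f"
| "eval_expr s (Sub e f) = eval_expr s e - eval_expr s f"

primrec eval_test :: "store \<Rightarrow> test \<Rightarrow> bool" where
  "eval_test s (Less e f) \<longleftrightarrow> eval_expr s e < eval_expr s f"
| "eval_test s (Equal e f) \<longleftrightarrow> eval_expr s e = eval_expr s f"
| "eval_test s (Neg b) \<longleftrightarrow> \<not> eval_test s b"
| "eval_test s (Conj b c) \<longleftrightarrow> eval_test s b \<and> eval_test s c"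

text \<open>
  Register and array contents need no check when they are read: they are at most \<open>w\<close> initially,
  and whenever something is written.
\<close>

primrec fits_expr :: "nat \<Rightarrow> store \<Rightarrow> expr \<Rightarrow> bool" where
  "fits_expr w s (Num n) \<longleftrightarrow> n \<le> w"
| "fits_expr w s (Reg x) \<longleftrightarrow> True"
| "fits_expr w s (Cell a e) \<longleftrightarrow> fits_expr w s e"
| "fits_expr w s (Add e f) \<longleftrightarrow>
     fits_expr w s e \<and> fits_expr w s f \<and> eval_expr s e + eval_expr s f \<le> w"
| "fits_expr w s (Sub e f) \<longleftrightarrow> fits_expr w s e \<and> fits_expr w s f"

primrec fits_test :: "nat \<Rightarrow> store \<Rightarrow> test \<Rightarrow> bool" where
  "fits_test w s (Less e f) \<longleftrightarrow> fits_expr w s e \<and> fits_expr w s f"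
| "fits_test w s (Equal e f) \<longleftrightarrow> fits_expr w s e \<and> fits_expr w s f"
| "fits_test w s (Neg b) \<longleftrightarrow> fits_test w s b"
| "fits_test w s (Conj b c) \<longleftrightarrow> fits_test w s b \<and> fits_test w s c"

primrec cost_expr :: "expr \<Rightarrow> nat" where
  "cost_expr (Num n) = 1"
| "cost_expr (Reg x) = 1"
| "cost_expr (Cell a e) = 1 + cost_expr e"
| "cost_expr (Add e f) = 1 + cost_expr e + cost_expr f"
| "cost_expr (Sub e f) = 1 + cost_expr e + cost_expr f"

primrec cost_test :: "test \<Rightarrow> nat" where
  "cost_test (Less e f) = 1 + cost_expr e + cost_expr f"
| "cost_test (Equal e f) = 1 + cost_expr e + cost_expr f"
| "cost_test (Neg b) = 1 + cost_test b"
| "cost_test (Conj b c) = 1 + cost_test b + cost_test c"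

text \<open>\<open>exec w p s t s'\<close>: with word bound \<open>w\<close>, program \<open>p\<close> started in \<open>s\<close> halts in \<open>s'\<close> after time \<open>t\<close>.\<close>

inductive exec :: "nat \<Rightarrow> prog \<Rightarrow> store \<Rightarrow> nat \<Rightarrow> store \<Rightarrow> bool" for w where
  exec_Skip: "exec w Skip s 1 s"
| exec_Assign: "fits_expr w s e \<Longrightarrow>
    exec w (Assign x e) s (1 + cost_expr e) (s\<lparr>regs := (regs s)(x := eval_expr s e)\<rparr>)"
| exec_Store: "fits_expr w s i \<Longrightarrow> fits_expr w s e \<Longrightarrow>
    exec w (Store a i e) s (1 + cost_expr i + cost_expr e)
      (s\<lparr>arrs := (arrs s)(a := (arrs s a)(eval_expr s i := eval_expr s e))\<rparr>)"
| exec_Seq: "exec w p s t s' \<Longrightarrow> exec w q s' t' s'' \<Longrightarrow> exec w (Seq p q) s (t + t') s''"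
| exec_Cond_True: "fits_test w s b \<Longrightarrow> eval_test s b \<Longrightarrow> exec w p s t s' \<Longrightarrow>
    exec w (Cond b p q) s (1 + cost_test b + t) s'"
| exec_Cond_False: "fits_test w s b \<Longrightarrow> \<not> eval_test s b \<Longrightarrow> exec w q s t s' \<Longrightarrow>
    exec w (Cond b p q) s (1 + cost_test b + t) s'"
| exec_While_False: "fits_test w s b \<Longrightarrow> \<not> eval_test s b \<Longrightarrow>
    exec w (While b p) s (1 + cost_test b) s"
| exec_While_True: "fits_test w s b \<Longrightarrow> eval_test s b \<Longrightarrow> exec w p s t s' \<Longrightarrow>
    exec w (While b p) s' t' s'' \<Longrightarrow> exec w (While b p) s (1 + cost_test b + t + t') s''"

inductive_cases exec_SkipE: "exec w Skip s t s'"
inductive_cases exec_AssignE: "exec w (Assign x e) s t s'"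
inductive_cases exec_StoreE: "exec w (Store a i e) s t s'"
inductive_cases exec_SeqE: "exec w (Seq p q) s t s'"
inductive_cases exec_CondE: "exec w (Cond b p q) s t s'"
inductive_cases exec_WhileE: "exec w (While b p) s t s'"

lemma exec_deterministic:
  "exec w p s t s' \<Longrightarrow> exec w p s u s'' \<Longrightarrow> t = u \<and> s' = s''"
proof (induction arbitrary: u s'' rule: exec.induct)
  case (exec_Skip s)
  then show ?case by (rule exec_SkipE) simp
next
  case (exec_Assign s e x)
  from exec_Assign.prems show ?case by (rule exec_AssignE) simp
next
  case (exec_Store s i e a)
  from exec_Store.prems show ?case by (rule exec_StoreE) simp
next
  case (exec_Seq p s t s' q t' r)
  from exec_Seq.prems obtain v x v'
    where *: "u = v + v'" "exec w p s v x" "exec w q x v' s''" by (rule exec_SeqE)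
  from exec_Seq.IH(1)[OF *(2)] have "t = v" "s' = x" by simp_all
  with *(1) exec_Seq.IH(2)[of v' s''] *(3) show ?case by simp
next
  case (exec_Cond_True s b p t s' q)
  from exec_Cond_True.prems exec_Cond_True.hyps(2) obtain v
    where *: "u = 1 + cost_test b + v" "exec w p s v s''" by (elim exec_CondE) simp_all
  from *(1) exec_Cond_True.IH[OF *(2)] show ?case by simp
next
  case (exec_Cond_False s b q t s' p)
  from exec_Cond_False.prems exec_Cond_False.hyps(2) obtain v
    where *: "u = 1 + cost_test b + v" "exec w q s v s''" by (elim exec_CondE) simp_all
  from *(1) exec_Cond_False.IH[OF *(2)] show ?case by simp
next
  case (exec_While_False s b p)
  from exec_While_False.prems exec_While_False.hyps(2)
  have "u = 1 + cost_test b \<and> s'' = s" by - (erule exec_WhileE; simp)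
  then show ?case by simp
next
  case (exec_While_True s b p t s' t' r)
  from exec_While_True.prems exec_While_True.hyps(2) obtain v x v'
    where *: "u = 1 + cost_test b + v + v'" "exec w p s v x" "exec w (While b p) x v' s''"
    by - (erule exec_WhileE; simp)
  from exec_While_True.IH(1)[OF *(2)] have "t = v" "s' = x" by simp_all
  with *(1) exec_While_True.IH(2)[of v' s''] *(3) show ?case by simp
qed

text \<open>
  The input is placed in array 0 and everything else is 0. The output is read from the first
  cells of array 1, and its length from register 0.
\<close>

definition initial_store :: "nat list \<Rightarrow> store" where
  "initial_store xs =
     \<lparr> regs = (\<lambda>_. 0), arrs = (\<lambda>a i. if a = 0 \<and> i < length xs then xs ! i else 0) \<rparr>"

definition output_of :: "store \<Rightarrow> nat list" where
  "output_of s = map (arrs s 1) [0..<regs s 0]"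

definition computes_within :: "prog \<Rightarrow> nat list \<Rightarrow> nat list \<Rightarrow> nat \<Rightarrow> nat \<Rightarrow> bool" where
  "computes_within p xs ys T w \<longleftrightarrow>
     (\<forall>x\<in>set xs. x \<le> w) \<and>
     (\<exists>t s. exec w p (initial_store xs) t s \<and> t \<le> T \<and> output_of s = ys)"


section \<open>Encoding of inputs and outputs\<close>

text \<open>
  The vertices of an input digraph are \<open>0, \<dots>, n - 1\<close>. It is given by the lists of out-neighbours
  of its vertices, each in arbitrary order.
\<close>

definition adjacency_lists :: "nat pair_pre_digraph \<Rightarrow> nat list list \<Rightarrow> bool" where
  "adjacency_lists D adj \<longleftrightarrow>
     pverts D = {..<length adj} \<and>
     (\<forall>u<length adj. distinct (adj ! u) \<and> set (adj ! u) = {v. (u, v) \<in> parcs D})"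

definition encode_input :: "nat list list \<Rightarrow> nat list" where
  "encode_input adj = length adj # concat (map (\<lambda>l. length l # l) adj)"

primrec encode_obstruction :: "obstruction \<Rightarrow> nat list" where
  "encode_obstruction (Missing_Loop v) = [1, v]"
| "encode_obstruction (Induced_K1_plus_K2 vs) = 2 # vs"
| "encode_obstruction (Induced_C4 vs) = 3 # vs"
| "encode_obstruction (Directed_Cycle vs) = 4 # vs"
| "encode_obstruction (Induced_T202 vs) = 5 # vs"
| "encode_obstruction (Induced_T1111 vs) = 6 # vs"
| "encode_obstruction (Induced_T10101 vs) = 7 # vs"

primrec encode_answer :: "answer \<Rightarrow> nat list" where
  "encode_answer (Yes vs) = 0 # vs"
| "encode_answer (No ob) = encode_obstruction ob"

lemma encode_answer_inject: "encode_answer a = encode_answer b \<Longrightarrow> a = b"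
proof -
  have obs: "ob = ob'" if "encode_obstruction ob = encode_obstruction ob'" for ob ob'
    using that by (cases ob; cases ob') auto
  have yes: "encode_obstruction ob \<noteq> 0 # vs" for ob vs
    by (cases ob) simp_all
  show "encode_answer a = encode_answer b \<Longrightarrow> a = b"
    by (cases a; cases b) (auto dest: obs simp: yes yes[symmetric])
qed

end

theory Submission
  imports Defs
begin

text \<open>
  In a strong ordering of a reflexive multipartite tournament the first vertex of any induced
  subdigraph can be bypassed on cycles and its neighbours are pairwise adjacent. So a strongly
  chordal one is acyclic and its underlying graph is a clique plus an independent set \<open>S\<close>, with all
  edges in between: it is one of the digraphs \<open>T\<^sub>c\<close>, described by a word that records, in
  topological order, which vertices belong to \<open>S\<close>. The three forbidden induced subdigraphs are the
  subsequences \<open>SSTTSS\<close>, \<open>STSTSTS\<close> and \<open>STTSTTS\<close>. If none occurs then, up to reversal, all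
  elements of \<open>S\<close> but the last lie in two consecutive classes, and listing first these, then the
  remaining vertices from there on in topological order and finally the others in reverse
  topological order is a strong ordering.

  The algorithm looks for a missing loop, sorts topologically by repeatedly removing sources (if
  it gets stuck, following predecessors leads into a cycle), and takes as \<open>S\<close> the vertices of
  degree less than \<open>n - 1\<close>. If an arc joins two such vertices, then non-neighbours of its ends
  produce an induced \<open>K\<^sub>1 + K\<^sub>2\<close> or \<open>C\<^sub>4\<close>. Otherwise comparing the classes of the first two and the
  last two elements of \<open>S\<close> decides between the two orderings and the three obstructions.
\<close>

section \<open>Induced copies and directed cycles\<close>

text \<open>Both directions work with positions only. Five local rules relate the topological order
  to a supposed strong ordering, and each obstruction contradicts them by order reasoning alone.
  Conversely one ordering suffices, because the condition survives reversal of all arcs. Since the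
  ordering tolerates one stray extreme element of \<open>S\<close>, the classes compared are those
  of the first and second-last, or of the second and last element. If both differences are at least
  two, the classes of the second and second-last element decide: they differ by at least two
  (\<open>T202\<close>), by one (\<open>T1111\<close>) or not at all (\<open>T10101\<close>). The
  sequence of tests is forced: degrees count arcs, which are neighbours only once two-cycles are
  excluded, and the search for non-neighbours relies on loops. The obstacle on the machine is linear
  time. The double loops over vertices and their arcs are flattened into single loops that handle
  one arc or close one vertex per round. Loops are then never nested, each makes at most
  \<open>n + m\<close> rounds, and the running time is bounded by a syntactic function of the
  program.\<close>

lemma induces_copyI:
  assumes "inj_on f (pverts H)" "f ` pverts H = set vs" "distinct vs" "set vs \<subseteq> pverts D"
    and wf: "\<And>x y. (x, y) \<in> parcs H \<Longrightarrow> x \<in> pverts H \<and> y \<in> pverts H"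
    and arc: "\<And>x y. x \<in> pverts H \<Longrightarrow> y \<in> pverts H \<Longrightarrow> (f x, f y) \<in> parcs D \<longleftrightarrow> (x, y) \<in> parcs H"
  shows "induces_copy D vs H"
proof -
  let ?h = "\<lparr> iso_verts = f, iso_arcs = map_prod f f, iso_head = snd, iso_tail = fst \<rparr>"
  have "pre_digraph.digraph_isomorphism (with_proj H) ?h"
    unfolding pre_digraph.digraph_isomorphism_def
    using assms(1) wf by (auto simp: wf_digraph_def inj_on_def)
  moreover have "induce_subgraph (with_proj D) (set vs) = app_iso ?h (with_proj H)"
  proof -
    have "{e \<in> parcs D. fst e \<in> set vs \<and> snd e \<in> set vs} = map_prod f f ` parcs H"
    proof (intro equalityI subsetI)
      fix e assume e: "e \<in> {e \<in> parcs D. fst e \<in> set vs \<and> snd e \<in> set vs}"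
      obtain u v where uv: "e = (u, v)" by fastforce
      with e have "u \<in> f ` pverts H" "v \<in> f ` pverts H" using assms(2) by auto
      then obtain x y where "x \<in> pverts H" "y \<in> pverts H" "u = f x" "v = f y" by blast
      with e uv arc show "e \<in> map_prod f f ` parcs H" by force
    next
      fix e assume "e \<in> map_prod f f ` parcs H"
      then obtain x y where xy: "(x, y) \<in> parcs H" "e = (f x, f y)" by auto
      with wf have "x \<in> pverts H" "y \<in> pverts H" by auto
      with arc xy assms(2) show "e \<in> {e \<in> parcs D. fst e \<in> set vs \<and> snd e \<in> set vs}" by auto
    qed
    then show ?thesis
      using assms(2) by (simp add: induce_subgraph_def app_iso_def with_proj_def)
  qed
  ultimately show ?thesis
    using assms(3,4) unfolding induces_copy_def digraph_iso_def by blast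
qed

lemma pcas_zip: "pcas x (zip (x # xs) (xs @ [y])) y"
  by (induction xs arbitrary: x) auto

lemma pawalk_verts_zip: "pawalk_verts x (zip (x # xs) (xs @ [y])) = x # xs @ [y]"
  by (induction xs arbitrary: x) auto

text \<open>The cycle is a closed walk from the first vertex. Pairing \<open>vs\<close> with
  \<open>rotate1 vs\<close> lists its arcs including the closing one, and the modulus in the
  hypothesis is the same rotation seen through indices.\<close>

lemma directed_nonloop_cycleI:
  assumes "distinct vs" "2 \<le> length vs" "set vs \<subseteq> pverts D"
    and arcs: "\<And>i. i < length vs \<Longrightarrow> (vs ! i, vs ! (Suc i mod length vs)) \<in> parcs D"
  shows "directed_nonloop_cycle D vs"
proof -
  from assms(2) obtain x xs where vs: "vs = x # xs" by (cases vs) auto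
  have "set (zip vs (rotate1 vs)) \<subseteq> parcs D"
    using arcs by (auto simp: set_zip nth_rotate1)
  then have "pre_digraph.cycle (with_proj D) (zip vs (rotate1 vs))"
    using assms(1,3) pcas_zip[of x xs x] pawalk_verts_zip[of x xs x] vs
    unfolding pre_digraph.cycle_def pre_digraph.awalk_def
    by (intro exI[of _ x]) (auto simp: cas_with_proj_eq awalk_verts_with_proj_eq)
  with assms(2) show ?thesis by (simp add: directed_nonloop_cycle_def)
qed

section \<open>Adjacency in the underlying graph and its two obstructions\<close>

definition adjacent :: "'a pair_pre_digraph \<Rightarrow> 'a \<Rightarrow> 'a \<Rightarrow> bool" where
  "adjacent D u v \<longleftrightarrow> u \<noteq> v \<and> ((u, v) \<in> parcs D \<or> (v, u) \<in> parcs D)"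

lemma adjacent_sym: "adjacent D u v \<longleftrightarrow> adjacent D v u"
  by (auto simp: adjacent_def)

lemma underlying_graph_simps [simp]:
  "pverts (underlying_graph D) = pverts D"
  "(u, v) \<in> parcs (underlying_graph D) \<longleftrightarrow> adjacent D u v"
  by (auto simp: underlying_graph_def adjacent_def parcs_mk_symmetric intro: bexI[of _ "(v, u)"])

lemma induces_K1_plus_K2:
  assumes "{x, u, v} \<subseteq> pverts D" "adjacent D u v" "x \<noteq> u" "x \<noteq> v" "\<not> adjacent D x u" "\<not> adjacent D x v"
  shows "induces_copy (underlying_graph D) [x, u, v] K1_plus_K2"
proof -
  have "u \<noteq> v" using assms(2) by (simp add: adjacent_def)
  show ?thesis
  proof (rule induces_copyI[where f = "(!) [x, u, v]"])
    show "inj_on ((!) [x, u, v]) (pverts K1_plus_K2)"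
      using assms \<open>u \<noteq> v\<close> by (auto simp: K1_plus_K2_def inj_on_def)
    show "((!) [x, u, v] a, (!) [x, u, v] b) \<in> parcs (underlying_graph D) \<longleftrightarrow> (a, b) \<in> parcs K1_plus_K2"
      if "a \<in> pverts K1_plus_K2" "b \<in> pverts K1_plus_K2" for a b
    proof -
      have adj: "adjacent D v u" "\<not> adjacent D u x" "\<not> adjacent D v x" "\<not> adjacent D y y" for y
        using assms by (auto simp: adjacent_def)
      have "a \<in> {0, 1, 2}" "b \<in> {0, 1, 2}" using that by (auto simp: K1_plus_K2_def)
      then show ?thesis
        by (elim insertE emptyE; simp add: K1_plus_K2_def adj assms)
    qed
  qed (use assms \<open>u \<noteq> v\<close> in \<open>auto simp: K1_plus_K2_def\<close>)
qed

lemma induces_C4: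
  assumes "{a, b, c, d} \<subseteq> pverts D" "adjacent D a b" "adjacent D b c" "adjacent D c d" "adjacent D d a"
    "a \<noteq> c" "b \<noteq> d" "\<not> adjacent D a c" "\<not> adjacent D b d"
  shows "induces_copy (underlying_graph D) [a, b, c, d] C4"
proof -
  have ne: "a \<noteq> b" "b \<noteq> c" "c \<noteq> d" "d \<noteq> a" using assms by (auto simp: adjacent_def)
  have less4: "i < 4 \<longleftrightarrow> i = 0 \<or> i = 1 \<or> i = 2 \<or> i = 3" for i :: nat by auto
  have set4: "{..<4::nat} = {0, 1, 2, 3}" by auto
  show ?thesis
  proof (rule induces_copyI[where f = "(!) [a, b, c, d]"])
    show "inj_on ((!) [a, b, c, d]) (pverts C4)"
      using assms ne by (auto simp: C4_def inj_on_def less4)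
    show "((!) [a, b, c, d] x, (!) [a, b, c, d] y) \<in> parcs (underlying_graph D) \<longleftrightarrow> (x, y) \<in> parcs C4"
      if "x \<in> pverts C4" "y \<in> pverts C4" for x y
    proof -
      have adj: "adjacent D b a" "adjacent D c b" "adjacent D d c" "adjacent D a d" "\<not> adjacent D c a"
          "\<not> adjacent D d b" "\<not> adjacent D z z" for z
        using assms by (auto simp: adjacent_def)
      have "x \<in> {0, 1, 2, 3}" "y \<in> {0, 1, 2, 3}" using that by (auto simp: C4_def)
      then show ?thesis
        by (elim insertE emptyE; simp add: C4_def adj assms)
    qed
  qed (use assms ne in \<open>auto simp: C4_def set4\<close>)
qed

section \<open>Strong orderings\<close>

text \<open>For refuting orderings: a numbering of the vertices can be compared with other structure
  on them, which list indices cannot.\<close>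

lemma strong_ordering_position:
  assumes "strong_ordering D vs"
  obtains g :: "'a \<Rightarrow> nat" where "inj_on g (pverts D)"
    and "\<And>x y z w. x \<in> pverts D \<Longrightarrow> y \<in> pverts D \<Longrightarrow> z \<in> pverts D \<Longrightarrow> w \<in> pverts D \<Longrightarrow>
      g x < g y \<Longrightarrow> g z < g w \<Longrightarrow>
      (x, z) \<in> parcs D \<Longrightarrow> (x, w) \<in> parcs D \<Longrightarrow> (y, z) \<in> parcs D \<Longrightarrow> (y, w) \<in> parcs D"
proof
  have vs: "distinct vs" "set vs = pverts D" using assms by (auto simp: strong_ordering_def)
  define g where "g = inv_into {..<length vs} ((!) vs)"
  have bij: "bij_betw ((!) vs) {..<length vs} (pverts D)"
    using vs by (intro bij_betw_nth) auto
  have g: "g x < length vs \<and> vs ! g x = x" if "x \<in> pverts D" for x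
    using that bij_betw_inv_into_right[OF bij that] bij_betwE[OF bij_betw_inv_into[OF bij]]
    by (auto simp: g_def)
  show "inj_on g (pverts D)" using g by (metis inj_onI)
  fix x y z w
  assume "x \<in> pverts D" "y \<in> pverts D" "z \<in> pverts D" "w \<in> pverts D" "g x < g y" "g z < g w"
    "(x, z) \<in> parcs D" "(x, w) \<in> parcs D" "(y, z) \<in> parcs D"
  with assms g show "(y, w) \<in> parcs D" unfolding strong_ordering_def by metis
qed

text \<open>For building orderings: once a list is sorted by \<open>R\<close>, the condition is
  checked on related vertices and indices disappear.\<close>

lemma strong_ordering_if_sorted_wrt:
  assumes "sorted_wrt R vs" "distinct vs" "set vs = pverts D"
    and "\<And>x y z w. x \<in> pverts D \<Longrightarrow> y \<in> pverts D \<Longrightarrow> z \<in> pverts D \<Longrightarrow> w \<in> pverts D \<Longrightarrow>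
      R x y \<Longrightarrow> R z w \<Longrightarrow>
      (x, z) \<in> parcs D \<Longrightarrow> (x, w) \<in> parcs D \<Longrightarrow> (y, z) \<in> parcs D \<Longrightarrow> (y, w) \<in> parcs D"
  shows "strong_ordering D vs"
  unfolding strong_ordering_def
proof (intro conjI allI impI)
  fix i j k l
  assume *: "i < j \<and> j < length vs \<and> k < l \<and> l < length vs \<and>
    (vs ! i, vs ! k) \<in> parcs D \<and> (vs ! i, vs ! l) \<in> parcs D \<and> (vs ! j, vs ! k) \<in> parcs D"
  then have "R (vs ! i) (vs ! j)" "R (vs ! k) (vs ! l)"
    using assms(1) by (auto simp: sorted_wrt_iff_nth_less)
  moreover have "vs ! i \<in> pverts D" "vs ! j \<in> pverts D" "vs ! k \<in> pverts D" "vs ! l \<in> pverts D"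
    using * assms(3) by (metis nth_mem order.strict_trans)+
  ultimately show "(vs ! j, vs ! l) \<in> parcs D" using * assms(4) by blast
qed (use assms in auto)

section \<open>Reflexive multipartite tournaments\<close>

text \<open>Distinct non-adjacent vertices lie in one part. The last fact is the absence of an
  induced \<open>K1_plus_K2\<close>: a vertex that misses both ends of an edge would put them into
  the same part.\<close>

lemma reflexive_multipartite_tournamentD:
  assumes "reflexive_multipartite_tournament D"
  shows "v \<in> pverts D \<Longrightarrow> (v, v) \<in> parcs D"
    and "(u, v) \<in> parcs D \<Longrightarrow> u \<in> pverts D \<and> v \<in> pverts D"
    and "(u, v) \<in> parcs D \<Longrightarrow> u \<noteq> v \<Longrightarrow> (v, u) \<notin> parcs D"
    and "adjacent D u v \<Longrightarrow> x \<in> pverts D \<Longrightarrow> x \<noteq> u \<Longrightarrow> x \<noteq> v \<Longrightarrow> adjacent D x u \<or> adjacent D x v"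
proof -
  obtain G O' P where P: "partition_on (pverts G) P"
    "parcs G = {(u, v). u \<in> pverts G \<and> v \<in> pverts G \<and> \<not> (\<exists>X\<in>P. u \<in> X \<and> v \<in> X)}"
    and O': "orientation_of O' G" and D: "pverts D = pverts G" "parcs D = O' \<union> Id_on (pverts G)"
    using assms unfolding reflexive_multipartite_tournament_def complete_multipartite_def by blast
  show "(v, v) \<in> parcs D" if "v \<in> pverts D" for v using that D by auto
  have O'1: "O' \<subseteq> parcs G" and O'2: "(u, v) \<in> parcs G \<Longrightarrow> ((u, v) \<in> O') \<noteq> ((v, u) \<in> O')" for u v
    using O' by (auto simp: orientation_of_def)
  show "u \<in> pverts D \<and> v \<in> pverts D" if "(u, v) \<in> parcs D" for u v
    using that D O'1 P(2) by auto
  show "(v, u) \<notin> parcs D" if "(u, v) \<in> parcs D" "u \<noteq> v" for u v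
  proof -
    from that D have "(u, v) \<in> O'" by auto
    with O'1 O'2 have "(v, u) \<notin> O'" by blast
    with that D show ?thesis by auto
  qed
  have adj: "adjacent D u v \<longleftrightarrow> u \<noteq> v \<and> u \<in> pverts D \<and> v \<in> pverts D \<and> \<not> (\<exists>X\<in>P. u \<in> X \<and> v \<in> X)" for u v
  proof -
    have "adjacent D u v \<longleftrightarrow> u \<noteq> v \<and> ((u, v) \<in> O' \<or> (v, u) \<in> O')" using D by (auto simp: adjacent_def)
    also have "\<dots> \<longleftrightarrow> u \<noteq> v \<and> (u, v) \<in> parcs G" using O'1 O'2[of u v] P(2) by auto
    finally show ?thesis using P(2) D by auto
  qed
  show "adjacent D x u \<or> adjacent D x v" if "adjacent D u v" "x \<in> pverts D" "x \<noteq> u" "x \<noteq> v" for u v x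
  proof (rule ccontr)
    assume "\<not> ?thesis"
    with that adj obtain X Y where "X \<in> P" "Y \<in> P" "x \<in> X" "u \<in> X" "x \<in> Y" "v \<in> Y" by metis
    moreover from this have "X = Y" using P(1) by (auto simp: partition_on_def disjoint_def)
    ultimately show False using that adj by metis
  qed
qed

text \<open>
  The first vertex \<open>v\<close> of \<open>C\<close> in a strong ordering can be bypassed: \<open>u \<rightarrow> v \<rightarrow> w\<close> and the loop at
  \<open>v\<close> give \<open>u \<rightarrow> w\<close>.
\<close>

lemma no_strong_ordering_if_all_have_successor:
  assumes "reflexive_multipartite_tournament D" "strongly_chordal D"
    and "finite C" "C \<noteq> {}" "C \<subseteq> pverts D" "\<And>x. x \<in> C \<Longrightarrow> \<exists>y\<in>C. y \<noteq> x \<and> (x, y) \<in> parcs D"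
  shows False
proof -
  note rmt = reflexive_multipartite_tournamentD[OF assms(1)]
  obtain vs where "strong_ordering D vs" using assms(2) by (auto simp: strongly_chordal_def)
  then obtain g :: "'a \<Rightarrow> nat" where inj: "inj_on g (pverts D)"
    and g: "\<And>x y z w. x \<in> pverts D \<Longrightarrow> y \<in> pverts D \<Longrightarrow> z \<in> pverts D \<Longrightarrow> w \<in> pverts D \<Longrightarrow>
      g x < g y \<Longrightarrow> g z < g w \<Longrightarrow>
      (x, z) \<in> parcs D \<Longrightarrow> (x, w) \<in> parcs D \<Longrightarrow> (y, z) \<in> parcs D \<Longrightarrow> (y, w) \<in> parcs D"
    by (rule strong_ordering_position) blast
  show False
    using assms(3-6)
  proof (induction "card C" arbitrary: C rule: less_induct)
    case less
    define v where "v = arg_min_on g C"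
    have v: "v \<in> C" "\<And>x. x \<in> C \<Longrightarrow> g v \<le> g x"
      using arg_min_if_finite[OF less.prems(1,2), of g] arg_min_least[OF less.prems(1,2), of _ g] unfolding v_def by auto
    then have min: "g v < g x" if "x \<in> C" "x \<noteq> v" for x
      using that inj less.prems(3) by (metis inj_onD le_neq_implies_less subsetD)
    obtain w where w: "w \<in> C" "w \<noteq> v" "(v, w) \<in> parcs D" using less.prems(4) v by blast
    show False
    proof (rule less.hyps[of "C - {v}"])
      show "card (C - {v}) < card C" using less.prems v by (metis card_Diff1_less)
      show "\<exists>y\<in>C - {v}. y \<noteq> x \<and> (x, y) \<in> parcs D" if x: "x \<in> C - {v}" for x
      proof -
        obtain y where y: "y \<in> C" "y \<noteq> x" "(x, y) \<in> parcs D" using less.prems(4) x by blast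
        show ?thesis
        \<comment> \<open>An arc from \<open>x\<close> to the removed vertex \<open>v\<close> is
          replaced by one to \<open>w\<close>. If \<open>w\<close> were \<open>x\<close>, then
          \<open>x\<close> and \<open>v\<close> would form a two-cycle, which a tournament excludes;
          so the new arc is no loop.\<close>
        proof (cases "y = v")
          case True
          then have "(x, w) \<in> parcs D"
            using g[of v x v w] min x y w v less.prems(3) rmt(1) by blast
          moreover have "w \<noteq> x" using y True w rmt(3) by blast
          ultimately show ?thesis using w by blast
        qed (use y in blast)
      qed
    qed (use less.prems w v in auto)
  qed
qed

text \<open>The neighbours of a vertex that come later in a strong ordering form a clique, whatever
  the orientation. The earliest vertex of an induced four-cycle contradicts this, as its two
  neighbours there are later and not adjacent.\<close>

lemma no_strong_ordering_C4:
  assumes "reflexive_multipartite_tournament D"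
    and "adjacent D a b" "adjacent D b c" "adjacent D c d" "adjacent D d a"
    "a \<noteq> c" "b \<noteq> d" "\<not> adjacent D a c" "\<not> adjacent D b d"
  shows "\<not> strongly_chordal D"
proof
  assume "strongly_chordal D"
  note rmt = reflexive_multipartite_tournamentD[OF assms(1)]
  obtain vs where "strong_ordering D vs" using \<open>strongly_chordal D\<close> by (auto simp: strongly_chordal_def)
  then obtain g :: "'a \<Rightarrow> nat" where inj: "inj_on g (pverts D)"
    and g: "\<And>x y z w. x \<in> pverts D \<Longrightarrow> y \<in> pverts D \<Longrightarrow> z \<in> pverts D \<Longrightarrow> w \<in> pverts D \<Longrightarrow>
      g x < g y \<Longrightarrow> g z < g w \<Longrightarrow>
      (x, z) \<in> parcs D \<Longrightarrow> (x, w) \<in> parcs D \<Longrightarrow> (y, z) \<in> parcs D \<Longrightarrow> (y, w) \<in> parcs D"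
    by (rule strong_ordering_position) blast
  have simplicial: "adjacent D x y" if "adjacent D v x" "adjacent D v y" "x \<noteq> y" "g v < g x" "g x < g y" for v x y
  proof -
    have V: "v \<in> pverts D" "x \<in> pverts D" "y \<in> pverts D" and ne: "x \<noteq> v" "y \<noteq> v"
      using that(1,2) rmt(2) by (auto simp: adjacent_def)
    note L = rmt(1)[OF V(1)] rmt(1)[OF V(2)] rmt(1)[OF V(3)]
    have less: "g v < g y" using that(4,5) by simp
    have "(v, x) \<in> parcs D \<or> (x, v) \<in> parcs D" "(v, y) \<in> parcs D \<or> (y, v) \<in> parcs D"
      using that(1,2) by (auto simp: adjacent_def)
    then have "(x, y) \<in> parcs D \<or> (y, x) \<in> parcs D"
    \<comment> \<open>In each orientation the arcs at \<open>v\<close>, together with the loop at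
      \<open>v\<close> or at \<open>x\<close>, fill three corners of the strong ordering condition;
      the fourth corner is an arc between \<open>x\<close> and \<open>y\<close>.\<close>
    proof (elim disjE)
      assume "(v, x) \<in> parcs D" "(v, y) \<in> parcs D"
      then show ?thesis using g[of v x x y] that(4,5) V L by simp
    next
      assume "(v, x) \<in> parcs D" "(y, v) \<in> parcs D"
      then show ?thesis using g[of v y v x] that(4) less V L by simp
    next
      assume "(x, v) \<in> parcs D" "(v, y) \<in> parcs D"
      then show ?thesis using g[of v x v y] that(4) less V L by simp
    next
      assume "(x, v) \<in> parcs D" "(y, v) \<in> parcs D"
      then show ?thesis using g[of x y v x] that(4,5) V L by simp
    qed
    with that(3) show ?thesis by (auto simp: adjacent_def)
  qed
  have V: "a \<in> pverts D" "b \<in> pverts D" "c \<in> pverts D" "d \<in> pverts D"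
    using assms(2-5) rmt(2) by (auto simp: adjacent_def)
  have ne: "a \<noteq> b" "b \<noteq> c" "c \<noteq> d" "d \<noteq> a" using assms by (auto simp: adjacent_def)
  then have gne: "g a \<noteq> g b" "g b \<noteq> g c" "g c \<noteq> g d" "g d \<noteq> g a" "g a \<noteq> g c" "g b \<noteq> g d"
    using V inj assms(6,7) by (metis inj_onD)+
  have sim: "\<not> (g v < g x \<and> g v < g y)"
    if "adjacent D v x" "adjacent D v y" "x \<noteq> y" "\<not> adjacent D x y" "g x \<noteq> g y" for v x y
  proof
    assume less: "g v < g x \<and> g v < g y"
    from that(5) consider "g x < g y" | "g y < g x" by linarith
    then show False
    proof cases
      case 1
      then show ?thesis using simplicial[OF that(1,2,3)] less that(4) by simp
    next
      case 2
      have "y \<noteq> x" using that(3) by simp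
      then have "adjacent D y x" using simplicial[OF that(2,1)] less 2 by simp
      then show ?thesis using that(4) adjacent_sym[of D x y] by simp
    qed
  qed
  have adj: "adjacent D b a" "adjacent D c b" "adjacent D d c" "adjacent D a d"
    using assms by (auto simp: adjacent_def)
  have "\<not> (g a < g b \<and> g a < g d)" "\<not> (g b < g a \<and> g b < g c)" "\<not> (g c < g b \<and> g c < g d)"
     "\<not> (g d < g a \<and> g d < g c)"
    using sim adj assms(2-9) gne by simp_all
  with gne show False by linarith
qed

section \<open>Digraphs described by a word\<close>

text \<open>
  \<open>q\<close> lists the vertices topologically, and \<open>S x\<close> says that the vertex at position \<open>x\<close> belongs to
  the independent set. These are the digraphs \<open>T\<^sub>c\<close>, with \<open>c\<close> counting the elements of \<open>S\<close>
  between consecutive vertices of the tournament.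
\<close>

locale layered =
  fixes D :: "'a pair_pre_digraph" and q :: "nat \<Rightarrow> 'a" and n :: nat and S :: "nat \<Rightarrow> bool"
  assumes bij: "bij_betw q {..<n} (pverts D)"
    and wf: "(u, v) \<in> parcs D \<Longrightarrow> u \<in> pverts D \<and> v \<in> pverts D"
    and arcs: "x < n \<Longrightarrow> y < n \<Longrightarrow> (q x, q y) \<in> parcs D \<longleftrightarrow> x = y \<or> x < y \<and> \<not> (S x \<and> S y)"
begin

lemma inj: "x < n \<Longrightarrow> y < n \<Longrightarrow> q x = q y \<longleftrightarrow> x = y"
  using bij by (auto simp: bij_betw_def inj_on_def)

lemma vertexE:
  assumes "v \<in> pverts D"
  obtains x where "x < n" "v = q x"
  using assms bij by (auto simp: bij_betw_def)

lemma q_vertex: "x < n \<Longrightarrow> q x \<in> pverts D"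
  using bij by (auto simp: bij_betw_def)

lemma rmt: "reflexive_multipartite_tournament D"
proof -
  define I where "I = q ` {x. x < n \<and> S x}"
  \<comment> \<open>Dropping \<open>{}\<close> matters when no position satisfies \<open>S\<close>:
    then \<open>I\<close> is empty, and a partition has no empty part.\<close>
  define P where "P = ((\<lambda>x. {x}) ` (pverts D - I) \<union> {I}) - {{}}"
  define G where "G = \<lparr> pverts = pverts D,
    parcs = {(u, v). u \<in> pverts D \<and> v \<in> pverts D \<and> u \<noteq> v \<and> \<not> (u \<in> I \<and> v \<in> I)} \<rparr>"
  have I: "I \<subseteq> pverts D" by (auto simp: I_def q_vertex)
  have P: "(\<exists>X\<in>P. u \<in> X \<and> v \<in> X) \<longleftrightarrow> u \<in> pverts D \<and> (u = v \<or> u \<in> I \<and> v \<in> I)" for u v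
    unfolding P_def using I by blast
  have "complete_multipartite G"
    unfolding complete_multipartite_def
  proof (intro exI conjI)
    show "partition_on (pverts G) P"
      using I by (auto simp: partition_on_def disjoint_def P_def G_def)
    show "parcs G = {(u, v). u \<in> pverts G \<and> v \<in> pverts G \<and> \<not> (\<exists>X\<in>P. u \<in> X \<and> v \<in> X)}"
      unfolding P by (auto simp: G_def)
  qed
  moreover have qI: "q x \<in> I \<longleftrightarrow> S x" if "x < n" for x
    using that inj by (auto simp: I_def)
  moreover have "orientation_of (parcs D - Id) G"
    unfolding orientation_of_def
  proof (intro conjI subsetI ballI)
    fix e assume e: "e \<in> parcs D - Id"
    obtain u v where uv: "e = (u, v)" by fastforce
    with e wf obtain x y where "x < n" "u = q x" "y < n" "v = q y" by (metis Diff_iff vertexE)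
    with e uv arcs[of x y] qI show "e \<in> parcs G" by (auto simp: G_def q_vertex)
  next
    fix e assume e: "e \<in> parcs G"
    obtain u v where uv: "e = (u, v)" by fastforce
    with e obtain x y where "x < n" "u = q x" "y < n" "v = q y"
      by (metis (no_types, lifting) G_def case_prodD mem_Collect_eq pair_pre_digraph.select_convs(2) vertexE)
    with e uv arcs[of x y] arcs[of y x] qI inj[of x y] inj[of y x]
    show "case e of (u, v) \<Rightarrow> ((u, v) \<in> parcs D - Id) \<noteq> ((v, u) \<in> parcs D - Id)"
      by (auto simp: G_def)
  qed
  moreover have "parcs D = parcs D - Id \<union> Id_on (pverts G)"
  proof -
    have "(u, u) \<in> parcs D" if "u \<in> pverts D" for u
      using that arcs by (auto elim!: vertexE)
    moreover have "u \<in> pverts D" if "(u, u) \<in> parcs D" for u using that wf by blast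
    ultimately show ?thesis by (auto simp: G_def)
  qed
  ultimately show ?thesis
    unfolding reflexive_multipartite_tournament_def
    by (intro exI[of _ G] exI[of _ "parcs D - Id"]) (simp add: G_def)
qed

abbreviation E :: "nat \<Rightarrow> nat \<Rightarrow> bool" where
  "E x y \<equiv> x = y \<or> x < y \<and> \<not> (S x \<and> S y)"

lemma strong_ordering_map:
  assumes "sorted_wrt R ps" "distinct ps" "set ps = {..<n}"
    and R: "\<And>x y z w. x < n \<Longrightarrow> y < n \<Longrightarrow> z < n \<Longrightarrow> w < n \<Longrightarrow> R x y \<Longrightarrow> R z w \<Longrightarrow>
      E x z \<Longrightarrow> E x w \<Longrightarrow>
      E y z \<Longrightarrow> E y w"
  shows "strong_ordering D (map q ps)"
proof (rule strong_ordering_if_sorted_wrt)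
  let ?R = "\<lambda>u v. \<exists>x y. x < n \<and> y < n \<and> u = q x \<and> v = q y \<and> R x y"
  show "sorted_wrt ?R (map q ps)"
    using assms(1) unfolding sorted_wrt_map
    by (rule sorted_wrt_mono_rel[rotated]) (use assms(3) in auto)
  show "distinct (map q ps)" "set (map q ps) = pverts D"
    using assms(2,3) bij by (auto simp: distinct_map bij_betw_def)
  fix u v s t
  assume *: "u \<in> pverts D" "v \<in> pverts D" "s \<in> pverts D" "t \<in> pverts D" "?R u v" "?R s t"
    "(u, s) \<in> parcs D" "(u, t) \<in> parcs D" "(v, s) \<in> parcs D"
  then obtain x y z w where "x < n" "y < n" "u = q x" "v = q y" "R x y"
    "z < n" "w < n" "s = q z" "t = q w" "R z w" by blast
  with * arcs R[of x y z w] show "(v, t) \<in> parcs D" by simp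
qed

definition strong_position :: "(nat \<Rightarrow> nat) \<Rightarrow> bool" where
  "strong_position g \<longleftrightarrow> inj_on g {..<n} \<and>
    (\<forall>x<n. \<forall>y<n. \<forall>z<n. \<forall>w<n. g x < g y \<longrightarrow> g z < g w \<longrightarrow>
      E x z \<longrightarrow> E x w \<longrightarrow>
      E y z \<longrightarrow> E y w)"

lemma strong_positionE:
  assumes "strongly_chordal D"
  obtains g where "strong_position g"
proof -
  obtain vs where "strong_ordering D vs" using assms by (auto simp: strongly_chordal_def)
  then obtain h :: "'a \<Rightarrow> nat" where h: "inj_on h (pverts D)"
    and gam: "\<And>x y z w. x \<in> pverts D \<Longrightarrow> y \<in> pverts D \<Longrightarrow> z \<in> pverts D \<Longrightarrow> w \<in> pverts D \<Longrightarrow>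
      h x < h y \<Longrightarrow> h z < h w \<Longrightarrow>
      (x, z) \<in> parcs D \<Longrightarrow> (x, w) \<in> parcs D \<Longrightarrow> (y, z) \<in> parcs D \<Longrightarrow> (y, w) \<in> parcs D"
    by (rule strong_ordering_position) blast
  have "strong_position (\<lambda>x. h (q x))"
    unfolding strong_position_def
  proof (intro conjI allI impI)
    show "inj_on (\<lambda>x. h (q x)) {..<n}"
    proof (rule inj_onI)
      fix x y assume xy: "x \<in> {..<n}" "y \<in> {..<n}" "h (q x) = h (q y)"
      then have "q x = q y" using inj_onD[OF h xy(3)] q_vertex by simp
      with xy inj show "x = y" by simp
    qed
    fix x y z w
    assume "x < n" "y < n" "z < n" "w < n" "h (q x) < h (q y)" "h (q z) < h (q w)"
      "E x z" "E x w" "E y z"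
    then show "E y w"
      using gam[of "q x" "q y" "q z" "q w"] arcs[of x z] arcs[of x w] arcs[of y z] arcs[of y w] q_vertex
      by simp
  qed
  then show ?thesis by (rule that)
qed

section \<open>Comparing a strong ordering with the topological order\<close>

context
  fixes g assumes g: "strong_position g"
begin

lemma position_linear: "x < n \<Longrightarrow> y < n \<Longrightarrow> x \<noteq> y \<Longrightarrow> g x < g y \<or> g y < g x"
  using g unfolding strong_position_def inj_on_def by (metis lessThan_iff linorder_neqE_nat)

lemma position_gamma:
  "x < n \<Longrightarrow> y < n \<Longrightarrow> z < n \<Longrightarrow> w < n \<Longrightarrow> g x < g y \<Longrightarrow> g z < g w \<Longrightarrow>
    E x z \<Longrightarrow> E x w \<Longrightarrow>
    E y z \<Longrightarrow> E y w"
  using g[unfolded strong_position_def, THEN conjunct2, rule_format, of x y z w] .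

text \<open>If \<open>t\<close> preceded both twins, the earlier twin would have its loop and an arc
  to \<open>t\<close>, and the later one an arc to \<open>t\<close>. This forces an arc between two
  elements of \<open>S\<close>.\<close>

lemma position_left_twins:
  assumes "s < t" "s' < t" "s \<noteq> s'" "t < n" "S s" "S s'" "\<not> S t"
  shows "g s < g t \<or> g s' < g t"
  using assms position_linear[of s s'] position_linear[of s t] position_linear[of s' t]
    position_gamma[of s s' t s] position_gamma[of s' s t s'] by auto

text \<open>The transposed situation: \<open>t\<close> has arcs to both twins and the earlier twin
  has its loop, which again forces an arc inside \<open>S\<close>.\<close>

lemma position_right_twins:
  assumes "t < s" "t < s'" "s \<noteq> s'" "s < n" "s' < n" "S s" "S s'" "\<not> S t"
  shows "g s < g t \<or> g s' < g t"
  using assms position_linear[of s s'] position_linear[of s t] position_linear[of s' t]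
    position_gamma[of t s s s'] position_gamma[of t s' s' s] by auto

text \<open>If \<open>u\<close> came before \<open>t\<close>, the arcs from \<open>s\<close> to
  \<open>u\<close> and \<open>t\<close> and the loop at \<open>u\<close> would force the backward
  arc from \<open>u\<close> to \<open>t\<close>.\<close>

lemma position_ascending:
  assumes "s < t" "t < u" "u < n" "S s" "\<not> S t" "\<not> S u" "g s < g u"
  shows "g t < g u"
  using assms position_linear[of t u] position_gamma[of s u u t] by auto

text \<open>If \<open>t\<close> came before \<open>u\<close>, the arcs from \<open>t\<close> and
  \<open>u\<close> to \<open>s\<close> and the loop at \<open>t\<close> would force the backward arc
  from \<open>u\<close> to \<open>t\<close>.\<close>

lemma position_descending:
  assumes "t < u" "u < s" "s < n" "S s" "\<not> S t" "\<not> S u" "g s < g t"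
  shows "g u < g t"
  using assms position_linear[of t u] position_gamma[of t u s t] by auto

text \<open>A vertex that precedes both of its neighbours can be bypassed, and bypassing
  \<open>t\<close> would give an arc from \<open>s\<close> to \<open>u\<close> inside
  \<open>S\<close>.\<close>

lemma position_between:
  assumes "s < t" "t < u" "u < n" "S s" "\<not> S t" "S u"
  shows "\<not> (g t < g s \<and> g t < g u)"
  using assms position_gamma[of t s t u] by auto

end

text \<open>One of the left twins precedes \<open>u\<close>, so \<open>t\<close> precedes
  \<open>u\<close>; one of the right twins precedes \<open>t\<close>, so \<open>u\<close> precedes
  \<open>t\<close>.\<close>

lemma not_strongly_chordal_T202:
  assumes "a < a'" "a' < t" "t < u" "u < b" "b < b'" "b' < n"
    and "S a" "S a'" "\<not> S t" "\<not> S u" "S b" "S b'"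
  shows "\<not> strongly_chordal D"
proof
  assume "strongly_chordal D"
  then obtain g where g: "strong_position g" by (rule strong_positionE)
  note F1 = position_left_twins[OF g] and F2 = position_right_twins[OF g]
    and F3 = position_ascending[OF g] and F4 = position_descending[OF g]
    and F5 = position_between[OF g] and lin = position_linear[OF g]
  have "g a < g u \<or> g a' < g u" by (rule F1) (use assms in simp_all)
  moreover have "g a < g u \<Longrightarrow> g t < g u" by (rule F3[of a]) (use assms in simp_all)
  moreover have "g a' < g u \<Longrightarrow> g t < g u" by (rule F3[of a']) (use assms in simp_all)
  moreover have "g b < g t \<or> g b' < g t" by (rule F2) (use assms in simp_all)
  moreover have "g b < g t \<Longrightarrow> g u < g t" by (rule F4[of _ _ b]) (use assms in simp_all)
  moreover have "g b' < g t \<Longrightarrow> g u < g t" by (rule F4[of _ _ b']) (use assms in simp_all)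
  ultimately show False by linarith
qed

text \<open>The twins on either side force \<open>t2\<close> before both \<open>t1\<close> and
  \<open>t3\<close>. But \<open>t2\<close> cannot precede both \<open>s0\<close> and
  \<open>s3\<close>; if \<open>s0\<close> is earlier then \<open>t1\<close> precedes
  \<open>t2\<close>, and if \<open>s3\<close> is earlier then \<open>t3\<close> precedes
  \<open>t2\<close>.\<close>

lemma not_strongly_chordal_T1111:
  assumes "s0 < t1" "t1 < s1" "s1 < t2" "t2 < s2" "s2 < t3" "t3 < s3" "s3 < n"
    and "S s0" "S s1" "S s2" "S s3" "\<not> S t1" "\<not> S t2" "\<not> S t3"
  shows "\<not> strongly_chordal D"
proof
  assume "strongly_chordal D"
  then obtain g where g: "strong_position g" by (rule strong_positionE)
  note F1 = position_left_twins[OF g] and F2 = position_right_twins[OF g]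
    and F3 = position_ascending[OF g] and F4 = position_descending[OF g]
    and F5 = position_between[OF g] and lin = position_linear[OF g]
  have "g s0 < g t3 \<or> g s1 < g t3" by (rule F1) (use assms in simp_all)
  moreover have "g s0 < g t3 \<Longrightarrow> g t2 < g t3" by (rule F3[of s0]) (use assms in simp_all)
  moreover have "g s1 < g t3 \<Longrightarrow> g t2 < g t3" by (rule F3[of s1]) (use assms in simp_all)
  moreover have "g s2 < g t1 \<or> g s3 < g t1" by (rule F2) (use assms in simp_all)
  moreover have "g s2 < g t1 \<Longrightarrow> g t2 < g t1" by (rule F4[of _ _ s2]) (use assms in simp_all)
  moreover have "g s3 < g t1 \<Longrightarrow> g t2 < g t1" by (rule F4[of _ _ s3]) (use assms in simp_all)
  moreover have "g s0 < g t2 \<Longrightarrow> g t1 < g t2" by (rule F3[of s0]) (use assms in simp_all)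
  moreover have "g s3 < g t2 \<Longrightarrow> g t3 < g t2" by (rule F4[of _ _ s3]) (use assms in simp_all)
  moreover have "\<not> (g t2 < g s0 \<and> g t2 < g s3)" by (rule F5) (use assms in simp_all)
  moreover have "g s0 < g t2 \<or> g t2 < g s0" by (rule lin) (use assms in simp_all)
  moreover have "g s3 < g t2 \<or> g t2 < g s3" by (rule lin) (use assms in simp_all)
  ultimately show False by linarith
qed

text \<open>The twins force \<open>t3\<close> before \<open>t4\<close> and \<open>t2\<close> before
  \<open>t1\<close>. By the ascending and descending rules \<open>t2\<close> then precedes
  \<open>s0\<close> and \<open>t3\<close> precedes \<open>s4\<close>. Neither may precede both of
  \<open>s0\<close> and \<open>s4\<close>, which closes the cycle \<open>t2\<close>,
  \<open>s0\<close>, \<open>t3\<close>, \<open>s4\<close>, \<open>t2\<close> of precedences.\<close>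

lemma not_strongly_chordal_T10101:
  assumes "s0 < t1" "t1 < t2" "t2 < s2" "s2 < t3" "t3 < t4" "t4 < s4" "s4 < n"
    and "S s0" "S s2" "S s4" "\<not> S t1" "\<not> S t2" "\<not> S t3" "\<not> S t4"
  shows "\<not> strongly_chordal D"
proof
  assume "strongly_chordal D"
  then obtain g where g: "strong_position g" by (rule strong_positionE)
  note F1 = position_left_twins[OF g] and F2 = position_right_twins[OF g]
    and F3 = position_ascending[OF g] and F4 = position_descending[OF g]
    and F5 = position_between[OF g] and lin = position_linear[OF g]
  have "g s0 < g t4 \<or> g s2 < g t4" by (rule F1) (use assms in simp_all)
  moreover have "g s0 < g t4 \<Longrightarrow> g t3 < g t4" by (rule F3[of s0]) (use assms in simp_all)
  moreover have "g s2 < g t4 \<Longrightarrow> g t3 < g t4" by (rule F3[of s2]) (use assms in simp_all)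
  moreover have "g s2 < g t1 \<or> g s4 < g t1" by (rule F2) (use assms in simp_all)
  moreover have "g s2 < g t1 \<Longrightarrow> g t2 < g t1" by (rule F4[of _ _ s2]) (use assms in simp_all)
  moreover have "g s4 < g t1 \<Longrightarrow> g t2 < g t1" by (rule F4[of _ _ s4]) (use assms in simp_all)
  moreover have "g s0 < g t2 \<Longrightarrow> g t1 < g t2" by (rule F3[of s0]) (use assms in simp_all)
  moreover have "g s4 < g t3 \<Longrightarrow> g t4 < g t3" by (rule F4[of _ _ s4]) (use assms in simp_all)
  moreover have "g s0 < g t2 \<or> g t2 < g s0" by (rule lin) (use assms in simp_all)
  moreover have "g s4 < g t3 \<or> g t3 < g s4" by (rule lin) (use assms in simp_all)
  moreover have "g t2 < g t3 \<or> g t3 < g t2" by (rule lin) (use assms in simp_all)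
  moreover have "\<not> (g t2 < g s0 \<and> g t2 < g s4)" by (rule F5) (use assms in simp_all)
  moreover have "\<not> (g t3 < g s0 \<and> g t3 < g s4)" by (rule F5) (use assms in simp_all)
  ultimately show False by linarith
qed

text \<open>Arcs of \<open>T_digraph\<close> depend on the order among tournament vertices and on
  the order between these and \<open>S\<close>. The order inside \<open>S\<close> leaves no trace,
  so there \<open>sp\<close> is only asked to be injective.\<close>

lemma induces_T_digraph:
  assumes T: "\<And>p. p \<in> T_verts c \<Longrightarrow> tp p < n \<and> \<not> S (tp p)"
    and SS: "\<And>x. x \<in> S_verts c \<Longrightarrow> sp x < n \<and> S (sp x)"
    and TT: "\<And>p p'. p \<in> T_verts c \<Longrightarrow> p' \<in> T_verts c \<Longrightarrow> p < p' \<Longrightarrow> tp p < tp p'"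
    and TS: "\<And>p i j. p \<in> T_verts c \<Longrightarrow> (i, j) \<in> S_verts c \<Longrightarrow> p \<le> i \<Longrightarrow> tp p < sp (i, j)"
    and ST: "\<And>p i j. p \<in> T_verts c \<Longrightarrow> (i, j) \<in> S_verts c \<Longrightarrow> i < p \<Longrightarrow> sp (i, j) < tp p"
    and inj_sp: "inj_on sp (S_verts c)"
    and set: "set ps = tp ` T_verts c \<union> sp ` S_verts c" and "distinct ps"
  shows "induces_copy D (map q ps) (T_digraph c)"
proof (rule induces_copyI[where f = "q \<circ> case_sum tp sp"])
  let ?f = "case_sum tp sp" and ?V = "pverts (T_digraph c)"
  have V: "?V = Inl ` T_verts c \<union> Inr ` S_verts c" by (simp add: T_digraph_def)
  have fn: "?f x < n" if "x \<in> ?V" for x using that T SS by (auto simp: V)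
  have inj_tp: "p = p'" if "p \<in> T_verts c" "p' \<in> T_verts c" "tp p = tp p'" for p p'
    using TT[of p p'] TT[of p' p] that by (metis less_irrefl linorder_neqE_nat)
  have inj_f: "inj_on ?f ?V"
  proof (rule inj_onI)
    fix x y assume xy: "x \<in> ?V" "y \<in> ?V" "?f x = ?f y"
    have S: "S (?f x) \<longleftrightarrow> S (?f y)" using xy(3) by simp
    show "x = y"
    proof (cases x; cases y)
      fix p p' assume "x = Inl p" "y = Inl p'"
      with xy show ?thesis by (auto simp: V intro: inj_tp)
    next
      fix z z' assume "x = Inr z" "y = Inr z'"
      moreover from this xy have "z \<in> S_verts c" "z' \<in> S_verts c" "sp z = sp z'" by (auto simp: V)
      ultimately show ?thesis using inj_onD[OF inj_sp] by blast
    next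
      fix p z assume "x = Inl p" "y = Inr z"
      moreover from this xy have "p \<in> T_verts c" "z \<in> S_verts c" by (auto simp: V)
      ultimately show ?thesis using S T SS by simp
    next
      fix p z assume "x = Inr z" "y = Inl p"
      moreover from this xy have "p \<in> T_verts c" "z \<in> S_verts c" by (auto simp: V)
      ultimately show ?thesis using S T SS by simp
    qed
  qed
  show "inj_on (q \<circ> ?f) ?V"
    using inj_f fn inj by (auto intro!: comp_inj_on simp: inj_on_def)
  have set': "set ps = ?f ` ?V" unfolding set V by (simp add: image_Un image_image)
  show "(q \<circ> ?f) ` ?V = set (map q ps)" unfolding set_map set' by (simp add: image_comp)
  show "distinct (map q ps)" using \<open>distinct ps\<close> set' fn inj by (auto simp: distinct_map inj_on_def)
  show "set (map q ps) \<subseteq> pverts D" using set' fn q_vertex by auto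
  show "x \<in> ?V \<and> y \<in> ?V" if "(x, y) \<in> parcs (T_digraph c)" for x y
    using that by (auto simp: T_digraph_def)
  have cmp: "(p < p' \<longleftrightarrow> tp p < tp p') \<and> (p = p' \<longleftrightarrow> tp p = tp p')" if "p \<in> T_verts c" "p' \<in> T_verts c" for p p'
    using TT[of p p'] TT[of p' p] that by (metis less_asym less_irrefl linorder_neqE_nat)
  have cmpS: "(p \<le> i \<longleftrightarrow> tp p < sp (i, j)) \<and> (i < p \<longleftrightarrow> sp (i, j) < tp p) \<and> tp p \<noteq> sp (i, j)"
    if "p \<in> T_verts c" "(i, j) \<in> S_verts c" for p i j
    using TS[OF that] ST[OF that] by (metis less_asym less_irrefl linorder_not_le)
  show "((q \<circ> ?f) x, (q \<circ> ?f) y) \<in> parcs D \<longleftrightarrow> (x, y) \<in> parcs (T_digraph c)" if "x \<in> ?V" "y \<in> ?V" for x y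
  proof -
    have "((q \<circ> ?f) x, (q \<circ> ?f) y) \<in> parcs D \<longleftrightarrow> ?f x = ?f y \<or> ?f x < ?f y \<and> \<not> (S (?f x) \<and> S (?f y))"
      using that fn arcs by simp
    also have "\<dots> \<longleftrightarrow> x = y \<or> ?f x < ?f y \<and> \<not> (S (?f x) \<and> S (?f y))"
      using inj_f that by (metis inj_onD)
    also have "\<dots> \<longleftrightarrow> (x, y) \<in> parcs (T_digraph c)"
    proof (cases x; cases y)
      fix p p' assume xy: "x = Inl p" "y = Inl p'"
      with that have "p \<in> T_verts c" "p' \<in> T_verts c" by (auto simp: V)
      with xy T cmp show ?thesis by (auto simp: T_digraph_def)
    next
      fix p z assume xy: "x = Inl p" "y = Inr z"
      obtain i j where z: "z = (i, j)" by fastforce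
      from xy z that have "p \<in> T_verts c" "(i, j) \<in> S_verts c" by (auto simp: V)
      with xy z T SS cmpS[of p i j] show ?thesis by (auto simp: T_digraph_def)
    next
      fix p z assume xy: "x = Inr z" "y = Inl p"
      obtain i j where z: "z = (i, j)" by fastforce
      from xy z that have "p \<in> T_verts c" "(i, j) \<in> S_verts c" by (auto simp: V)
      with xy z T SS cmpS[of p i j] show ?thesis by (auto simp: T_digraph_def)
    next
      fix z z' assume xy: "x = Inr z" "y = Inr z'"
      with that have "z \<in> S_verts c" "z' \<in> S_verts c" by (auto simp: V)
      with xy SS show ?thesis by (auto simp: T_digraph_def)
    qed
    finally show ?thesis .
  qed
qed

lemma induces_T202:
  assumes "a < a'" "a' < t" "t < u" "u < b" "b < b'" "b' < n"
    and "S a" "S a'" "\<not> S t" "\<not> S u" "S b" "S b'"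
  shows "induces_copy D (map q [a, a', t, u, b, b']) (T_digraph [2, 0, 2])"
proof (rule induces_T_digraph)
  let ?tp = "\<lambda>p. if p = 1 then t else u"
  let ?sp = "\<lambda>(i, j). if i = 0 then (if j = 0 then a else a') else (if j = 0 then b else b')"
  have T: "T_verts [2, 0, 2] = {1, 2}" by (auto simp: T_verts_def)
  have SV: "S_verts [2, 0, 2] = {(0, 0), (0, 1), (2, 0), (2, 1)}"
    by (auto simp: S_verts_def less_Suc_eq numeral_2_eq_2)
  show "set [a, a', t, u, b, b'] = ?tp ` T_verts [2, 0, 2] \<union> ?sp ` S_verts [2, 0, 2]"
    unfolding T SV by auto
  show "inj_on ?sp (S_verts [2, 0, 2])" unfolding SV using assms by auto
qed (use assms in \<open>auto simp: T_verts_def S_verts_def less_Suc_eq numeral_2_eq_2 split: if_splits\<close>)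

lemma induces_T1111:
  assumes "s0 < t1" "t1 < s1" "s1 < t2" "t2 < s2" "s2 < t3" "t3 < s3" "s3 < n"
    and "S s0" "S s1" "S s2" "S s3" "\<not> S t1" "\<not> S t2" "\<not> S t3"
  shows "induces_copy D (map q [s0, t1, s1, t2, s2, t3, s3]) (T_digraph [1, 1, 1, 1])"
proof (rule induces_T_digraph)
  let ?tp = "\<lambda>p. if p = 1 then t1 else if p = 2 then t2 else t3"
  let ?sp = "\<lambda>(i, j :: nat). if i = 0 then s0 else if i = 1 then s1 else if i = 2 then s2 else s3"
  have T: "T_verts [1, 1, 1, 1] = {1, 2, 3}" by (auto simp: T_verts_def)
  have SV: "S_verts [1, 1, 1, 1] = {(0, 0), (1, 0), (2, 0), (3, 0)}"
    by (auto simp: S_verts_def less_Suc_eq numeral_2_eq_2 numeral_3_eq_3)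
  show "set [s0, t1, s1, t2, s2, t3, s3] = ?tp ` T_verts [1, 1, 1, 1] \<union> ?sp ` S_verts [1, 1, 1, 1]"
    unfolding T SV by auto
  show "inj_on ?sp (S_verts [1, 1, 1, 1])" unfolding SV using assms by auto
  fix p i j assume "p \<in> T_verts [1, 1, 1, 1]" "(i, j) \<in> S_verts [1, 1, 1, 1]"
  then show "p \<le> i \<Longrightarrow> ?tp p < ?sp (i, j)" "i < p \<Longrightarrow> ?sp (i, j) < ?tp p"
    unfolding T SV using assms by auto
qed (use assms in \<open>auto simp: T_verts_def S_verts_def split: if_splits\<close>)

lemma induces_T10101:
  assumes "s0 < t1" "t1 < t2" "t2 < s2" "s2 < t3" "t3 < t4" "t4 < s4" "s4 < n"
    and "S s0" "S s2" "S s4" "\<not> S t1" "\<not> S t2" "\<not> S t3" "\<not> S t4"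
  shows "induces_copy D (map q [s0, t1, t2, s2, t3, t4, s4]) (T_digraph [1, 0, 1, 0, 1])"
proof (rule induces_T_digraph)
  let ?tp = "\<lambda>p. if p = 1 then t1 else if p = 2 then t2 else if p = 3 then t3 else t4"
  let ?sp = "\<lambda>(i, j :: nat). if i = 0 then s0 else if i = 2 then s2 else s4"
  have T: "T_verts [1, 0, 1, 0, 1] = {1, 2, 3, 4}" by (auto simp: T_verts_def)
  have SV: "S_verts [1, 0, 1, 0, 1] = {(0, 0), (2, 0), (4, 0)}"
    by (auto simp: S_verts_def less_Suc_eq numeral_2_eq_2 numeral_3_eq_3 eval_nat_numeral)
  show "set [s0, t1, t2, s2, t3, t4, s4] = ?tp ` T_verts [1, 0, 1, 0, 1] \<union> ?sp ` S_verts [1, 0, 1, 0, 1]"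
    unfolding T SV by auto
  show "inj_on ?sp (S_verts [1, 0, 1, 0, 1])" unfolding SV using assms by auto
  fix p i j assume "p \<in> T_verts [1, 0, 1, 0, 1]" "(i, j) \<in> S_verts [1, 0, 1, 0, 1]"
  then show "p \<le> i \<Longrightarrow> ?tp p < ?sp (i, j)" "i < p \<Longrightarrow> ?sp (i, j) < ?tp p"
    unfolding T SV using assms by auto
qed (use assms in \<open>auto simp: T_verts_def S_verts_def split: if_splits\<close>)

end

text \<open>\<open>f\<close> is the position, or minus the position to obtain the mirror image of the ordering.\<close>

definition elimination_before :: "('b \<Rightarrow> bool) \<Rightarrow> int \<Rightarrow> ('b \<Rightarrow> int) \<Rightarrow> 'b \<Rightarrow> 'b \<Rightarrow> bool" where
  "elimination_before P a f x y \<longleftrightarrow> P x \<and> (P y \<longrightarrow> f x < f y) \<or>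
    \<not> P x \<and> \<not> P y \<and> a \<le> f x \<and> (a \<le> f y \<longrightarrow> f x < f y) \<or> \<not> P x \<and> \<not> P y \<and> f y < f x \<and> f x < a"

text \<open>\<open>a\<close> bounds \<open>S\<close> from below; \<open>last\<close> and
  \<open>uniq\<close> leave at most one element of \<open>S\<close> outside \<open>P\<close>, above
  all of \<open>P\<close>; and by \<open>T\<close> at most one tournament vertex from
  \<open>a\<close> on, the one with value \<open>r\<close>, fails to lie above all of
  \<open>P\<close>. Integer values let the mirrored case use the same statement through
  negation.\<close>

lemma elimination_before_strong:
  fixes f :: "'b \<Rightarrow> int"
  assumes inj: "\<And>x y. x \<in> V \<Longrightarrow> y \<in> V \<Longrightarrow> f x = f y \<Longrightarrow> x = y"
    and PS: "\<And>x. x \<in> V \<Longrightarrow> P x \<Longrightarrow> S x"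
    and Sa: "\<And>x. x \<in> V \<Longrightarrow> S x \<Longrightarrow> a \<le> f x"
    and last: "\<And>x y. x \<in> V \<Longrightarrow> S x \<Longrightarrow> \<not> P x \<Longrightarrow> y \<in> V \<Longrightarrow> P y \<Longrightarrow> f y < f x"
    and uniq: "\<And>x y. x \<in> V \<Longrightarrow> y \<in> V \<Longrightarrow> S x \<Longrightarrow> \<not> P x \<Longrightarrow> S y \<Longrightarrow> \<not> P y \<Longrightarrow> x = y"
    and T: "\<And>x y. x \<in> V \<Longrightarrow> \<not> S x \<Longrightarrow> y \<in> V \<Longrightarrow> P y \<Longrightarrow> f x < a \<or> f x = r \<or> f y < f x"
    and V: "x \<in> V" "y \<in> V" "z \<in> V" "w \<in> V"
    and R: "elimination_before P a f x y" "elimination_before P a f z w"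
    and arcs: "x = z \<or> f x < f z \<and> \<not> (S x \<and> S z)" "x = w \<or> f x < f w \<and> \<not> (S x \<and> S w)"
      "y = z \<or> f y < f z \<and> \<not> (S y \<and> S z)"
  shows "y = w \<or> f y < f w \<and> \<not> (S y \<and> S w)"
proof (rule ccontr)
  assume contra: "\<not> ?thesis"
  have eq: "f x = f y \<longleftrightarrow> x = y" if "x \<in> V" "y \<in> V" for x y using inj that by auto
  have 1: "(P x \<longrightarrow> S x) \<and> (S x \<longrightarrow> a \<le> f x)" if "x \<in> V" for x using PS Sa that by auto
  have 2: "(S x \<longrightarrow> P x \<or> (P y \<longrightarrow> f y < f x) \<and> (S y \<and> \<not> P y \<longrightarrow> f x = f y)) \<and>
      (\<not> S x \<longrightarrow> P y \<longrightarrow> f x < a \<or> f x = r \<or> f y < f x)"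
    if "x \<in> V" "y \<in> V" for x y using last uniq T that by blast
  \<comment> \<open>Only four vertices occur. Instantiating the hypotheses at all their pairs leaves
    a ground problem about linear inequalities between values of \<open>f\<close>.\<close>
  show False
    using contra arcs R[unfolded elimination_before_def] 1[OF V(1)] 1[OF V(2)] 1[OF V(3)] 1[OF V(4)]
      2[OF V(1,2)] 2[OF V(1,3)] 2[OF V(1,4)] 2[OF V(2,1)] 2[OF V(2,3)] 2[OF V(2,4)]
      2[OF V(3,1)] 2[OF V(3,2)] 2[OF V(3,4)] 2[OF V(4,1)] 2[OF V(4,2)] 2[OF V(4,3)]
      eq[OF V(1,2)] eq[OF V(1,3)] eq[OF V(1,4)] eq[OF V(2,3)] eq[OF V(2,4)] eq[OF V(3,4)]
    by (smt (verit))
qed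

context layered
begin

text \<open>The reversed segment is written with \<open>n - 1 - x\<close>, and not with
  \<open>rev\<close>, because this is the list that a loop with an ascending counter
  produces.\<close>

lemma strong_ordering_forward:
  assumes PS: "\<And>x. x < n \<Longrightarrow> P x \<Longrightarrow> S x"
    and Sa: "\<And>x. x < n \<Longrightarrow> S x \<Longrightarrow> a \<le> x"
    and last: "\<And>x y. x < n \<Longrightarrow> S x \<Longrightarrow> \<not> P x \<Longrightarrow> y < n \<Longrightarrow> P y \<Longrightarrow> y < x"
    and uniq: "\<And>x y. x < n \<Longrightarrow> y < n \<Longrightarrow> S x \<Longrightarrow> \<not> P x \<Longrightarrow> S y \<Longrightarrow> \<not> P y \<Longrightarrow> x = y"
    and T: "\<And>x. x < n \<Longrightarrow> \<not> S x \<Longrightarrow> x < a \<or> x = r \<or> (\<forall>y<n. P y \<longrightarrow> y < x)"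
  shows "strong_ordering D (map q (filter P [0..<n] @ filter (\<lambda>x. \<not> P x \<and> a \<le> x) [0..<n] @
    map (\<lambda>x. n - 1 - x) (filter (\<lambda>x. n - 1 - x < a) [0..<n])))"
proof (rule strong_ordering_map)
  let ?R = "\<lambda>x y. P x \<and> (P y \<longrightarrow> x < y) \<or> \<not> P x \<and> \<not> P y \<and> a \<le> x \<and> (a \<le> y \<longrightarrow> x < y) \<or>
    \<not> P x \<and> \<not> P y \<and> y < x \<and> x < a"
  let ?ps = "filter P [0..<n] @ filter (\<lambda>x. \<not> P x \<and> a \<le> x) [0..<n] @
    map (\<lambda>x. n - 1 - x) (filter (\<lambda>x. n - 1 - x < a) [0..<n])"
  have Pa: "\<not> P x" if "x < n" "x < a" for x using that PS[of x] Sa[of x] by auto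
  have up: "sorted_wrt ?R (filter Q [0..<n])" if "\<And>x y. x < y \<Longrightarrow> y < n \<Longrightarrow> Q x \<Longrightarrow> Q y \<Longrightarrow> ?R x y" for Q
    by (rule sorted_wrt_mono_rel[OF _ sorted_wrt_filter[OF sorted_wrt_upt]]) (use that in auto)
  have "sorted_wrt (\<lambda>x y. ?R (n - 1 - x) (n - 1 - y)) (filter (\<lambda>x. n - 1 - x < a) [0..<n])"
    by (rule sorted_wrt_mono_rel[OF _ sorted_wrt_filter[OF sorted_wrt_upt]])
      (use Pa in auto)
  moreover have "sorted_wrt ?R (filter P [0..<n])" by (rule up) auto
  moreover have "sorted_wrt ?R (filter (\<lambda>x. \<not> P x \<and> a \<le> x) [0..<n])" by (rule up) auto
  ultimately show "sorted_wrt ?R ?ps"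
    using Pa by (auto simp: sorted_wrt_append sorted_wrt_map)
  show "distinct ?ps" using Pa by (auto simp: distinct_map inj_on_def)
  show "set ?ps = {..<n}"
  proof (intro equalityI subsetI)
    fix x assume x: "x \<in> {..<n}"
    have "x \<in> (\<lambda>x. n - 1 - x) ` {x. x < n \<and> n - 1 - x < a}" if "x < a"
      using x that by (intro image_eqI[of _ _ "n - 1 - x"]) auto
    with x show "x \<in> set ?ps" by (cases "x < a") auto
  qed auto
  fix x y z w
  assume *: "x < n" "y < n" "z < n" "w < n" "?R x y" "?R z w"
    "E x z" "E x w" "E y z"
  have "y = w \<or> int y < int w \<and> \<not> (S y \<and> S w)"
  proof (rule elimination_before_strong[where V = "{..<n}" and P = P and f = int and a = "int a" and r = "int r"
        and x = x and z = z])
    show "int x < int a \<or> int x = int r \<or> int y < int x" if "x \<in> {..<n}" "\<not> S x" "y \<in> {..<n}" "P y" for x y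
      using T[of x] that by auto
    show "elimination_before P (int a) int x y" "elimination_before P (int a) int z w"
      unfolding elimination_before_def using *(5,6) by simp_all
    show "x = y" if "x \<in> {..<n}" "y \<in> {..<n}" "S x" "\<not> P x" "S y" "\<not> P y" for x y
      using uniq[of x y] that by simp
  qed (use PS Sa last *(1-4,7-9) in simp_all)
  then show "E y w" by simp
qed

text \<open>Reversing all arcs exchanges the rows \<open>x\<close>, \<open>y\<close> with the
  columns \<open>z\<close>, \<open>w\<close> and leaves the condition unchanged. So the same
  elimination lemma applies to negated positions with these two pairs exchanged.\<close>

lemma strong_ordering_backward:
  assumes PS: "\<And>x. x < n \<Longrightarrow> P x \<Longrightarrow> S x"
    and Sb: "\<And>x. x < n \<Longrightarrow> S x \<Longrightarrow> x \<le> b"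
    and first: "\<And>x y. x < n \<Longrightarrow> S x \<Longrightarrow> \<not> P x \<Longrightarrow> y < n \<Longrightarrow> P y \<Longrightarrow> x < y"
    and uniq: "\<And>x y. x < n \<Longrightarrow> y < n \<Longrightarrow> S x \<Longrightarrow> \<not> P x \<Longrightarrow> S y \<Longrightarrow> \<not> P y \<Longrightarrow> x = y"
    and T: "\<And>x. x < n \<Longrightarrow> \<not> S x \<Longrightarrow> b < x \<or> x = r \<or> (\<forall>y<n. P y \<longrightarrow> x < y)"
  shows "strong_ordering D (map q (map (\<lambda>x. n - 1 - x) (filter (\<lambda>x. P (n - 1 - x)) [0..<n]) @
    map (\<lambda>x. n - 1 - x) (filter (\<lambda>x. \<not> P (n - 1 - x) \<and> n - 1 - x \<le> b) [0..<n]) @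
    filter (\<lambda>x. b < x) [0..<n]))"
proof (rule strong_ordering_map)
  let ?R = "\<lambda>x y. P x \<and> (P y \<longrightarrow> y < x) \<or> \<not> P x \<and> \<not> P y \<and> x \<le> b \<and> (y \<le> b \<longrightarrow> y < x) \<or>
    \<not> P x \<and> \<not> P y \<and> x < y \<and> b < x"
  let ?ps = "map (\<lambda>x. n - 1 - x) (filter (\<lambda>x. P (n - 1 - x)) [0..<n]) @
    map (\<lambda>x. n - 1 - x) (filter (\<lambda>x. \<not> P (n - 1 - x) \<and> n - 1 - x \<le> b) [0..<n]) @
    filter (\<lambda>x. b < x) [0..<n]"
  have Pb: "\<not> P x" if "x < n" "b < x" for x using that PS[of x] Sb[of x] by auto
  have down: "sorted_wrt ?R (map (\<lambda>x. n - 1 - x) (filter (\<lambda>x. Q (n - 1 - x)) [0..<n]))"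
    if "\<And>x y. y < x \<Longrightarrow> x < n \<Longrightarrow> Q x \<Longrightarrow> Q y \<Longrightarrow> ?R x y" for Q
    unfolding sorted_wrt_map
    by (rule sorted_wrt_mono_rel[OF _ sorted_wrt_filter[OF sorted_wrt_upt]], rule that) auto
  have "sorted_wrt ?R (map (\<lambda>x. n - 1 - x) (filter (\<lambda>x. P (n - 1 - x)) [0..<n]))" by (rule down) auto
  moreover have "sorted_wrt ?R (map (\<lambda>x. n - 1 - x)
      (filter (\<lambda>x. \<not> P (n - 1 - x) \<and> n - 1 - x \<le> b) [0..<n]))"
    by (rule down[of "\<lambda>x. \<not> P x \<and> x \<le> b"]) auto
  moreover have "sorted_wrt ?R (filter (\<lambda>x. b < x) [0..<n])"
    by (rule sorted_wrt_mono_rel[OF _ sorted_wrt_filter[OF sorted_wrt_upt]]) (use Pb in auto)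
  ultimately show "sorted_wrt ?R ?ps"
    using Pb by (auto simp: sorted_wrt_append)
  show "distinct ?ps" using Pb by (auto simp: distinct_map inj_on_def)
  show "set ?ps = {..<n}"
  proof (intro equalityI subsetI)
    fix x assume x: "x \<in> {..<n}"
    have "x \<in> (\<lambda>x. n - 1 - x) ` {x. x < n \<and> Q (n - 1 - x)}" if "Q x" for Q
      using x that by (intro image_eqI[of _ _ "n - 1 - x"]) auto
    from this[of P] this[of "\<lambda>x. \<not> P x \<and> x \<le> b"] x show "x \<in> set ?ps"
      by (cases "b < x"; cases "P x") auto
  qed auto
  fix x y z w
  assume *: "x < n" "y < n" "z < n" "w < n" "?R x y" "?R z w"
    "E x z" "E x w" "E y z"
  have "w = y \<or> - int w < - int y \<and> \<not> (S w \<and> S y)"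
  proof (rule elimination_before_strong[where V = "{..<n}" and P = P and f = "\<lambda>x. - int x" and a = "- int b"
        and r = "- int r" and x = z and z = x])
    show "- int x < - int b \<or> - int x = - int r \<or> - int y < - int x"
      if "x \<in> {..<n}" "\<not> S x" "y \<in> {..<n}" "P y" for x y
      using T[of x] that by auto
    show "elimination_before P (- int b) (\<lambda>x. - int x) x y" "elimination_before P (- int b) (\<lambda>x. - int x) z w"
      unfolding elimination_before_def using *(5,6) by simp_all
    show "z = x \<or> - int z < - int x \<and> \<not> (S z \<and> S x)" "z = y \<or> - int z < - int y \<and> \<not> (S z \<and> S y)"
      "w = x \<or> - int w < - int x \<and> \<not> (S w \<and> S x)"
      using *(7-9) by auto
    show "x = y" if "x \<in> {..<n}" "y \<in> {..<n}" "S x" "\<not> P x" "S y" "\<not> P y" for x y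
      using uniq[of x y] that by simp
    show "- int y < - int x" if "x \<in> {..<n}" "S x" "\<not> P x" "y \<in> {..<n}" "P y" for x y
      using first[of x y] that by simp
    show "S x" if "x \<in> {..<n}" "P x" for x using PS[of x] that by simp
    show "- int b \<le> - int x" if "x \<in> {..<n}" "S x" for x using Sb[of x] that by simp
  qed (use *(1-4) in simp_all)
  then show "E y w" by auto
qed

end

section \<open>Certificates from the word\<close>

context layered
begin

section \<open>Elements of the independent set and their classes\<close>

definition SL :: "nat list" where "SL = filter S [0..<n]"
definition TL :: "nat list" where "TL = filter (\<lambda>x. \<not> S x) [0..<n]"

text \<open>The number \<open>i\<close> of the class \<open>S\<^sub>i\<close> that contains the \<open>j\<close>-th element of \<open>S\<close>.\<close>

definition class_of :: "nat \<Rightarrow> nat" where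
  "class_of j = length (filter (\<lambda>x. \<not> S x) [0..<SL ! j])"

lemma SL_nth: "j < length SL \<Longrightarrow> S (SL ! j)" "j < length SL \<Longrightarrow> SL ! j < n"
  using nth_mem[of j SL] by (auto simp: SL_def)

lemma TL_nth: "c < length TL \<Longrightarrow> \<not> S (TL ! c)" "c < length TL \<Longrightarrow> TL ! c < n"
  using nth_mem[of c TL] by (auto simp: TL_def)

lemma SL_index:
  assumes "x < n" "S x"
  obtains j where "j < length SL" "x = SL ! j"
proof -
  have "x \<in> set SL" using assms by (auto simp: SL_def)
  then show ?thesis using that by (metis in_set_conv_nth)
qed

lemma TL_index:
  assumes "x < n" "\<not> S x"
  obtains c where "c < length TL" "x = TL ! c"
proof -
  have "x \<in> set TL" using assms by (auto simp: TL_def)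
  then show ?thesis using that by (metis in_set_conv_nth)
qed

lemma SL_less: "i < j \<Longrightarrow> j < length SL \<Longrightarrow> SL ! i < SL ! j"
  using sorted_wrt_nth_less[OF sorted_wrt_filter[OF sorted_wrt_upt, of S 0 n]] by (simp add: SL_def)

lemma SL_mono: "i \<le> j \<Longrightarrow> j < length SL \<Longrightarrow> SL ! i \<le> SL ! j"
  using SL_less[of i j] by (cases "i = j") simp_all

lemma TL_less: "i < j \<Longrightarrow> j < length TL \<Longrightarrow> TL ! i < TL ! j"
  using sorted_wrt_nth_less[OF sorted_wrt_filter[OF sorted_wrt_upt, of "\<lambda>x. \<not> S x" 0 n]] by (simp add: TL_def)

lemma class_of_le: "j < length SL \<Longrightarrow> class_of j \<le> length TL"
  using SL_nth(2)[of j] upt_add_eq_append[of 0 "SL ! j" "n - SL ! j"]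
  by (simp add: class_of_def TL_def)

text \<open>The tournament vertices before \<open>SL ! j\<close> are a prefix of \<open>TL\<close>
  of length \<open>class_of j\<close>. All comparisons between the two lists are thereby reduced to
  comparisons of classes.\<close>

lemma TL_SL_less:
  assumes "j < length SL"
  shows "c < class_of j \<Longrightarrow> TL ! c < SL ! j"
    and "class_of j \<le> c \<Longrightarrow> c < length TL \<Longrightarrow> SL ! j < TL ! c"
proof -
  let ?x = "SL ! j" and ?T = "\<lambda>x. \<not> S x"
  have "TL = filter ?T [0..<?x] @ filter ?T [?x..<n]"
    using SL_nth(2)[OF assms] upt_add_eq_append[of 0 ?x "n - ?x"] by (simp add: TL_def)
  then have len: "length TL = class_of j + length (filter ?T [?x..<n])"
    and nth: "TL ! c = (if c < class_of j then filter ?T [0..<?x] ! c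
      else filter ?T [?x..<n] ! (c - class_of j))" for c
    by (simp_all add: nth_append class_of_def)
  show "TL ! c < ?x" if "c < class_of j"
    using that nth[of c] nth_mem[of c "filter ?T [0..<?x]"] by (auto simp: class_of_def)
  show "?x < TL ! c" if "class_of j \<le> c" "c < length TL"
  proof -
    have "TL ! c \<in> set (filter ?T [?x..<n])"
      using that len nth[of c] nth_mem[of "c - class_of j" "filter ?T [?x..<n]"] by auto
    then have "?x \<le> TL ! c" by simp
    moreover have "TL ! c \<noteq> ?x" using TL_nth(1)[OF that(2)] SL_nth(1)[OF assms] by metis
    ultimately show ?thesis by simp
  qed
qed

text \<open>With \<open>P\<close> all of \<open>S\<close> but its last element, only the tournament
  vertex of index \<open>class_of 0\<close> can separate two elements of \<open>P\<close>. For a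
  single element of \<open>S\<close> the truncated \<open>length SL - 2\<close> is 0, so the bound
  on classes holds by itself; for none, \<open>a\<close> and \<open>l\<close> are arbitrary.\<close>

lemma strong_ordering_forward_SL:
  assumes "0 < length SL \<Longrightarrow> a = SL ! 0 \<and> l = SL ! (length SL - 1) \<and> class_of (length SL - 2) < class_of 0 + 2"
  shows "strong_ordering D (map q (filter (\<lambda>x. S x \<and> x \<noteq> l) [0..<n] @
    filter (\<lambda>x. \<not> (S x \<and> x \<noteq> l) \<and> a \<le> x) [0..<n] @
    map (\<lambda>x. n - 1 - x) (filter (\<lambda>x. n - 1 - x < a) [0..<n])))"
proof (rule strong_ordering_forward[where r = "TL ! class_of 0"])
  have al: "a = SL ! 0" "l = SL ! (length SL - 1)" "class_of (length SL - 2) < class_of 0 + 2" if "j < length SL" for j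
  proof -
    have "0 < length SL" using that by linarith
    from assms[OF this] show "a = SL ! 0" "l = SL ! (length SL - 1)" "class_of (length SL - 2) < class_of 0 + 2"
      by blast+
  qed
  show "a \<le> x" if x: "x < n" "S x" for x
  proof -
    obtain j where j: "j < length SL" "x = SL ! j" using x by (rule SL_index)
    then show ?thesis using SL_mono[of 0 j] al(1)[OF j(1)] by simp
  qed
  have P: "\<exists>j. Suc j < length SL \<and> y = SL ! j" if y: "y < n" "S y \<and> y \<noteq> l" for y
  proof -
    obtain j where j: "j < length SL" "y = SL ! j" using y SL_index by metis
    moreover have "j \<noteq> length SL - 1" using y(2) j al(2)[OF j(1)] by auto
    ultimately show ?thesis by (intro exI[of _ j]) simp
  qed
  show "y < x" if x: "x < n" "S x" "\<not> (S x \<and> x \<noteq> l)" and y: "y < n" "S y \<and> y \<noteq> l" for x y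
  proof -
    obtain j where j: "Suc j < length SL" "y = SL ! j" using P[OF y] by blast
    then show ?thesis using x al(2)[of j] SL_less[of j "length SL - 1"] by simp
  qed
  show "x < a \<or> x = TL ! class_of 0 \<or> (\<forall>y<n. S y \<and> y \<noteq> l \<longrightarrow> y < x)" if x: "x < n" "\<not> S x" for x
  proof -
    obtain c where c: "c < length TL" "x = TL ! c" using x by (rule TL_index)
    have "y < x" if y: "y < n" "S y \<and> y \<noteq> l" and "\<not> x < a" "x \<noteq> TL ! class_of 0" for y
    proof -
      obtain j where j: "Suc j < length SL" "y = SL ! j" using P[OF y] by blast
      have *: "a = SL ! 0" "class_of (length SL - 2) < class_of 0 + 2" using al[of j] j by auto
      have "\<not> c < class_of 0" using TL_SL_less(1)[of 0 c] that(3) c * j by (cases SL) auto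
      moreover have "c \<noteq> class_of 0" using that(4) c by auto
      ultimately have "class_of (length SL - 2) \<le> c" using *(2) by simp
      then have "SL ! (length SL - 2) < x" using TL_SL_less(2)[of "length SL - 2" c] c j by auto
      moreover have "y \<le> SL ! (length SL - 2)"
        using j SL_mono[of j "length SL - 2"] by simp
      ultimately show ?thesis by simp
    qed
    then show ?thesis by blast
  qed
qed auto

text \<open>Here the first element of \<open>S\<close> is the stray one, and only the tournament
  vertex of index \<open>class_of 1\<close> can separate two of the others.\<close>

lemma strong_ordering_backward_SL:
  assumes "2 \<le> length SL" "class_of (length SL - 1) < class_of 1 + 2"
    and bf: "b = SL ! (length SL - 1)" "f = SL ! 0"
  shows "strong_ordering D (map q (map (\<lambda>x. n - 1 - x) (filter (\<lambda>x. S (n - 1 - x) \<and> n - 1 - x \<noteq> f) [0..<n]) @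
    map (\<lambda>x. n - 1 - x) (filter (\<lambda>x. \<not> (S (n - 1 - x) \<and> n - 1 - x \<noteq> f) \<and> n - 1 - x \<le> b) [0..<n]) @
    filter (\<lambda>x. b < x) [0..<n]))"
proof (rule strong_ordering_backward[where P = "\<lambda>x. S x \<and> x \<noteq> f" and r = "TL ! class_of 1"])
  show "x \<le> b" if x: "x < n" "S x" for x
  proof -
    obtain j where j: "j < length SL" "x = SL ! j" using x by (rule SL_index)
    then show ?thesis using SL_mono[of j "length SL - 1"] bf by simp
  qed
  have P: "\<exists>j. 0 < j \<and> j < length SL \<and> y = SL ! j" if y: "y < n" "S y \<and> y \<noteq> f" for y
  proof -
    obtain j where j: "j < length SL" "y = SL ! j" using y SL_index by metis
    moreover have "0 < j" using y(2) j bf by (intro gr0I) auto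
    ultimately show ?thesis by blast
  qed
  show "x < y" if x: "x < n" "S x" "\<not> (S x \<and> x \<noteq> f)" and y: "y < n" "S y \<and> y \<noteq> f" for x y
  proof -
    obtain j where j: "0 < j" "j < length SL" "y = SL ! j" using P[OF y] by blast
    then show ?thesis using x bf SL_less[of 0 j] by simp
  qed
  show "b < x \<or> x = TL ! class_of 1 \<or> (\<forall>y<n. S y \<and> y \<noteq> f \<longrightarrow> x < y)" if x: "x < n" "\<not> S x" for x
  proof -
    obtain c where c: "c < length TL" "x = TL ! c" using x by (rule TL_index)
    have "x < y" if y: "y < n" "S y \<and> y \<noteq> f" and "\<not> b < x" "x \<noteq> TL ! class_of 1" for y
    proof -
      obtain j where j: "0 < j" "j < length SL" "y = SL ! j" using P[OF y] by blast
      have "c < class_of (length SL - 1)" using TL_SL_less(2)[of "length SL - 1" c] that(3) c j bf by fastforce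
      moreover have "c \<noteq> class_of 1" using that(4) c by auto
      ultimately have "c < class_of 1" using assms(2) by simp
      then have "x < SL ! 1" using TL_SL_less(1)[of 1 c] c assms(1) by auto
      moreover have "SL ! 1 \<le> y"
        using j SL_mono[of 1 j] by simp
      ultimately show ?thesis by simp
    qed
    then show ?thesis by blast
  qed
qed auto

section \<open>Obstructions when both orderings fail\<close>

context
  assumes not_forward: "class_of 0 + 2 \<le> class_of (length SL - 2)"
    and not_backward: "class_of 1 + 2 \<le> class_of (length SL - 1)"
    and ne: "SL \<noteq> []"
begin

text \<open>With at most two elements, truncated subtraction would turn \<open>not_forward\<close>
  into a comparison of \<open>class_of 0\<close> with itself.\<close>

lemma length_SL: "3 \<le> length SL"
proof -
  have "length SL - 2 \<noteq> 0" using not_forward by (metis add_le_same_cancel1 not_numeral_le_zero)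
  then show ?thesis by simp
qed

text \<open>The two consecutive tournament vertices that follow \<open>SL ! 1\<close> both precede
  the second-last element of \<open>S\<close>. The gap also shows that the second and second-last
  elements differ, so the four elements of \<open>S\<close> are distinct.\<close>

lemma T202_positions:
  assumes "class_of 1 + 1 < class_of (length SL - 2)"
  shows "\<not> strongly_chordal D"
    and "induces_copy D (map q [SL ! 0, SL ! 1, TL ! class_of 1, TL ! (class_of 1 + 1),
      SL ! (length SL - 2), SL ! (length SL - 1)]) (T_digraph [2, 0, 2])" (is ?copy)
proof -
  have "length SL - 2 \<noteq> 1" using assms by (metis less_add_one less_asym)
  then have len: "4 \<le> length SL" using length_SL by simp
  have cl: "class_of (length SL - 2) \<le> length TL" by (rule class_of_le) (use len in simp)
  have S: "S (SL ! 0)" "S (SL ! 1)" "S (SL ! (length SL - 2))" "S (SL ! (length SL - 1))"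
    using len by (auto intro!: SL_nth simp del: length_greater_0_conv)
  have T: "\<not> S (TL ! class_of 1)" "\<not> S (TL ! (class_of 1 + 1))"
    using TL_nth(1)[of "class_of 1"] TL_nth(1)[of "class_of 1 + 1"] assms cl by auto
  have less: "SL ! 0 < SL ! 1" "SL ! 1 < TL ! class_of 1" "TL ! class_of 1 < TL ! (class_of 1 + 1)"
    "TL ! (class_of 1 + 1) < SL ! (length SL - 2)" "SL ! (length SL - 2) < SL ! (length SL - 1)" "SL ! (length SL - 1) < n"
    using len cl assms SL_less TL_less TL_SL_less SL_nth(2) by auto
  show "\<not> strongly_chordal D" by (rule not_strongly_chordal_T202[OF less S(1,2) T S(3,4)])
  show ?copy
    by (rule induces_T202[OF less S(1,2) T S(3,4)])
qed

text \<open>As the second and the second-last element share a class, \<open>not_forward\<close> puts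
  two tournament vertices between \<open>SL ! 0\<close> and \<open>SL ! 1\<close>, and
  \<open>not_backward\<close> puts two between \<open>SL ! 1\<close> and the last element.\<close>

lemma T10101_positions:
  assumes "class_of 1 = class_of (length SL - 2)"
  shows "\<not> strongly_chordal D"
    and "induces_copy D (map q [SL ! 0, TL ! class_of 0, TL ! (class_of 0 + 1), SL ! 1,
      TL ! class_of 1, TL ! (class_of 1 + 1), SL ! (length SL - 1)]) (T_digraph [1, 0, 1, 0, 1])" (is ?copy)
proof -
  have len: "3 \<le> length SL" by (rule length_SL)
  have cl: "class_of (length SL - 1) \<le> length TL" "class_of 1 \<le> length TL"
    using class_of_le[of "length SL - 1"] class_of_le[of 1] len by auto
  note a = not_forward not_backward assms
  have S: "S (SL ! 0)" "S (SL ! 1)" "S (SL ! (length SL - 1))"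
    using len by (auto intro!: SL_nth simp del: length_greater_0_conv)
  have T: "\<not> S (TL ! class_of 0)" "\<not> S (TL ! (class_of 0 + 1))" "\<not> S (TL ! class_of 1)" "\<not> S (TL ! (class_of 1 + 1))"
    using TL_nth(1)[of "class_of 0"] TL_nth(1)[of "class_of 0 + 1"] TL_nth(1)[of "class_of 1"]
      TL_nth(1)[of "class_of 1 + 1"] a cl by auto
  have less: "SL ! 0 < TL ! class_of 0" "TL ! class_of 0 < TL ! (class_of 0 + 1)" "TL ! (class_of 0 + 1) < SL ! 1"
    "SL ! 1 < TL ! class_of 1" "TL ! class_of 1 < TL ! (class_of 1 + 1)"
    "TL ! (class_of 1 + 1) < SL ! (length SL - 1)" "SL ! (length SL - 1) < n"
    using len cl a ne TL_less TL_SL_less SL_nth(2) by auto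
  show "\<not> strongly_chordal D" by (rule not_strongly_chordal_T10101[OF less S T])
  show ?copy
    by (rule induces_T10101[OF less S T])
qed

lemma T1111_positions:
  assumes "\<not> class_of 1 + 1 < class_of (length SL - 2)" "class_of 1 \<noteq> class_of (length SL - 2)"
  shows "\<not> strongly_chordal D"
    and "induces_copy D (map q [SL ! 0, TL ! class_of 0, SL ! 1, TL ! class_of 1,
      SL ! (length SL - 2), TL ! class_of (length SL - 2), SL ! (length SL - 1)]) (T_digraph [1, 1, 1, 1])" (is ?copy)
proof -
  have len: "3 \<le> length SL" by (rule length_SL)
  have cl: "class_of (length SL - 1) \<le> length TL" "class_of (length SL - 2) \<le> length TL"
    using class_of_le[of "length SL - 1"] class_of_le[of "length SL - 2"] len by auto
  have mono: "class_of 1 \<le> class_of (length SL - 2)"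
  proof (rule ccontr)
    assume *: "\<not> ?thesis"
    have "SL ! 1 \<le> SL ! (length SL - 2)" using SL_mono[of 1 "length SL - 2"] len by simp
    moreover have "class_of 1 \<le> length TL" using class_of_le[of 1] len by simp
    ultimately show False
      using ne TL_SL_less(1)[of 1 "class_of (length SL - 2)"] TL_SL_less(2)[of "length SL - 2" "class_of (length SL - 2)"] len *
      by auto
  qed
  \<comment> \<open>The second-last class exceeds \<open>class_of 1\<close> by exactly one.
    Subtracting this one from the two failed tests leaves a tournament vertex in each outer gap
    too.\<close>
  with assms have a: "class_of (length SL - 2) = class_of 1 + 1" "class_of 0 < class_of 1"
    "class_of (length SL - 2) < class_of (length SL - 1)"
    using not_forward not_backward by auto
  have S: "S (SL ! 0)" "S (SL ! 1)" "S (SL ! (length SL - 2))" "S (SL ! (length SL - 1))"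
    using len by (auto intro!: SL_nth simp del: length_greater_0_conv)
  have T: "\<not> S (TL ! class_of 0)" "\<not> S (TL ! class_of 1)" "\<not> S (TL ! class_of (length SL - 2))"
    using TL_nth(1)[of "class_of 0"] TL_nth(1)[of "class_of 1"] TL_nth(1)[of "class_of (length SL - 2)"] a cl by auto
  have less: "SL ! 0 < TL ! class_of 0" "TL ! class_of 0 < SL ! 1" "SL ! 1 < TL ! class_of 1"
    "TL ! class_of 1 < SL ! (length SL - 2)" "SL ! (length SL - 2) < TL ! class_of (length SL - 2)"
    "TL ! class_of (length SL - 2) < SL ! (length SL - 1)" "SL ! (length SL - 1) < n"
    using ne TL_SL_less[of 0 "class_of 0"] TL_SL_less[of 1 "class_of 0"] TL_SL_less[of 1 "class_of 1"]
      TL_SL_less[of "length SL - 2" "class_of 1"] TL_SL_less[of "length SL - 2" "class_of (length SL - 2)"]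
      TL_SL_less[of "length SL - 1" "class_of (length SL - 2)"] SL_nth(2)[of "length SL - 1"] len a cl
    by auto
  show "\<not> strongly_chordal D" by (rule not_strongly_chordal_T1111[OF less S T])
  show "induces_copy D (map q [SL ! 0, TL ! class_of 0, SL ! 1, TL ! class_of 1,
      SL ! (length SL - 2), TL ! class_of (length SL - 2), SL ! (length SL - 1)]) (T_digraph [1, 1, 1, 1])"
    by (rule induces_T1111[OF less S T])
qed

end

end

section \<open>Digraphs stored as arrays of arcs\<close>

text \<open>
  Arc \<open>e\<close> goes from \<open>sr e\<close> to \<open>ds e\<close>, and the arcs leaving \<open>u\<close> are numbered consecutively from
  \<open>off u\<close>.
\<close>

locale arc_arrays =
  fixes D :: "nat pair_pre_digraph" and n m :: nat and sr ds off len :: "nat \<Rightarrow> nat"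
  assumes verts: "pverts D = {..<n}"
    and arcs: "parcs D = (\<lambda>e. (sr e, ds e)) ` {..<m}"
    and inj_arcs: "e < m \<Longrightarrow> e' < m \<Longrightarrow> sr e = sr e' \<Longrightarrow> ds e = ds e' \<Longrightarrow> e = e'"
    and sr_less: "e < m \<Longrightarrow> sr e < n"
    and ds_less: "e < m \<Longrightarrow> ds e < n"
    and lists: "u < n \<Longrightarrow> e < m \<and> sr e = u \<longleftrightarrow> off u \<le> e \<and> e < off u + len u"
begin

lemma arcE:
  assumes "(u, v) \<in> parcs D"
  obtains e where "e < m" "sr e = u" "ds e = v"
  using assms by (auto simp: arcs)

lemma arc: "e < m \<Longrightarrow> (sr e, ds e) \<in> parcs D"
  by (auto simp: arcs)

lemma arc_vertices: "(u, v) \<in> parcs D \<Longrightarrow> u < n \<and> v < n"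
  using sr_less ds_less by (auto simp: arcs)

subsection \<open>Topological sorting\<close>

text \<open>
  \<open>a\<close> is a queue of length \<open>t\<close> whose first \<open>h\<close> vertices are finished; \<open>c\<close> arcs leaving vertex
  \<open>a h\<close> have been processed. \<open>unprocessed\<close> collects the remaining arcs, and \<open>d\<close> counts those
  entering each vertex.
\<close>

definition unprocessed :: "(nat \<Rightarrow> nat) \<Rightarrow> nat \<Rightarrow> nat \<Rightarrow> nat \<Rightarrow> nat set" where
  "unprocessed a t h c = {e. e < m \<and> (\<forall>j<h. a j \<noteq> sr e) \<and> \<not> (h < t \<and> sr e = a h \<and> e < off (a h) + c)}"

definition entering :: "nat set \<Rightarrow> nat \<Rightarrow> nat set" where
  "entering E v = {e \<in> E. ds e = v \<and> sr e \<noteq> v}"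

text \<open>A vertex is queued exactly when its count is 0. If the queue comes to hold all vertices,
  the last clause makes it a topological order; if it runs dry earlier, the counts lead from each
  remaining vertex to a remaining predecessor.\<close>

definition kahn :: "(nat \<Rightarrow> nat) \<Rightarrow> (nat \<Rightarrow> nat) \<Rightarrow> nat \<Rightarrow> nat \<Rightarrow> nat \<Rightarrow> bool" where
  "kahn a d t h c \<longleftrightarrow> h \<le> t \<and> inj_on a {..<t} \<and> (\<forall>j<t. a j < n) \<and> (h < t \<longrightarrow> c \<le> len (a h)) \<and>
    (\<forall>v<n. d v = card (entering (unprocessed a t h c) v)) \<and>
    (\<forall>v<n. d v = 0 \<longleftrightarrow> (\<exists>j<t. a j = v)) \<and>
    (\<forall>j<t. \<forall>e<m. ds e = a j \<longrightarrow> sr e \<noteq> a j \<longrightarrow> (\<exists>i<j. a i = sr e))"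

lemma finite_unprocessed [simp]: "finite (unprocessed a t h c)"
  by (simp add: unprocessed_def)

lemma finite_entering [simp]: "finite E \<Longrightarrow> finite (entering E v)"
  by (simp add: entering_def)

lemma kahnD:
  assumes "kahn a d t h c"
  shows "h \<le> t" "inj_on a {..<t}" "j < t \<Longrightarrow> a j < n" "x < n \<Longrightarrow> d x = 0 \<longleftrightarrow> (\<exists>j<t. a j = x)"
    "j < t \<Longrightarrow> e < m \<Longrightarrow> ds e = a j \<Longrightarrow> sr e \<noteq> a j \<Longrightarrow> \<exists>i<j. a i = sr e"
proof -
  note k = assms[unfolded kahn_def] and c2 = conjunct2
  show "h \<le> t" "inj_on a {..<t}" using k[THEN conjunct1] k[THEN c2, THEN conjunct1] .
  show "a j < n" if "j < t" using k[THEN c2, THEN c2, THEN conjunct1] that by simp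
  show "d x = 0 \<longleftrightarrow> (\<exists>j<t. a j = x)" if "x < n"
    using k[THEN c2, THEN c2, THEN c2, THEN c2, THEN c2, THEN conjunct1, rule_format, OF that] .
  show "\<exists>i<j. a i = sr e" if "j < t" "e < m" "ds e = a j" "sr e \<noteq> a j"
    using k[THEN c2, THEN c2, THEN c2, THEN c2, THEN c2, THEN c2, rule_format, OF that] .
qed

lemma kahn_length:
  assumes "kahn a d t h c"
  shows "t \<le> n"
proof -
  have "card (a ` {..<t}) \<le> card {..<n}"
    using assms by (intro card_mono) (auto simp: kahn_def)
  then show ?thesis using assms by (simp add: card_image kahn_def)
qed

lemma kahn_init:
  assumes "inj_on a {..<t}" "\<And>v. v < n \<Longrightarrow> d v = card (entering {..<m} v)"
    and "\<And>v. (\<exists>j<t. a j = v) \<longleftrightarrow> v < n \<and> d v = 0"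
  shows "kahn a d t 0 0"
proof -
  \<comment> \<open>No arc leaving \<open>a 0\<close> has a number below \<open>off (a 0)\<close>,
    so nothing counts as processed at the start. An empty queue is treated apart because
    \<open>a 0\<close> is then arbitrary.\<close>
  have "unprocessed a t 0 0 = {..<m}"
  proof (cases "t = 0")
    case False
    then have "a 0 < n" using assms(3)[of "a 0"] by auto
    then have "\<not> (e < m \<and> sr e = a 0 \<and> e < off (a 0))" for e using lists[of "a 0" e] by auto
    then show ?thesis by (auto simp: unprocessed_def)
  qed (auto simp: unprocessed_def)
  moreover have "\<exists>i<j. a i = sr e" if "j < t" "e < m" "ds e = a j" "sr e \<noteq> a j" for j e
  proof -
    have "a j < n" "d (a j) = 0" using assms(3)[of "a j"] that by auto
    then have "entering {..<m} (a j) = {}" using assms(2) by simp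
    then show ?thesis using that by (auto simp: entering_def)
  qed
  moreover have "a j < n" if "j < t" for j using assms(3)[of "a j"] that by blast
  moreover have "d v = 0 \<longleftrightarrow> (\<exists>j<t. a j = v)" if "v < n" for v using assms(3)[of v] that by simp
  ultimately show ?thesis
    unfolding kahn_def using assms(1,2) by simp
qed

lemma kahn_arc:
  assumes "kahn a d t h c" "h < t" "c < len (a h)"
  shows "off (a h) + c < m" "sr (off (a h) + c) = a h" "off (a h) + c \<in> unprocessed a t h c"
    "unprocessed a t h (Suc c) = unprocessed a t h c - {off (a h) + c}"
proof -
  have "a h < n" using assms by (auto simp: kahn_def)
  then show 1: "off (a h) + c < m" "sr (off (a h) + c) = a h"
    using lists[of "a h" "off (a h) + c"] assms by auto
  have ne: "a j \<noteq> a h" if "j < h" for j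
    using assms that by (auto simp: kahn_def inj_on_def)
  then show "off (a h) + c \<in> unprocessed a t h c" using 1 by (simp add: unprocessed_def)
  show "unprocessed a t h (Suc c) = unprocessed a t h c - {off (a h) + c}"
  proof (rule set_eqI)
    fix e
    show "e \<in> unprocessed a t h (Suc c) \<longleftrightarrow> e \<in> unprocessed a t h c - {off (a h) + c}"
    proof (cases "e = off (a h) + c")
      case True
      with assms(2) 1(2) show ?thesis by (simp add: unprocessed_def)
    next
      case False
      then have "e < off (a h) + Suc c \<longleftrightarrow> e < off (a h) + c" by linarith
      with False show ?thesis
        unfolding unprocessed_def mem_Collect_eq Diff_iff singleton_iff by presburger
    qed
  qed
qed

lemma kahn_skip:
  assumes "kahn a d t h c" "h < t" "c < len (a h)" "ds (off (a h) + c) = a h"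
  shows "kahn a d t h (Suc c)"
proof -
  note e = kahn_arc[OF assms(1-3)]
  \<comment> \<open>The arc just processed is a loop, and \<open>entering\<close> ignores
    loops.\<close>
  have eq: "entering (unprocessed a t h (Suc c)) v = entering (unprocessed a t h c) v" for v
    unfolding e(4) entering_def by (metis (lifting) DiffE DiffI assms(4) e(2) singletonD)
  show ?thesis
    using assms unfolding kahn_def eq by (elim conjE, intro conjI; (assumption | simp add: Suc_leI))
qed

context
  fixes a d t h c v
  assumes kahn: "kahn a d t h c" and less: "h < t" "c < len (a h)"
    and v: "v = ds (off (a h) + c)" "v \<noteq> a h"
begin

lemmas kahn_inv = kahnD[OF kahn]

lemma kahn_head: "v < n" "0 < d v"
  and kahn_decrement: "x < n \<Longrightarrow> (d(v := d v - 1)) x = card (entering (unprocessed a t h (Suc c)) x)"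
proof -
  note e = kahn_arc[OF kahn less]
  have d: "d x = card (entering (unprocessed a t h c) x)" if "x < n" for x
    using kahn that unfolding kahn_def by simp
  show vn: "v < n" using e(1) v(1) ds_less by simp
  have mem: "off (a h) + c \<in> entering (unprocessed a t h c) v"
    using e(2,3) v by (simp add: entering_def)
  then show "0 < d v" using d[OF vn] by (auto simp: card_gt_0_iff)
  show "(d(v := d v - 1)) x = card (entering (unprocessed a t h (Suc c)) x)" if "x < n"
  proof (cases "x = v")
    case True
    have "entering (unprocessed a t h (Suc c)) v = entering (unprocessed a t h c) v - {off (a h) + c}"
      unfolding e(4) entering_def by blast
    with True mem d[OF that] show ?thesis by simp
  next
    case False
    then have "entering (unprocessed a t h (Suc c)) x = entering (unprocessed a t h c) x"
      unfolding e(4) entering_def by (metis (lifting) DiffE DiffI v(1) singletonD)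
    with False d[OF that] show ?thesis by simp
  qed
qed

lemma kahn_keep:
  assumes "d v - 1 \<noteq> 0"
  shows "kahn a (d(v := d v - 1)) t h (Suc c)"
  unfolding kahn_def
proof (intro conjI allI impI)
  show "(d(v := d v - 1)) x = 0 \<longleftrightarrow> (\<exists>j<t. a j = x)" if "x < n" for x
    using kahn_inv(4)[OF that] assms kahn_head(2) by (cases "x = v") auto
  show "(d(v := d v - 1)) x = card (entering (unprocessed a t h (Suc c)) x)" if "x < n" for x
    using kahn_decrement[OF that] .
  show "Suc c \<le> len (a h)" using less by simp
qed (rule kahn_inv; assumption)+

lemma kahn_push:
  assumes "d v - 1 = 0"
  shows "kahn (a(t := v)) (d(v := d v - 1)) (Suc t) h (Suc c)" "t < n"
proof -
  note vn = kahn_head(1) and dv = kahn_head(2) and old = kahn_inv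
  have new: "a j \<noteq> v" if "j < t" for j using old(4)[OF vn] dv that by auto
  have U: "unprocessed (a(t := v)) (Suc t) h (Suc c) = unprocessed a t h (Suc c)"
    using less by (auto simp: unprocessed_def)
  have "entering (unprocessed a t h (Suc c)) v = {}"
    using kahn_decrement[OF vn] assms by (simp add: card_eq_0_iff)
  \<comment> \<open>No arc into \<open>v\<close> is left unprocessed, so the source of each is
    finished or is \<open>a h\<close>; either way it stands in the queue before index
    \<open>t\<close>.\<close>
  then have empty: "\<exists>i<t. a i = sr e" if "e < m" "ds e = v" "sr e \<noteq> v" for e
    using that less by (auto simp: entering_def unprocessed_def)
      (metis less_trans)
  show "kahn (a(t := v)) (d(v := d v - 1)) (Suc t) h (Suc c)"
    unfolding kahn_def U
  proof (intro conjI allI impI)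
    show "h \<le> Suc t" using old by simp
    have "inj_on (a(t := v)) {..<t}" using old(2) by (simp add: inj_on_def)
    moreover have "v \<notin> a ` {..<t}" using new by blast
    ultimately show "inj_on (a(t := v)) {..<Suc t}" by (auto simp: lessThan_Suc)
    show "(a(t := v)) j < n" if "j < Suc t" for j using that old(3) vn by (auto simp: less_Suc_eq)
    show "Suc c \<le> len ((a(t := v)) h)" using less by auto
    show "(d(v := d v - 1)) x = card (entering (unprocessed a t h (Suc c)) x)" if "x < n" for x
      using kahn_decrement[OF that] .
    show "(d(v := d v - 1)) x = 0 \<longleftrightarrow> (\<exists>j<Suc t. (a(t := v)) j = x)" if "x < n" for x
    proof (cases "x = v")
      case False
      then have "(\<exists>j<Suc t. (a(t := v)) j = x) \<longleftrightarrow> (\<exists>j<t. a j = x)"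
        by (metis fun_upd_apply less_Suc_eq less_irrefl)
      with False show ?thesis using old(4)[OF that] by simp
    qed (use assms in auto)
    show "\<exists>i<j. (a(t := v)) i = sr e"
      if je: "j < Suc t" "e < m" "ds e = (a(t := v)) j" "sr e \<noteq> (a(t := v)) j" for j e
    proof (cases "j = t")
      case True
      then have "ds e = v" "sr e \<noteq> v" using je by simp_all
      then obtain i where "i < t" "a i = sr e" using empty je(2) by blast
      with True show ?thesis by (intro exI[of _ i]) simp
    next
      case False
      then have "j < t" "ds e = a j" "sr e \<noteq> a j" using je by simp_all
      then obtain i where "i < j" "a i = sr e" using old(5) je(2) by blast
      with \<open>j < t\<close> show ?thesis by (intro exI[of _ i]) simp
    qed
  qed
  then show "t < n" using kahn_length by fastforce
qed

end

text \<open>Only the bookkeeping changes: all arcs leaving \<open>a h\<close> are already processed,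
  and none leaving the next vertex is.\<close>

lemma kahn_advance:
  assumes "kahn a d t h c" "h < t" "\<not> c < len (a h)"
  shows "kahn a d t (Suc h) 0" "unprocessed a t (Suc h) 0 = unprocessed a t h c"
proof -
  have an: "\<And>j. j < t \<Longrightarrow> a j < n" and c: "c = len (a h)" using assms by (auto simp: kahn_def)
  show U: "unprocessed a t (Suc h) 0 = unprocessed a t h c"
  proof (intro set_eqI)
    fix e
    have "\<not> (Suc h < t \<and> e < m \<and> sr e = a (Suc h) \<and> e < off (a (Suc h)))"
      using lists[of "a (Suc h)" e] an by auto
    moreover have "e < m \<and> sr e = a h \<longleftrightarrow> e < m \<and> sr e = a h \<and> e < off (a h) + c"
      using lists[of "a h" e] an[OF assms(2)] c by auto
    ultimately show "e \<in> unprocessed a t (Suc h) 0 \<longleftrightarrow> e \<in> unprocessed a t h c"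
      using assms(2) by (auto simp: unprocessed_def less_Suc_eq)
  qed
  show "kahn a d t (Suc h) 0"
    using assms unfolding kahn_def U by (elim conjE, intro conjI; (assumption | simp))
qed

text \<open>When every queued vertex is finished, the source of an unprocessed arc is not in the
  queue, hence has a non-zero count itself.\<close>

lemma kahn_predecessor:
  assumes "kahn a d t t c" "v < n" "d v \<noteq> 0"
  shows "\<exists>e<m. sr e \<noteq> ds e \<and> d (sr e) \<noteq> 0 \<and> ds e = v"
proof -
  have "entering (unprocessed a t t c) v \<noteq> {}" using assms by (auto simp: kahn_def)
  then obtain e where e: "e < m" "ds e = v" "sr e \<noteq> v" "\<forall>j<t. a j \<noteq> sr e"
    by (auto simp: entering_def unprocessed_def)
  moreover from this have "d (sr e) \<noteq> 0" using assms(1) sr_less by (auto simp: kahn_def)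
  ultimately show ?thesis by auto
qed

end

section \<open>Periodic points\<close>

text \<open>An orbit in a set of at most \<open>n\<close> points has reached its cycle after
  \<open>n\<close> steps. So the machine can find a cycle by counting steps, without recording which
  vertices were visited.\<close>

lemma periodic_point:
  fixes f :: "'b \<Rightarrow> 'b"
  assumes "finite R" "card R \<le> n" "x0 \<in> R" "\<And>x. x \<in> R \<Longrightarrow> f x \<in> R" and x: "x = (f ^^ n) x0"
  obtains l where "0 < l" "l \<le> n" "(f ^^ l) x = x" "inj_on (\<lambda>i. (f ^^ i) x) {..<l}"
proof -
  have R: "(f ^^ i) x0 \<in> R" for i using assms(3,4) by (induction i) auto
  have "\<not> inj_on (\<lambda>i. (f ^^ i) x0) {..n}"
  proof
    assume "inj_on (\<lambda>i. (f ^^ i) x0) {..n}"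
    then have "card {..n} \<le> card R" using R assms(1) by (intro card_inj_on_le) auto
    with assms(2) show False by simp
  qed
  then obtain i j where ij: "i < j" "j \<le> n" "(f ^^ i) x0 = (f ^^ j) x0"
    unfolding inj_on_def by (metis atMost_iff linorder_neqE_nat)
  \<comment> \<open>The first repetition starts at an index \<open>i \<le> n\<close>, so the
    difference \<open>j - i\<close> is already a period at \<open>x\<close>.\<close>
  have "(f ^^ (j - i)) x = (f ^^ (j - i + n)) x0" unfolding x by (simp add: funpow_add)
  also have "j - i + n = n - i + j" using ij by simp
  also have "(f ^^ (n - i + j)) x0 = (f ^^ (n - i + i)) x0" unfolding funpow_add comp_def ij(3) ..
  also have "\<dots> = x" using ij unfolding x by simp
  finally have per: "0 < j - i \<and> (f ^^ (j - i)) x = x" using ij by simp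
  \<comment> \<open>The least period is taken because it makes the points of one round
    distinct.\<close>
  define l where "l = (LEAST l. 0 < l \<and> (f ^^ l) x = x)"
  have l: "0 < l" "(f ^^ l) x = x" using LeastI[of "\<lambda>l. 0 < l \<and> (f ^^ l) x = x", OF per] by (auto simp: l_def)
  have min: "l \<le> k" if "0 < k" "(f ^^ k) x = x" for k unfolding l_def using that by (intro Least_le) auto
  have "False" if "i < k" "k < l" "(f ^^ i) x = (f ^^ k) x" for i k
  proof -
    have "(f ^^ (l - k + i)) x = (f ^^ (l - k)) ((f ^^ i) x)" by (simp only: funpow_add comp_def)
    also have "\<dots> = (f ^^ (l - k)) ((f ^^ k) x)" using that(3) by simp
    also have "\<dots> = (f ^^ (l - k + k)) x" by (simp only: funpow_add comp_def)
    also have "\<dots> = x" using that l by simp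
    finally show False using min[of "l - k + i"] that by simp
  qed
  then have "inj_on (\<lambda>i. (f ^^ i) x) {..<l}" unfolding inj_on_def by (metis lessThan_iff linorder_neqE_nat)
  with l min[of "j - i"] per ij that show ?thesis by fastforce
qed

section \<open>Degrees\<close>

context arc_arrays
begin

definition incident :: "nat set \<Rightarrow> nat \<Rightarrow> nat set" where
  "incident E v = {e \<in> E. sr e \<noteq> ds e \<and> (sr e = v \<or> ds e = v)}"

definition degree :: "nat \<Rightarrow> nat" where
  "degree v = card (incident {..<m} v)"

text \<open>\<open>other\<close> sends an incident arc to its far end. Antisymmetry makes this
  injective, so that counting arcs counts neighbours; a two-cycle would count one neighbour
  twice.\<close>

lemma degree_universal:
  assumes antisym: "\<And>u v. (u, v) \<in> parcs D \<Longrightarrow> (v, u) \<in> parcs D \<Longrightarrow> u = v" and "v < n"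
  shows "degree v = n - 1 \<longleftrightarrow> (\<forall>x<n. x \<noteq> v \<longrightarrow> adjacent D v x)"
proof -
  define other where "other e = (if sr e = v then ds e else sr e)" for e
  have "inj_on other (incident {..<m} v)"
  proof (rule inj_onI)
    fix e e' assume "e \<in> incident {..<m} v" "e' \<in> incident {..<m} v" and eq: "other e = other e'"
    then have e: "e < m" "sr e \<noteq> ds e" "sr e = v \<or> ds e = v"
      and e': "e' < m" "sr e' \<noteq> ds e'" "sr e' = v \<or> ds e' = v"
      unfolding incident_def by simp_all
    have "sr e = v \<longleftrightarrow> sr e' = v"
    proof (rule ccontr)
      assume "(sr e = v) \<noteq> (sr e' = v)"
      then have "sr e = ds e'" "ds e = sr e'" using e(2,3) e'(2,3) eq unfolding other_def by metis+
      then show False using antisym[of "sr e" "ds e"] arc[OF e(1)] arc[OF e'(1)] e(2) by simp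
    qed
    then have "sr e = sr e'" "ds e = ds e'" using e(3) e'(3) eq unfolding other_def by metis+
    then show "e = e'" using inj_arcs e(1) e'(1) by blast
  qed
  then have "degree v = card (other ` incident {..<m} v)" by (simp add: degree_def card_image)
  also have "other ` incident {..<m} v = {x. x < n \<and> adjacent D v x}"
  proof (intro equalityI subsetI)
    fix x assume "x \<in> other ` incident {..<m} v"
    then obtain e where "e < m" "sr e \<noteq> ds e" "sr e = v \<or> ds e = v" "x = other e"
      by (auto simp: incident_def)
    then show "x \<in> {x. x < n \<and> adjacent D v x}"
      using arc[of e] sr_less[of e] ds_less[of e] by (auto simp: other_def adjacent_def)
  next
    fix x assume x: "x \<in> {x. x < n \<and> adjacent D v x}"
    then have "x \<noteq> v" "(v, x) \<in> parcs D \<or> (x, v) \<in> parcs D" by (auto simp: adjacent_def)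
    then obtain e where "e < m" "x \<noteq> v" "sr e = v \<and> ds e = x \<or> sr e = x \<and> ds e = v"
      using arcE by metis
    then show "x \<in> other ` incident {..<m} v"
      by (intro image_eqI[of _ _ e]) (auto simp: incident_def other_def)
  qed
  finally have deg: "degree v = card {x. x < n \<and> adjacent D v x}" .
  have sub: "{x. x < n \<and> adjacent D v x} \<subseteq> {..<n} - {v}" by (auto simp: adjacent_def)
  have card: "card ({..<n} - {v}) = n - 1" using \<open>v < n\<close> by simp
  have "degree v = n - 1 \<longleftrightarrow> {x. x < n \<and> adjacent D v x} = {..<n} - {v}"
    unfolding deg card[symmetric] using card_subset_eq[OF finite_Diff[OF finite_lessThan] sub] by metis
  also have "\<dots> \<longleftrightarrow> (\<forall>x<n. x \<noteq> v \<longrightarrow> adjacent D v x)" using sub by blast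
  finally show ?thesis .
qed

lemma kahn_topological:
  assumes "kahn a d n h c"
  shows "bij_betw a {..<n} {..<n}"
    and "x < n \<Longrightarrow> y < n \<Longrightarrow> (a x, a y) \<in> parcs D \<Longrightarrow> x \<le> y"
    and "(u, v) \<in> parcs D \<Longrightarrow> (v, u) \<in> parcs D \<Longrightarrow> u = v"
proof -
  have inj: "inj_on a {..<n}" and im: "a ` {..<n} \<subseteq> {..<n}"
    using kahnD(2,3)[OF assms] by auto
  then have "a ` {..<n} = {..<n}" by (simp add: endo_inj_surj)
  with inj show bij: "bij_betw a {..<n} {..<n}" by (simp add: bij_betw_def)
  show le: "x \<le> y" if xy: "x < n" "y < n" "(a x, a y) \<in> parcs D" for x y
  proof (cases "x = y")
    case False
    then have "a x \<noteq> a y" using inj xy by (auto simp: inj_on_def)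
    moreover obtain e where "e < m" "sr e = a x" "ds e = a y" using xy(3) by (rule arcE)
    ultimately obtain i where "i < y" "a i = a x" using kahnD(5)[OF assms \<open>y < n\<close>] by metis
    moreover from this have "i = x" using inj xy by (auto simp: inj_on_def)
    ultimately show ?thesis by simp
  qed simp
  show "u = v" if uv: "(u, v) \<in> parcs D" "(v, u) \<in> parcs D"
  proof -
    have "u \<in> a ` {..<n}" "v \<in> a ` {..<n}" using arc_vertices[OF uv(1)] bij by (auto simp: bij_betw_def)
    then obtain x y where "x < n" "u = a x" "y < n" "v = a y" by blast
    with uv le[of x y] le[of y x] show ?thesis by simp
  qed
qed

text \<open>A vertex of degree \<open>n - 1\<close> is adjacent to all others, and
  \<open>indep\<close> excludes arcs between two vertices of other degrees. So degrees decide
  adjacency and the queue decides direction.\<close>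

lemma layered:
  assumes kahn: "kahn a d n h c" and loops: "\<And>v. v < n \<Longrightarrow> (v, v) \<in> parcs D"
    and indep: "\<And>e. e < m \<Longrightarrow> sr e \<noteq> ds e \<Longrightarrow> degree (sr e) = n - 1 \<or> degree (ds e) = n - 1"
  shows "layered D a n (\<lambda>x. degree (a x) \<noteq> n - 1)"
proof
  note top = kahn_topological[OF kahn]
  show "bij_betw a {..<n} (pverts D)" using top(1) by (simp add: verts)
  show "u \<in> pverts D \<and> v \<in> pverts D" if "(u, v) \<in> parcs D" for u v
    using arc_vertices[OF that] by (simp add: verts)
  fix x y assume xy: "x < n" "y < n"
  have an: "a x < n" "a y < n" using top(1) xy by (auto simp: bij_betw_def)
  have eq: "a x = a y \<longleftrightarrow> x = y" using top(1) xy by (auto simp: bij_betw_def inj_on_def)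
  have univ: "degree v = n - 1 \<longleftrightarrow> (\<forall>x<n. x \<noteq> v \<longrightarrow> adjacent D v x)" if "v < n" for v
    using degree_universal[OF _ that] top(3) by blast
  show "(a x, a y) \<in> parcs D \<longleftrightarrow> x = y \<or> x < y \<and> \<not> (degree (a x) \<noteq> n - 1 \<and> degree (a y) \<noteq> n - 1)"
  proof (cases "x = y")
    case True
    then show ?thesis using loops an by simp
  next
    case False
    show ?thesis
    proof
      assume *: "(a x, a y) \<in> parcs D"
      then obtain e where "e < m" "sr e = a x" "ds e = a y" by (rule arcE)
      with indep[of e] eq False top(2)[OF xy *]
      show "x = y \<or> x < y \<and> \<not> (degree (a x) \<noteq> n - 1 \<and> degree (a y) \<noteq> n - 1)" by auto
    next
      assume "x = y \<or> x < y \<and> \<not> (degree (a x) \<noteq> n - 1 \<and> degree (a y) \<noteq> n - 1)"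
      with False have "x < y" "degree (a x) = n - 1 \<or> degree (a y) = n - 1" by auto
      then have "adjacent D (a x) (a y)"
        using univ an eq False adjacent_sym[of D "a x" "a y"] by auto
      with top(2)[OF xy(2,1)] \<open>x < y\<close> show "(a x, a y) \<in> parcs D" by (auto simp: adjacent_def)
    qed
  qed
qed

end

section \<open>Total correctness with static time bounds\<close>

notation Seq (infixr ";;" 60)

primrec straight :: "prog \<Rightarrow> bool" where
  "straight Skip \<longleftrightarrow> True"
| "straight (Assign x e) \<longleftrightarrow> True"
| "straight (Store a i e) \<longleftrightarrow> True"
| "straight (p ;; q) \<longleftrightarrow> straight p \<and> straight q"
| "straight (Cond b p q) \<longleftrightarrow> straight p \<and> straight q"
| "straight (While b p) \<longleftrightarrow> False"

text \<open>\<open>run\<close> and \<open>fits_prog\<close> are meaningful for programs without loops only.\<close>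

primrec run :: "prog \<Rightarrow> store \<Rightarrow> store" where
  "run Skip s = s"
| "run (Assign x e) s = s\<lparr>regs := (regs s)(x := eval_expr s e)\<rparr>"
| "run (Store a i e) s = s\<lparr>arrs := (arrs s)(a := (arrs s a)(eval_expr s i := eval_expr s e))\<rparr>"
| "run (p ;; q) s = run q (run p s)"
| "run (Cond b p q) s = (if eval_test s b then run p s else run q s)"
| "run (While b p) s = s"

primrec fits_prog :: "nat \<Rightarrow> prog \<Rightarrow> store \<Rightarrow> bool" where
  "fits_prog w Skip s \<longleftrightarrow> True"
| "fits_prog w (Assign x e) s \<longleftrightarrow> fits_expr w s e"
| "fits_prog w (Store a i e) s \<longleftrightarrow> fits_expr w s i \<and> fits_expr w s e"
| "fits_prog w (p ;; q) s \<longleftrightarrow> fits_prog w p s \<and> fits_prog w q (run p s)"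
| "fits_prog w (Cond b p q) s \<longleftrightarrow> fits_test w s b \<and> (if eval_test s b then fits_prog w p s else fits_prog w q s)"
| "fits_prog w (While b p) s \<longleftrightarrow> False"

text \<open>Bounds the running time if every loop makes at most \<open>I\<close> iterations and loops are not nested.\<close>

primrec time :: "nat \<Rightarrow> prog \<Rightarrow> nat" where
  "time I Skip = 1"
| "time I (Assign x e) = 1 + cost_expr e"
| "time I (Store a i e) = 1 + cost_expr i + cost_expr e"
| "time I (p ;; q) = time I p + time I q"
| "time I (Cond b p q) = 1 + cost_test b + time I p + time I q"
| "time I (While b p) = (I + 1) * (1 + cost_test b + time 0 p)"

text \<open>The body of a loop is charged as if its own loops made no iterations, so
  \<open>I\<close> is never multiplied by itself.\<close>

lemma time_linear: "\<exists>K. \<forall>I. time I p \<le> K * (I + 1)"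
proof (induction p)
  case (Seq p q)
  then obtain K L where "\<And>I. time I p \<le> K * (I + 1)" "\<And>I. time I q \<le> L * (I + 1)" by blast
  then have "time I (p ;; q) \<le> (K + L) * (I + 1)" for I
    using add_mono[of "time I p" "K * (I + 1)" "time I q" "L * (I + 1)"] by (simp add: algebra_simps)
  then show ?case by blast
next
  case (Cond b p q)
  then obtain K L where "\<And>I. time I p \<le> K * (I + 1)" "\<And>I. time I q \<le> L * (I + 1)" by blast
  then have "(1 + cost_test b) + (time I p + time I q) \<le>
      (1 + cost_test b) * (I + 1) + (K * (I + 1) + L * (I + 1))" for I
    by (intro add_mono) auto
  then have "time I (Cond b p q) \<le> (1 + cost_test b + K + L) * (I + 1)" for I
    unfolding distrib_right time.simps by (simp add: add.assoc)
  then show ?case by blast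
next
  case (While b p)
  show ?case by (rule exI[of _ "1 + cost_test b + time 0 p"]) (simp add: algebra_simps)
next
  case Skip
  show ?case by (rule exI[of _ 1]) simp
next
  case (Assign x e)
  show ?case by (rule exI[of _ "1 + cost_expr e"]) simp
next
  case (Store a i e)
  show ?case by (rule exI[of _ "1 + cost_expr i + cost_expr e"]) simp
qed

lemma straight_exec:
  "straight p \<Longrightarrow> fits_prog w p s \<Longrightarrow> \<exists>t. exec w p s t (run p s) \<and> t \<le> time I p"
proof (induction p arbitrary: s)
  case (Seq p q)
  then obtain t t' where "exec w p s t (run p s)" "t \<le> time I p"
    "exec w q (run p s) t' (run q (run p s))" "t' \<le> time I q" by fastforce
  then show ?case by (auto intro!: exI[of _ "t + t'"] exec_Seq)
next
  case (Cond b p q)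
  show ?case
  proof (cases "eval_test s b")
    case True
    with Cond obtain t where "exec w p s t (run p s)" "t \<le> time I p" by fastforce
    with True Cond.prems show ?thesis
      by (auto intro!: exI[of _ "1 + cost_test b + t"] exec_Cond_True[simplified])
  next
    case False
    with Cond obtain t where "exec w q s t (run q s)" "t \<le> time I q" by fastforce
    with False Cond.prems show ?thesis
      by (auto intro!: exI[of _ "1 + cost_test b + t"] exec_Cond_False[simplified])
  qed
next
  case Skip
  show ?case using exec_Skip by auto
next
  case (Assign x e)
  then show ?case using exec_Assign[of w s e x] by auto
next
  case (Store a i e)
  then show ?case using exec_Store[of w s i e a] by auto
qed simp

text \<open>Total correctness with a time bound that depends on the program and \<open>I\<close> but
  not on the state, so no time estimate has to be carried through the proofs about single
  phases.\<close>

definition runs :: "nat \<Rightarrow> nat \<Rightarrow> prog \<Rightarrow> store \<Rightarrow> (store \<Rightarrow> bool) \<Rightarrow> bool" where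
  "runs w I p s Q \<longleftrightarrow> (\<exists>t s'. exec w p s t s' \<and> t \<le> time I p \<and> Q s')"

lemma runs_straight:
  assumes "straight p" "fits_prog w p s" "Q (run p s)"
  shows "runs w I p s Q"
  using straight_exec[OF assms(1,2)] assms(3) unfolding runs_def by blast

lemma runs_mono: "runs w I p s Q \<Longrightarrow> (\<And>s'. Q s' \<Longrightarrow> R s') \<Longrightarrow> runs w I p s R"
  unfolding runs_def by blast

primrec written_regs :: "prog \<Rightarrow> nat set" where
  "written_regs Skip = {}"
| "written_regs (Assign x e) = {x}"
| "written_regs (Store a i e) = {}"
| "written_regs (p ;; q) = written_regs p \<union> written_regs q"
| "written_regs (Cond b p q) = written_regs p \<union> written_regs q"
| "written_regs (While b p) = written_regs p"

primrec written_arrs :: "prog \<Rightarrow> nat set" where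
  "written_arrs Skip = {}"
| "written_arrs (Assign x e) = {}"
| "written_arrs (Store a i e) = {a}"
| "written_arrs (p ;; q) = written_arrs p \<union> written_arrs q"
| "written_arrs (Cond b p q) = written_arrs p \<union> written_arrs q"
| "written_arrs (While b p) = written_arrs p"

text \<open>The frame condition: each phase keeps all facts about registers and arrays that it does
  not write.\<close>

definition agree :: "nat set \<Rightarrow> nat set \<Rightarrow> store \<Rightarrow> store \<Rightarrow> bool" where
  "agree X A s s' \<longleftrightarrow> (\<forall>x. x \<notin> X \<longrightarrow> regs s' x = regs s x) \<and> (\<forall>a. a \<notin> A \<longrightarrow> arrs s' a = arrs s a)"

lemma agree_regs: "agree X A s s' \<Longrightarrow> x \<notin> X \<Longrightarrow> regs s' x = regs s x"
  and agree_arrs: "agree X A s s' \<Longrightarrow> a \<notin> A \<Longrightarrow> arrs s' a = arrs s a"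
  by (auto simp: agree_def)

lemma agree_trans: "agree X A s s' \<Longrightarrow> agree X A s' s'' \<Longrightarrow> agree X A s s''"
  by (simp add: agree_def)

lemma agree_mono: "agree X A s s' \<Longrightarrow> X \<subseteq> Y \<Longrightarrow> A \<subseteq> B \<Longrightarrow> agree Y B s s'"
  unfolding agree_def by blast

lemma exec_agree: "exec w p s t s' \<Longrightarrow> agree (written_regs p) (written_arrs p) s s'"
  by (induction rule: exec.induct) (auto simp: agree_def)

lemma run_agree: "agree (written_regs p) (written_arrs p) s (run p s)"
proof (induction p arbitrary: s)
  case (Seq p q)
  from Seq(1)[of s] Seq(2)[of "run p s"] show ?case by (auto simp: agree_def)
qed (auto simp: agree_def)

lemma runs_frame:
  "runs w I p s Q \<Longrightarrow> runs w I p s (\<lambda>s'. Q s' \<and> agree (written_regs p) (written_arrs p) s s')"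
  unfolding runs_def using exec_agree by blast

lemma runs_Seq:
  assumes "runs w I p s R"
    and "\<And>s'. R s' \<Longrightarrow> agree (written_regs p) (written_arrs p) s s' \<Longrightarrow> runs w I q s' Q"
  shows "runs w I (p ;; q) s Q"
proof -
  obtain t s' where p: "exec w p s t s'" "t \<le> time I p" "R s'" using assms(1) by (auto simp: runs_def)
  then obtain t' s'' where "exec w q s' t' s''" "t' \<le> time I q" "Q s''"
    using assms(2)[OF p(3) exec_agree[OF p(1)]] unfolding runs_def by blast
  with p show ?thesis unfolding runs_def
    by (intro exI[of _ "t + t'"] exI[of _ s'']) (auto intro: exec_Seq)
qed

lemma runs_Seq_straight:
  assumes "straight p" "fits_prog w p s" "runs w I q (run p s) Q"
  shows "runs w I (p ;; q) s Q"
  by (rule runs_Seq[where R = "\<lambda>s'. s' = run p s"]) (use assms in \<open>auto intro: runs_straight\<close>)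

lemma runs_Cond:
  assumes "fits_test w s b" "eval_test s b \<Longrightarrow> runs w I p s Q" "\<not> eval_test s b \<Longrightarrow> runs w I q s Q"
  shows "runs w I (Cond b p q) s Q"
proof (cases "eval_test s b")
  case True
  with assms obtain t s' where "exec w p s t s'" "t \<le> time I p" "Q s'" by (auto simp: runs_def)
  with True assms(1) show ?thesis unfolding runs_def
    by (intro exI[of _ "1 + cost_test b + t"] exI[of _ s']) (auto intro: exec_Cond_True[simplified])
next
  case False
  with assms obtain t s' where "exec w q s t s'" "t \<le> time I q" "Q s'" by (auto simp: runs_def)
  with False assms(1) show ?thesis unfolding runs_def
    by (intro exI[of _ "1 + cost_test b + t"] exI[of _ s']) (auto intro: exec_Cond_False[simplified])
qed

lemma runs_While:
  assumes "straight p" "J s" "\<mu> s \<le> I"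
    and fits: "\<And>s. J s \<Longrightarrow> fits_test w s b"
    and step: "\<And>s. J s \<Longrightarrow> eval_test s b \<Longrightarrow> fits_prog w p s \<and> J (run p s) \<and> \<mu> (run p s) < \<mu> s"
  shows "runs w I (While b p) s (\<lambda>s'. J s' \<and> \<not> eval_test s' b)"
proof -
  let ?c = "1 + cost_test b + time 0 p"
  \<comment> \<open>One more than the measure, to pay for the final test that fails.\<close>
  have "\<exists>t s'. exec w (While b p) s t s' \<and> t \<le> (\<mu> s + 1) * ?c \<and> J s' \<and> \<not> eval_test s' b"
    using assms(2)
  proof (induction "\<mu> s" arbitrary: s rule: less_induct)
    case less
    show ?case
    proof (cases "eval_test s b")
      case True
      with step less.prems have *: "fits_prog w p s" "J (run p s)" "\<mu> (run p s) < \<mu> s" by auto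
      from straight_exec[OF assms(1) *(1)] obtain t where t: "exec w p s t (run p s)" "t \<le> time 0 p" by blast
      from less.hyps[OF *(3,2)] obtain t' s' where
        t': "exec w (While b p) (run p s) t' s'" "t' \<le> (\<mu> (run p s) + 1) * ?c" "J s'" "\<not> eval_test s' b"
        by blast
      have "1 + cost_test b + t + t' \<le> ?c + (\<mu> (run p s) + 1) * ?c" using t(2) t'(2) by simp
      also have "\<dots> = (\<mu> (run p s) + 1 + 1) * ?c" by (simp add: algebra_simps)
      also have "\<dots> \<le> (\<mu> s + 1) * ?c" using *(3) by (intro mult_right_mono) auto
      finally show ?thesis
        using exec_While_True[OF fits[OF less.prems] True t(1) t'(1)] t'(3,4) by blast
    next
      case False
      then show ?thesis
        using exec_While_False[OF fits[OF less.prems] False, of p] less.prems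
        by (intro exI[of _ "1 + cost_test b"] exI[of _ s]) auto
    qed
  qed
  then obtain t s' where "exec w (While b p) s t s'" "t \<le> (\<mu> s + 1) * ?c" "J s'" "\<not> eval_test s' b" by blast
  moreover have "(\<mu> s + 1) * ?c \<le> (I + 1) * ?c" using assms(3) by (intro mult_right_mono) auto
  ultimately show ?thesis unfolding runs_def by (auto intro!: exI[of _ t] exI[of _ s'])
qed

text \<open>Register 3 is the loop counter of every \<open>For\<close> loop.\<close>

definition For :: "nat \<Rightarrow> prog \<Rightarrow> prog" where
  "For l p = Assign 3 (Num 0) ;; While (Less (Reg 3) (Reg l)) (p ;; Assign 3 (Add (Reg 3) (Num 1)))"

lemma written_For [simp]:
  "written_regs (For l p) = insert 3 (written_regs p)" "written_arrs (For l p) = written_arrs p"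
  by (auto simp: For_def)

text \<open>The index reaches the invariant as the parameter \<open>k\<close> of \<open>J\<close>;
  \<open>upd\<close> says that \<open>J\<close> itself ignores register 3, which the loop increments
  between rounds.\<close>

lemma runs_For:
  assumes "straight p" "l \<noteq> 3" "l \<notin> written_regs p" "3 \<notin> written_regs p"
    and "regs s l = L" "L \<le> I" "L < w" "J 0 s"
    and step: "\<And>k s'. k < L \<Longrightarrow> J k s' \<Longrightarrow> regs s' 3 = k \<Longrightarrow> regs s' l = L \<Longrightarrow>
      agree (insert 3 (written_regs p)) (written_arrs p) s s' \<Longrightarrow> fits_prog w p s' \<and> J (Suc k) (run p s')"
    and upd: "\<And>k s v. J k s \<Longrightarrow> J k (s\<lparr>regs := (regs s)(3 := v)\<rparr>)"
  shows "runs w I (For l p) s (J L)"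
proof -
  let ?X = "insert 3 (written_regs p)" and ?s = "s\<lparr>regs := (regs s)(3 := 0)\<rparr>"
  let ?J = "\<lambda>s'. J (regs s' 3) s' \<and> regs s' 3 \<le> L \<and> regs s' l = L \<and> agree ?X (written_arrs p) s s'"
  have "runs w I (While (Less (Reg 3) (Reg l)) (p ;; Assign 3 (Add (Reg 3) (Num 1)))) ?s
      (\<lambda>s'. ?J s' \<and> \<not> eval_test s' (Less (Reg 3) (Reg l)))"
  proof (rule runs_While[where \<mu> = "\<lambda>s. L - regs s 3"])
    show "?J ?s" using assms upd[OF assms(8), of 0] by (auto simp: agree_def)
    fix s' assume J: "?J s'" and "eval_test s' (Less (Reg 3) (Reg l))"
    then have less: "regs s' 3 < L" by simp
    have ag: "agree (written_regs p) (written_arrs p) s' (run p s')" by (rule run_agree)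
    have 3: "regs (run p s') 3 = regs s' 3" "regs (run p s') l = L"
      using agree_regs[OF ag] assms(3,4) J by auto
    have "agree ?X (written_arrs p) s (run p s')"
      using J agree_mono[OF ag, of ?X "written_arrs p"] agree_trans by blast
    then have "agree ?X (written_arrs p) s (run (p ;; Assign 3 (Add (Reg 3) (Num 1))) s')"
      by (auto simp: agree_def)
    moreover have "fits_prog w p s'" "J (Suc (regs s' 3)) (run p s')"
      using step[OF less, of s'] J by auto
    ultimately show "fits_prog w (p ;; Assign 3 (Add (Reg 3) (Num 1))) s' \<and>
        ?J (run (p ;; Assign 3 (Add (Reg 3) (Num 1))) s') \<and>
        L - regs (run (p ;; Assign 3 (Add (Reg 3) (Num 1))) s') 3 < L - regs s' 3"
      using less 3 assms(2,7) upd by (auto simp: fun_upd_def)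
  qed (use assms in auto)
  then have "runs w I (While (Less (Reg 3) (Reg l)) (p ;; Assign 3 (Add (Reg 3) (Num 1)))) ?s (J L)"
    by (rule runs_mono) auto
  then show ?thesis
    unfolding For_def by (intro runs_Seq_straight) auto
qed

text \<open>The result is an index plus one, so that 0 can signal failure. The loop always runs to
  its end, hence the last hit wins.\<close>

definition Find :: "nat \<Rightarrow> test \<Rightarrow> nat \<Rightarrow> prog" where
  "Find l b r = Assign r (Num 0) ;; For l (Cond b (Assign r (Add (Reg 3) (Num 1))) Skip)"

lemma written_Find [simp]: "written_regs (Find l b r) = {r, 3}" "written_arrs (Find l b r) = {}"
  by (auto simp: Find_def)

lemma runs_Find:
  assumes "l \<noteq> 3" "r \<noteq> 3" "l \<noteq> r" "regs s l = L" "L \<le> I" "L < w"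
    and b: "\<And>k s'. k < L \<Longrightarrow> regs s' 3 = k \<Longrightarrow> agree {r, 3} {} s s' \<Longrightarrow>
      fits_test w s' b \<and> (eval_test s' b \<longleftrightarrow> P k)"
  shows "runs w I (Find l b r) s (\<lambda>s'. regs s' r = 0 \<and> (\<forall>k<L. \<not> P k) \<or>
    (\<exists>k<L. regs s' r = Suc k \<and> P k))"
proof -
  let ?s = "s\<lparr>regs := (regs s)(r := 0)\<rparr>"
  let ?J = "\<lambda>k s'. regs s' r = 0 \<and> (\<forall>i<k. \<not> P i) \<or> (\<exists>i<k. regs s' r = Suc i \<and> P i)"
  have "runs w I (For l (Cond b (Assign r (Add (Reg 3) (Num 1))) Skip)) ?s (?J L)"
  proof (rule runs_For[where J = ?J])
    fix k s' assume *: "k < L" "?J k s'" "regs s' 3 = k"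
      and "agree (insert 3 (written_regs (Cond b (Assign r (Add (Reg 3) (Num 1))) Skip)))
        (written_arrs (Cond b (Assign r (Add (Reg 3) (Num 1))) Skip)) ?s s'"
    then have "agree {r, 3} {} s s'" by (auto simp: agree_def)
    with b * have "fits_test w s' b \<and> (eval_test s' b \<longleftrightarrow> P k)" by blast
    with * assms show "fits_prog w (Cond b (Assign r (Add (Reg 3) (Num 1))) Skip) s' \<and>
        ?J (Suc k) (run (Cond b (Assign r (Add (Reg 3) (Num 1))) Skip) s')"
      by (auto simp: less_Suc_eq)
  qed (use assms in auto)
  then show ?thesis unfolding Find_def by (intro runs_Seq_straight) auto
qed

definition Emit :: "nat \<Rightarrow> test \<Rightarrow> expr \<Rightarrow> prog" where
  "Emit l b e = For l (Cond b (Store 1 (Reg 0) e ;; Assign 0 (Add (Reg 0) (Num 1))) Skip)"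

lemma written_Emit [simp]: "written_regs (Emit l b e) = {0, 3}" "written_arrs (Emit l b e) = {1}"
  by (auto simp: Emit_def)

lemma runs_Emit:
  assumes "l \<noteq> 3" "l \<noteq> 0" "regs s l = L" "L \<le> I" "regs s 0 + L < w"
    and b: "\<And>k s'. k < L \<Longrightarrow> regs s' 3 = k \<Longrightarrow> agree {0, 3} {1} s s' \<Longrightarrow>
      fits_test w s' b \<and> (eval_test s' b \<longleftrightarrow> P k) \<and> fits_expr w s' e \<and> eval_expr s' e = f k"
  shows "runs w I (Emit l b e) s (\<lambda>s'. output_of s' = output_of s @ map f (filter P [0..<L]))"
proof -
  let ?p = "Cond b (Store 1 (Reg 0) e ;; Assign 0 (Add (Reg 0) (Num 1))) Skip"
  let ?J = "\<lambda>k s'. output_of s' = output_of s @ map f (filter P [0..<k]) \<and> regs s' 0 \<le> regs s 0 + k"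
  have "runs w I (For l ?p) s (?J L)"
  proof (rule runs_For[where J = ?J])
    fix k s' assume *: "k < L" "?J k s'" "regs s' 3 = k"
      and "agree (insert 3 (written_regs ?p)) (written_arrs ?p) s s'"
    then have "agree {0, 3} {1} s s'" by (auto simp: agree_def)
    with b * have "fits_test w s' b \<and> (eval_test s' b \<longleftrightarrow> P k) \<and> fits_expr w s' e \<and> eval_expr s' e = f k" by blast
    with * assms(5) show "fits_prog w ?p s' \<and> ?J (Suc k) (run ?p s')"
      by (auto simp: output_of_def)
  qed (use assms in \<open>auto simp: output_of_def\<close>)
  then show ?thesis unfolding Emit_def by (rule runs_mono) auto
qed

primrec Write :: "nat \<Rightarrow> expr list \<Rightarrow> prog" where
  "Write i [] = Assign 0 (Num i)"
| "Write i (e # es) = Store 1 (Num i) e ;; Write (Suc i) es"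

section \<open>Loops and topological sorting on the machine\<close>

text \<open>
  Memory layout: register 1 holds \<open>n\<close>, register 2 holds \<open>m\<close>, and arrays 2 to 5 hold \<open>sr\<close>, \<open>ds\<close>,
  \<open>off\<close> and \<open>len\<close>. Array 6 marks the vertices with loops, 7 counts unprocessed entering arcs, 8 is
  the queue, 9 holds predecessors, 10 degrees, 11 to 13 mark the neighbours of single vertices.
  Arrays 14 and 15 list the positions in the queue of the tournament vertices and of the elements
  of \<open>S\<close>, and 16 holds the classes of the latter.
\<close>

abbreviation "Source \<equiv> Cell 2 (Reg 3)"
abbreviation "Target \<equiv> Cell 3 (Reg 3)"
abbreviation "inc x \<equiv> Assign x (Add (Reg x) (Num 1))"

definition check_loops :: prog where
  "check_loops = For 2 (Cond (Equal Source Target) (Store 6 Source (Num 1)) Skip) ;;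
    Find 1 (Equal (Cell 6 (Reg 3)) (Num 0)) 4"

definition count_entering :: prog where
  "count_entering = For 2 (Cond (Equal Source Target) Skip (Store 7 Target (Add (Cell 7 Target) (Num 1))))"

definition queue_sources :: prog where
  "queue_sources = Assign 4 (Num 0) ;;
    For 1 (Cond (Equal (Cell 7 (Reg 3)) (Num 0)) (Store 8 (Reg 4) (Reg 3) ;; inc 4) Skip)"

text \<open>The loop over the queue and the loop over the arcs of one vertex are merged: each round
  either handles one arc or finishes one vertex. This keeps the body free of loops.\<close>

definition process_queue :: prog where
  "process_queue = Assign 5 (Num 0) ;; Assign 6 (Num 0) ;; While (Less (Reg 5) (Reg 4))
    (Assign 7 (Cell 8 (Reg 5)) ;;
     Cond (Less (Reg 6) (Cell 5 (Reg 7)))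
      (Assign 8 (Cell 3 (Add (Cell 4 (Reg 7)) (Reg 6))) ;; inc 6 ;;
       Cond (Equal (Reg 8) (Reg 7)) Skip
        (Store 7 (Reg 8) (Sub (Cell 7 (Reg 8)) (Num 1)) ;;
         Cond (Equal (Cell 7 (Reg 8)) (Num 0)) (Store 8 (Reg 4) (Reg 8) ;; inc 4) Skip))
      (inc 5 ;; Assign 6 (Num 0)))"

definition topsort :: prog where
  "topsort = count_entering ;; queue_sources ;; process_queue"

text \<open>After \<open>n\<close> predecessor steps register 5 lies on a cycle. Register 6 then
  counts its length, and the last loop fills array 1 from the back because predecessors run against
  the arcs; cell 0 is kept for the tag.\<close>

definition output_cycle :: prog where
  "output_cycle =
    For 2 (Cond (Conj (Neg (Equal Source Target))
        (Conj (Neg (Equal (Cell 7 Source) (Num 0))) (Neg (Equal (Cell 7 Target) (Num 0)))))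
      (Store 9 Target Source) Skip) ;;
    Find 1 (Neg (Equal (Cell 7 (Reg 3)) (Num 0))) 5 ;;
    Assign 5 (Sub (Reg 5) (Num 1)) ;;
    For 1 (Assign 5 (Cell 9 (Reg 5))) ;;
    Assign 6 (Num 1) ;; Assign 7 (Cell 9 (Reg 5)) ;;
    While (Neg (Equal (Reg 7) (Reg 5))) (Assign 7 (Cell 9 (Reg 7)) ;; inc 6) ;;
    For 6 (Store 1 (Sub (Reg 6) (Reg 3)) (Reg 7) ;; Assign 7 (Cell 9 (Reg 7))) ;;
    Store 1 (Num 0) (Num 4) ;; Assign 0 (Add (Reg 6) (Num 1))"

text \<open>The word bound covers input addresses (about \<open>n + m\<close>), degrees, a partly
  written output plus another pass of length \<open>n\<close>, and the small numerals of the
  program, with room to spare.\<close>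

locale arc_machine = arc_arrays +
  fixes w I :: nat
  assumes w: "3 * (n + m) + 20 \<le> w" and I: "n + m \<le> I"
begin

definition graph :: "store \<Rightarrow> bool" where
  "graph s \<longleftrightarrow> regs s 1 = n \<and> regs s 2 = m \<and> (\<forall>e<m. arrs s 2 e = sr e \<and> arrs s 3 e = ds e) \<and>
    (\<forall>u<n. arrs s 4 u = off u \<and> arrs s 5 u = len u)"

lemma graphD:
  "graph s \<Longrightarrow> regs s (Suc 0) = n" "graph s \<Longrightarrow> regs s 1 = n" "graph s \<Longrightarrow> regs s 2 = m"
  "graph s \<Longrightarrow> e < m \<Longrightarrow> arrs s 2 e = sr e" "graph s \<Longrightarrow> e < m \<Longrightarrow> arrs s 3 e = ds e"
  "graph s \<Longrightarrow> u < n \<Longrightarrow> arrs s 4 u = off u" "graph s \<Longrightarrow> u < n \<Longrightarrow> arrs s 5 u = len u"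
  by (simp_all add: graph_def)

lemma graph_agree:
  assumes "agree X A s s'" "graph s" "1 \<notin> X" "2 \<notin> X" "2 \<notin> A" "3 \<notin> A" "4 \<notin> A" "5 \<notin> A"
  shows "graph s'"
  using assms by (simp add: graph_def agree_def)

lemma check_loops:
  assumes s: "graph s" "\<And>v. arrs s 6 v = 0"
  shows "runs w I check_loops s (\<lambda>s'. regs s' 4 = 0 \<and> (\<forall>v<n. (v, v) \<in> parcs D) \<or>
    (\<exists>v<n. regs s' 4 = Suc v \<and> (v, v) \<notin> parcs D))"
  unfolding check_loops_def
proof (rule runs_Seq)
  let ?p = "Cond (Equal Source Target) (Store 6 Source (Num 1)) Skip"
  let ?J = "\<lambda>k s'. \<forall>v. arrs s' 6 v = 0 \<longleftrightarrow> \<not> (\<exists>e<k. sr e = v \<and> ds e = v)"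
  show "runs w I (For 2 ?p) s (?J m)"
  proof (rule runs_For[where J = ?J])
    show "?J 0 s" using s by simp
    fix k s' assume k: "k < m" and J: "?J k s'" and 3: "regs s' 3 = k"
      and ag: "agree (insert 3 (written_regs ?p))
        (written_arrs ?p) s s'"
    have g: "graph s'" by (rule graph_agree[OF ag s(1)]) simp_all
    show "fits_prog w ?p s' \<and>
        ?J (Suc k) (run ?p s')"
      using J 3 graphD[OF g] k w by (auto simp: less_Suc_eq)
  qed (use graphD[OF s(1)] w I in simp_all)
  fix s' assume J: "?J m s'"
    and ag: "agree (written_regs (For 2 ?p))
      (written_arrs (For 2 ?p)) s s'"
  have g: "graph s'" by (rule graph_agree[OF ag s(1)]) simp_all
  have zero: "arrs s' 6 v = 0 \<longleftrightarrow> (v, v) \<notin> parcs D" for v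
    using J by (auto simp: arcs image_iff)
  show "runs w I (Find 1 (Equal (Cell 6 (Reg 3)) (Num 0)) 4) s'
      (\<lambda>s'. regs s' 4 = 0 \<and> (\<forall>v<n. (v, v) \<in> parcs D) \<or> (\<exists>v<n. regs s' 4 = Suc v \<and> (v, v) \<notin> parcs D))"
    by (rule runs_mono[OF runs_Find[where P = "\<lambda>v. (v, v) \<notin> parcs D" and L = n]])
      (use graphD[OF g] w I zero in \<open>auto simp: agree_arrs\<close>)
qed

lemma card_entering_Suc:
  "card (entering {..<Suc k} v) = card (entering {..<k} v) + (if ds k = v \<and> sr k \<noteq> v then 1 else 0)"
proof -
  have "entering {..<Suc k} v = (if ds k = v \<and> sr k \<noteq> v then insert k (entering {..<k} v) else entering {..<k} v)"
    by (auto simp: entering_def less_Suc_eq)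
  moreover have "k \<notin> entering {..<k} v" by (simp add: entering_def)
  ultimately show ?thesis by simp
qed

lemma count_entering:
  assumes s: "graph s" "\<And>v. arrs s 7 v = 0"
  shows "runs w I count_entering s (\<lambda>s'. \<forall>v. arrs s' 7 v = card (entering {..<m} v))"
  unfolding count_entering_def
proof (rule runs_For[where J = "\<lambda>k s'. \<forall>v. arrs s' 7 v = card (entering {..<k} v)"])
  let ?p = "Cond (Equal Source Target) Skip (Store 7 Target (Add (Cell 7 Target) (Num 1)))"
  show "\<forall>v. arrs s 7 v = card (entering {..<0} v)" using s by (simp add: entering_def)
  fix k s' assume k: "k < m" and J: "\<forall>v. arrs s' 7 v = card (entering {..<k} v)" and 3: "regs s' 3 = k"
    and ag: "agree (insert 3 (written_regs ?p)) (written_arrs ?p) s s'"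
  have g: "graph s'" by (rule graph_agree[OF ag s(1)]) simp_all
  have "card (entering {..<k} (ds k)) \<le> k"
    using card_mono[of "{..<k}" "entering {..<k} (ds k)"] by (auto simp: entering_def)
  then show "fits_prog w ?p s' \<and> (\<forall>v. arrs (run ?p s') 7 v = card (entering {..<Suc k} v))"
    using J 3 graphD[OF g] k w by (auto simp: card_entering_Suc)
qed (use graphD[OF s(1)] w I in simp_all)

lemma queue_sources:
  assumes s: "graph s"
  shows "runs w I queue_sources s (\<lambda>s'. inj_on (arrs s' 8) {..<regs s' 4} \<and>
    (\<forall>v. (\<exists>j<regs s' 4. arrs s' 8 j = v) \<longleftrightarrow> v < n \<and> arrs s 7 v = 0))"
  unfolding queue_sources_def
proof (rule runs_Seq_straight, simp, use w in simp)
  let ?p = "Cond (Equal (Cell 7 (Reg 3)) (Num 0)) (Store 8 (Reg 4) (Reg 3) ;; inc 4) Skip"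
  let ?s = "run (Assign 4 (Num 0)) s"
  let ?J = "\<lambda>k s'. inj_on (arrs s' 8) {..<regs s' 4} \<and>
      (\<forall>v. (\<exists>j<regs s' 4. arrs s' 8 j = v) \<longleftrightarrow> v < k \<and> arrs s 7 v = 0) \<and> regs s' 4 \<le> k"
  have "runs w I (For 1 ?p) ?s (?J n)"
  proof (rule runs_For[where J = ?J])
    show "?J 0 ?s" by simp
    fix k s' assume k: "k < n" and J: "?J k s'" and 3: "regs s' 3 = k"
      and ag: "agree (insert 3 (written_regs ?p)) (written_arrs ?p) ?s s'"
    have 7: "arrs s' 7 = arrs s 7" using agree_arrs[OF ag, of 7] by simp
    show "fits_prog w ?p s' \<and> ?J (Suc k) (run ?p s')"
    proof (cases "arrs s 7 k = 0")
      case True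
      have new: "arrs s' 8 j \<noteq> k" if "j < regs s' 4" for j using J that by blast
      have "inj_on ((arrs s' 8)(regs s' 4 := k)) {..<regs s' 4}" using J by (simp add: inj_on_def)
      moreover have "k \<notin> arrs s' 8 ` {..<regs s' 4}" using new by blast
      ultimately have "inj_on ((arrs s' 8)(regs s' 4 := k)) {..<Suc (regs s' 4)}"
        by (auto simp: lessThan_Suc)
      moreover have "(\<exists>j<Suc (regs s' 4). ((arrs s' 8)(regs s' 4 := k)) j = v) \<longleftrightarrow>
          (\<exists>j<regs s' 4. arrs s' 8 j = v) \<or> v = k" for v
        by (metis fun_upd_apply less_Suc_eq less_irrefl)
      ultimately show ?thesis using True J 3 7 k w by (auto simp: less_Suc_eq)
    next
      case False
      then show ?thesis using J 3 7 w by (auto simp: less_Suc_eq)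
    qed
  qed (use graphD[OF s] w I in simp_all)
  then show "runs w I (For 1 ?p) ?s (\<lambda>s'. inj_on (arrs s' 8) {..<regs s' 4} \<and>
      (\<forall>v. (\<exists>j<regs s' 4. arrs s' 8 j = v) \<longleftrightarrow> v < n \<and> arrs s 7 v = 0))"
    by (rule runs_mono) simp
qed

lemma unprocessed_push: "h < t \<Longrightarrow> unprocessed (a(t := v)) (Suc t) h c = unprocessed a t h c"
  by (auto simp: unprocessed_def)

lemma process_queue:
  assumes s: "graph s" "kahn (arrs s 8) (arrs s 7) (regs s 4) 0 0"
  shows "runs w I process_queue s (\<lambda>s'. \<exists>c. kahn (arrs s' 8) (arrs s' 7) (regs s' 4) (regs s' 4) c)"
  unfolding process_queue_def
proof (rule runs_Seq_straight, simp, use w in simp, rule runs_Seq_straight, simp, use w in simp)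
  let ?p = "Assign 7 (Cell 8 (Reg 5)) ;;
     Cond (Less (Reg 6) (Cell 5 (Reg 7)))
      (Assign 8 (Cell 3 (Add (Cell 4 (Reg 7)) (Reg 6))) ;; inc 6 ;;
       Cond (Equal (Reg 8) (Reg 7)) Skip
        (Store 7 (Reg 8) (Sub (Cell 7 (Reg 8)) (Num 1)) ;;
         Cond (Equal (Cell 7 (Reg 8)) (Num 0)) (Store 8 (Reg 4) (Reg 8) ;; inc 4) Skip))
      (inc 5 ;; Assign 6 (Num 0))"
  let ?s = "run (Assign 6 (Num 0)) (run (Assign 5 (Num 0)) s)"
  let ?J = "\<lambda>s'. graph s' \<and> kahn (arrs s' 8) (arrs s' 7) (regs s' 4) (regs s' 5) (regs s' 6)"
  \<comment> \<open>The work left: arcs to be processed plus vertices to be finished, at most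
    \<open>m + n\<close> in the beginning.\<close>
  let ?\<mu> = "\<lambda>s'. card (unprocessed (arrs s' 8) (regs s' 4) (regs s' 5) (regs s' 6)) + (n - regs s' 5)"
  have "runs w I (While (Less (Reg 5) (Reg 4)) ?p) ?s (\<lambda>s'. ?J s' \<and> \<not> eval_test s' (Less (Reg 5) (Reg 4)))"
  proof (rule runs_While[where \<mu> = ?\<mu>])
    show "straight ?p" by simp
    have "graph ?s" by (rule graph_agree[of "{5, 6}" "{}", OF _ s(1)]) (simp_all add: agree_def)
    with s show "?J ?s" by simp
    have "card (unprocessed (arrs ?s 8) (regs ?s 4) (regs ?s 5) (regs ?s 6)) \<le> card {..<m}"
      by (intro card_mono) (auto simp: unprocessed_def)
    with I show "?\<mu> ?s \<le> I" by simp
    fix s' assume J: "?J s'"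
    show "fits_test w s' (Less (Reg 5) (Reg 4))" by simp
    assume "eval_test s' (Less (Reg 5) (Reg 4))"
    then have less: "regs s' 5 < regs s' 4" by simp
    define a d t h c where "a = arrs s' 8" and "d = arrs s' 7" and "t = regs s' 4" and "h = regs s' 5"
      and "c = regs s' 6"
    note defs = a_def[symmetric] d_def[symmetric] t_def[symmetric] h_def[symmetric] c_def[symmetric]
    from J less have k: "kahn a d t h c" and ht: "h < t" and g: "graph s'" by (simp_all add: defs)
    have tn: "t \<le> n" by (rule kahn_length[OF k])
    have u: "a h < n" by (rule kahnD(3)[OF k ht])
    have g': "graph (run ?p s')" by (rule graph_agree[OF run_agree[of ?p s'] g]) simp_all
    have len: "arrs s' 5 (a h) = len (a h)" and off: "arrs s' 4 (a h) = off (a h)" using graphD[OF g] u by simp_all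
    show "fits_prog w ?p s' \<and> ?J (run ?p s') \<and> ?\<mu> (run ?p s') < ?\<mu> s'"
    proof (cases "c < len (a h)")
      case False
      note adv = kahn_advance[OF k ht False]
      have fits: "fits_prog w ?p s'" using False len w tn ht by (simp add: defs)
      have upd: "arrs (run ?p s') 8 = a" "arrs (run ?p s') 7 = d" "regs (run ?p s') 4 = t"
        "regs (run ?p s') 5 = Suc h" "regs (run ?p s') 6 = 0"
        using False len by (simp_all add: defs)
      have "kahn (arrs (run ?p s') 8) (arrs (run ?p s') 7) (regs (run ?p s') 4) (regs (run ?p s') 5)
          (regs (run ?p s') 6)" unfolding upd by (rule adv)
      moreover have "?\<mu> (run ?p s') < ?\<mu> s'" unfolding upd adv(2) defs using ht tn by linarith
      ultimately show ?thesis using fits g' by blast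
    next
      case True
      note arc = kahn_arc[OF k ht True]
      have ds: "arrs s' 3 (off (a h) + c) = ds (off (a h) + c)" using graphD(5)[OF g arc(1)] .
      have decr: "card (unprocessed a t h (Suc c)) < card (unprocessed a t h c)"
        unfolding arc(4) using card_Diff1_less[OF finite_unprocessed arc(3)] .
      show ?thesis
      proof (cases "ds (off (a h) + c) = a h")
        case eq: True
        have fits: "fits_prog w ?p s'" using True len off ds eq w arc(1) by (simp add: defs)
        have upd: "arrs (run ?p s') 8 = a" "arrs (run ?p s') 7 = d" "regs (run ?p s') 4 = t"
          "regs (run ?p s') 5 = h" "regs (run ?p s') 6 = Suc c"
          using True len off ds eq by (simp_all add: defs)
        have "kahn (arrs (run ?p s') 8) (arrs (run ?p s') 7) (regs (run ?p s') 4) (regs (run ?p s') 5)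
            (regs (run ?p s') 6)" unfolding upd by (rule kahn_skip[OF k ht True eq])
        moreover have "?\<mu> (run ?p s') < ?\<mu> s'" unfolding upd defs using decr by simp
        ultimately show ?thesis using fits g' by blast
      next
        case ne: False
        define v where "v = ds (off (a h) + c)"
        note v = kahn_head[OF k ht True v_def ne[folded v_def]]
        show ?thesis
        proof (cases "d v - 1 = 0")
          case False
          have fits: "fits_prog w ?p s'"
            using True len off ds[folded v_def] ne[folded v_def] False w arc(1) by (simp add: defs v_def[symmetric])
          have upd: "arrs (run ?p s') 8 = a" "arrs (run ?p s') 7 = d(v := d v - 1)" "regs (run ?p s') 4 = t"
            "regs (run ?p s') 5 = h" "regs (run ?p s') 6 = Suc c"
            using True len off ds[folded v_def] ne[folded v_def] False by (simp_all add: defs v_def[symmetric])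
          have "kahn (arrs (run ?p s') 8) (arrs (run ?p s') 7) (regs (run ?p s') 4) (regs (run ?p s') 5)
              (regs (run ?p s') 6)" unfolding upd by (rule kahn_keep[OF k ht True v_def ne[folded v_def] False])
          moreover have "?\<mu> (run ?p s') < ?\<mu> s'" unfolding upd defs using decr by simp
          ultimately show ?thesis using fits g' by blast
        next
          case zero: True
          note push = kahn_push[OF k ht True v_def ne[folded v_def] zero]
          have fits: "fits_prog w ?p s'"
            using True len off ds[folded v_def] ne[folded v_def] zero w arc(1) push(2) by (simp add: defs v_def[symmetric])
          have upd: "arrs (run ?p s') 8 = a(t := v)" "arrs (run ?p s') 7 = d(v := d v - 1)"
            "regs (run ?p s') 4 = Suc t" "regs (run ?p s') 5 = h" "regs (run ?p s') 6 = Suc c"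
            using True len off ds[folded v_def] ne[folded v_def] zero by (simp_all add: defs v_def[symmetric])
          have "kahn (arrs (run ?p s') 8) (arrs (run ?p s') 7) (regs (run ?p s') 4) (regs (run ?p s') 5)
              (regs (run ?p s') 6)" unfolding upd by (rule push(1))
          moreover have "?\<mu> (run ?p s') < ?\<mu> s'" unfolding upd unprocessed_push[OF ht] defs using decr by simp
          ultimately show ?thesis using fits g' by blast
        qed
      qed
    qed
  qed
  then show "runs w I (While (Less (Reg 5) (Reg 4)) ?p) ?s
      (\<lambda>s'. \<exists>c. kahn (arrs s' 8) (arrs s' 7) (regs s' 4) (regs s' 4) c)"
  proof (rule runs_mono)
    fix s' assume J: "?J s' \<and> \<not> eval_test s' (Less (Reg 5) (Reg 4))"
    then have "regs s' 5 = regs s' 4" using kahnD(1) by fastforce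
    then show "\<exists>c. kahn (arrs s' 8) (arrs s' 7) (regs s' 4) (regs s' 4) c" using J by auto
  qed
qed

lemma topsort:
  assumes s: "graph s" "\<And>v. arrs s 7 v = 0"
  shows "runs w I topsort s (\<lambda>s'. \<exists>c. kahn (arrs s' 8) (arrs s' 7) (regs s' 4) (regs s' 4) c)"
  unfolding topsort_def
proof (rule runs_Seq[OF count_entering[OF s]])
  fix s1 assume 1: "\<forall>v. arrs s1 7 v = card (entering {..<m} v)"
    and ag: "agree (written_regs count_entering) (written_arrs count_entering) s s1"
  have g1: "graph s1" by (rule graph_agree[OF ag s(1)]) (simp_all add: count_entering_def)
  show "runs w I (queue_sources ;; process_queue) s1
      (\<lambda>s'. \<exists>c. kahn (arrs s' 8) (arrs s' 7) (regs s' 4) (regs s' 4) c)"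
  proof (rule runs_Seq[OF queue_sources[OF g1]])
    fix s2 assume 2: "inj_on (arrs s2 8) {..<regs s2 4} \<and>
        (\<forall>v. (\<exists>j<regs s2 4. arrs s2 8 j = v) \<longleftrightarrow> v < n \<and> arrs s1 7 v = 0)"
      and ag: "agree (written_regs queue_sources) (written_arrs queue_sources) s1 s2"
    have g2: "graph s2" by (rule graph_agree[OF ag g1]) (simp_all add: queue_sources_def)
    have "arrs s2 7 = arrs s1 7" using agree_arrs[OF ag, of 7] by (simp add: queue_sources_def)
    then have "kahn (arrs s2 8) (arrs s2 7) (regs s2 4) 0 0" using 1 2 by (intro kahn_init) auto
    then show "runs w I process_queue s2 (\<lambda>s'. \<exists>c. kahn (arrs s' 8) (arrs s' 7) (regs s' 4) (regs s' 4) c)"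
      by (rule process_queue[OF g2])
  qed
qed

end

text \<open>\<open>f\<close> picks predecessors, so listing its orbit backwards follows the arcs.
  The closing arc leaves \<open>x\<close> for \<open>(f ^^ (l - 1)) x\<close>, because applying
  \<open>f\<close> to the latter returns to \<open>x\<close>.\<close>

lemma backward_orbit_cycle:
  fixes f :: "'b \<Rightarrow> 'b"
  assumes l: "0 < l" "(f ^^ l) x = x" "inj_on (\<lambda>i. (f ^^ i) x) {..<l}"
    and arc: "\<And>i. (f ((f ^^ i) x), (f ^^ i) x) \<in> A"
  defines "vs \<equiv> map (\<lambda>i. (f ^^ (l - 1 - i)) x) [0..<l]"
  shows "distinct vs" "\<And>i. i < length vs \<Longrightarrow> (vs ! i, vs ! (Suc i mod length vs)) \<in> A"
proof -
  have "i = j" if "i < l" "j < l" "(f ^^ (l - 1 - i)) x = (f ^^ (l - 1 - j)) x" for i j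
  proof -
    have "l - 1 - i = l - 1 - j" using that by (intro inj_onD[OF l(3)]) auto
    with that show ?thesis by linarith
  qed
  then show "distinct vs" by (auto simp: vs_def distinct_map inj_on_def)
  fix i assume "i < length vs"
  then have i: "i < l" by (simp add: vs_def)
  have nth: "vs ! j = (f ^^ (l - 1 - j)) x" if "j < l" for j using that by (simp add: vs_def)
  have len: "length vs = l" by (simp add: vs_def)
  show "(vs ! i, vs ! (Suc i mod length vs)) \<in> A"
  proof (cases "Suc i = l")
    case True
    obtain k where k: "l = Suc k" using l(1) by (cases l) auto
    have "(f ((f ^^ k) x), (f ^^ k) x) \<in> A" by (rule arc)
    then show ?thesis using True k l(1,2) nth[of k] nth[of 0] len by simp
  next
    case False
    then have "l - 1 - i = Suc (l - 1 - Suc i)" using i by linarith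
    then show ?thesis using False i arc[of "l - 1 - Suc i"] nth[of i] nth[of "Suc i"] len by simp
  qed
qed

context arc_machine
begin

context
  fixes s :: store and t c :: nat
  assumes s: "graph s" "kahn (arrs s 8) (arrs s 7) t t c" "t < n"
begin

definition remaining :: "nat set" where
  "remaining = {v. v < n \<and> arrs s 7 v \<noteq> 0}"

lemma remaining_nonempty: "\<exists>v<n. arrs s 7 v \<noteq> 0"
proof (rule ccontr)
  assume "\<not> ?thesis"
  then have "{..<n} \<subseteq> arrs s 8 ` {..<t}" using kahnD(4)[OF s(2)] by fastforce
  then have "card {..<n} \<le> card {..<t}" by (intro surj_card_le) auto
  with s(3) show False by simp
qed

lemma store_predecessors:
  "runs w I (For 2 (Cond (Conj (Neg (Equal Source Target))
        (Conj (Neg (Equal (Cell 7 Source) (Num 0))) (Neg (Equal (Cell 7 Target) (Num 0)))))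
      (Store 9 Target Source) Skip)) s
    (\<lambda>s'. \<forall>v\<in>remaining. arrs s' 9 v \<in> remaining \<and> arrs s' 9 v \<noteq> v \<and> (arrs s' 9 v, v) \<in> parcs D)"
    (is "runs w I (For 2 ?p) s ?Q")
proof -
  define good where "good e \<longleftrightarrow> sr e \<noteq> ds e \<and> arrs s 7 (sr e) \<noteq> 0 \<and> arrs s 7 (ds e) \<noteq> 0" for e
  \<comment> \<open>A later arc may overwrite the predecessor stored by an earlier one, so the
    invariant only claims that the stored source belongs to some suitable arc.\<close>
  let ?J = "\<lambda>k (s' :: store). \<forall>v. (\<exists>e<k. good e \<and> ds e = v) \<longrightarrow> (\<exists>e<k. good e \<and> ds e = v \<and> arrs s' 9 v = sr e)"
  have "runs w I (For 2 ?p) s (?J m)"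
  proof (rule runs_For[where J = ?J])
    fix k s' assume k: "k < m" and J: "?J k s'" and 3: "regs s' 3 = k"
      and ag: "agree (insert 3 (written_regs ?p)) (written_arrs ?p) s s'"
    have g: "graph s'" by (rule graph_agree[OF ag s(1)]) simp_all
    have 7: "arrs s' 7 = arrs s 7" using agree_arrs[OF ag, of 7] by simp
    have arr: "arrs s' 2 k = sr k" "arrs s' 3 k = ds k" using graphD[OF g] k by simp_all
    have run: "arrs (run ?p s') 9 = (if good k then (arrs s' 9)(ds k := sr k) else arrs s' 9)"
      by (simp add: 3 7 arr good_def)
    have "?J (Suc k) (run ?p s')"
      unfolding run using J by (auto simp: less_Suc_eq)
    moreover have "fits_prog w ?p s'" using w by simp
    ultimately show "fits_prog w ?p s' \<and> ?J (Suc k) (run ?p s')" by blast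
  qed (use graphD[OF s(1)] w I in simp_all)
  then show ?thesis
  proof (rule runs_mono)
    fix s' assume J: "?J m s'"
    show "?Q s'"
    proof
      fix v assume v: "v \<in> remaining"
      then obtain e where "e < m" "good e" "ds e = v"
        using kahn_predecessor[OF s(2), of v] by (auto simp: remaining_def good_def)
      then obtain e where e: "e < m" "good e" "ds e = v" "arrs s' 9 v = sr e" using J by blast
      then show "arrs s' 9 v \<in> remaining \<and> arrs s' 9 v \<noteq> v \<and> (arrs s' 9 v, v) \<in> parcs D"
        using arc[OF e(1)] sr_less[OF e(1)] by (auto simp: remaining_def good_def)
    qed
  qed
qed

lemma output_cycle:
  "runs w I output_cycle s (\<lambda>s'. \<exists>vs. output_of s' = 4 # vs \<and> directed_nonloop_cycle D vs \<and>
    set vs \<subseteq> {..<n} \<and> 2 \<le> length vs \<and> (\<forall>i<length vs. (vs ! i, vs ! (Suc i mod length vs)) \<in> parcs D) \<and> distinct vs)"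
    (is "runs w I output_cycle s ?Q")
  unfolding output_cycle_def
proof (rule runs_Seq[OF store_predecessors])
  let ?p1 = "For 2 (Cond (Conj (Neg (Equal Source Target))
        (Conj (Neg (Equal (Cell 7 Source) (Num 0))) (Neg (Equal (Cell 7 Target) (Num 0)))))
      (Store 9 Target Source) Skip)"
  fix s1 assume f: "\<forall>v\<in>remaining. arrs s1 9 v \<in> remaining \<and> arrs s1 9 v \<noteq> v \<and> (arrs s1 9 v, v) \<in> parcs D"
    and ag1: "agree (written_regs ?p1) (written_arrs ?p1) s s1"
  define f where "f = arrs s1 9"
  have g1: "graph s1" by (rule graph_agree[OF ag1 s(1)]) simp_all
  have "arrs s1 7 = arrs s 7" using agree_arrs[OF ag1, of 7] by simp
  show "runs w I (Find 1 (Neg (Equal (Cell 7 (Reg 3)) (Num 0))) 5 ;;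
    Assign 5 (Sub (Reg 5) (Num 1)) ;;
    For 1 (Assign 5 (Cell 9 (Reg 5))) ;;
    Assign 6 (Num 1) ;; Assign 7 (Cell 9 (Reg 5)) ;;
    While (Neg (Equal (Reg 7) (Reg 5))) (Assign 7 (Cell 9 (Reg 7)) ;; inc 6) ;;
    For 6 (Store 1 (Sub (Reg 6) (Reg 3)) (Reg 7) ;; Assign 7 (Cell 9 (Reg 7))) ;;
    Store 1 (Num 0) (Num 4) ;; Assign 0 (Add (Reg 6) (Num 1))) s1 ?Q" (is "runs w I (?p2 ;; ?p3 ;; ?p4 ;; ?rest) s1 ?Q")
  proof (rule runs_Seq[OF runs_Find[where P = "\<lambda>v. arrs s 7 v \<noteq> 0" and L = n]])
    fix s2 assume "regs s2 5 = 0 \<and> (\<forall>v<n. \<not> arrs s 7 v \<noteq> 0) \<or> (\<exists>v<n. regs s2 5 = Suc v \<and> arrs s 7 v \<noteq> 0)"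
      and ag2: "agree (written_regs ?p2) (written_arrs ?p2) s1 s2"
    then obtain v where v: "regs s2 5 = Suc v" "v \<in> remaining"
      using remaining_nonempty by (auto simp: remaining_def)
    have fin: "finite remaining" "card remaining \<le> n"
      using card_mono[of "{..<n}" remaining] by (auto simp: remaining_def)
    have fR: "f v \<in> remaining" if "v \<in> remaining" for v using f that by (simp add: f_def)
    \<comment> \<open>The vertex in register 5 after \<open>n\<close> predecessor steps, where the
      orbit is already periodic.\<close>
    define x where "x = (f ^^ n) v"
    obtain l where l: "0 < l" "l \<le> n" "(f ^^ l) x = x" "inj_on (\<lambda>i. (f ^^ i) x) {..<l}"
      using periodic_point[OF fin v(2) fR x_def] .
    have "(f ^^ i) v \<in> remaining" for i using v(2) fR by (induction i) auto
    then have "x \<in> remaining" by (simp add: x_def)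
    then have orbit: "(f ^^ i) x \<in> remaining" for i using fR by (induction i) auto
    \<comment> \<open>No stored predecessor equals its own vertex, so period one is
      impossible.\<close>
    have l2: "2 \<le> l"
    proof (rule ccontr)
      assume "\<not> ?thesis"
      with l(1) have "l = 1" by simp
      with l(3) f orbit[of 0] show False by (auto simp: f_def)
    qed
    define vs where "vs = map (\<lambda>i. (f ^^ (l - 1 - i)) x) [0..<l]"
    have arcs: "(f ((f ^^ i) x), (f ^^ i) x) \<in> parcs D" for i using f orbit by (simp add: f_def)
    note vs = backward_orbit_cycle[OF l(1,3,4) arcs, folded vs_def]
    have set: "set vs \<subseteq> {..<n}" and len: "length vs = l" using orbit by (auto simp: vs_def remaining_def)
    have cyc: "directed_nonloop_cycle D vs"
      by (rule directed_nonloop_cycleI[OF vs(1) _ _ vs(2)]) (use set len l2 verts in auto)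
    let ?s3 = "run ?p3 s2"
    have 9: "arrs ?s3 9 = f" using agree_arrs[OF ag2, of 9] by (simp add: f_def)
    have g2: "graph s2" by (rule graph_agree[OF ag2 g1]) simp_all
    then have g3: "graph ?s3" by (rule graph_agree[OF run_agree]) simp_all
    show "runs w I (?p3 ;; ?p4 ;; ?rest) s2 ?Q"
    proof (rule runs_Seq_straight, simp, use w in simp,
        rule runs_Seq[OF runs_For[where J = "\<lambda>k s'. regs s' 5 = (f ^^ k) v" and L = n]])
      show "regs ?s3 5 = (f ^^ 0) v" using v by simp
      fix k s' assume "regs s' 5 = (f ^^ k) v"
        and "agree (insert 3 (written_regs (Assign 5 (Cell 9 (Reg 5))))) (written_arrs (Assign 5 (Cell 9 (Reg 5)))) ?s3 s'"
      then show "fits_prog w (Assign 5 (Cell 9 (Reg 5))) s' \<and> regs (run (Assign 5 (Cell 9 (Reg 5))) s') 5 = (f ^^ Suc k) v"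
        using 9 agree_arrs[of _ _ ?s3 s' 9] by simp
    next
      fix s4 assume 5: "regs s4 5 = (f ^^ n) v" and ag4: "agree (written_regs ?p4) (written_arrs ?p4) ?s3 s4"
      have 9: "arrs s4 9 = f" using agree_arrs[OF ag4, of 9] 9 by simp
      let ?s5 = "run (Assign 7 (Cell 9 (Reg 5))) (run (Assign 6 (Num 1)) s4)"
      let ?J = "\<lambda>s' :: store. arrs s' 9 = f \<and> regs s' 5 = x \<and> regs s' 7 = (f ^^ regs s' 6) x \<and> 0 < regs s' 6 \<and> regs s' 6 \<le> l"
      let ?while = "While (Neg (Equal (Reg 7) (Reg 5))) (Assign 7 (Cell 9 (Reg 7)) ;; inc 6)"
      let ?p = "Store 1 (Sub (Reg 6) (Reg 3)) (Reg 7) ;; Assign 7 (Cell 9 (Reg 7))"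
      have "runs w I ?while ?s5 (\<lambda>s'. ?J s' \<and> \<not> eval_test s' (Neg (Equal (Reg 7) (Reg 5))))"
      proof (rule runs_While[where \<mu> = "\<lambda>s'. l - regs s' 6"])
        show "?J ?s5" using 5 9 l by (simp add: x_def)
        show "l - regs ?s5 6 \<le> I" using l I by simp
        fix s' assume J: "?J s'" and "eval_test s' (Neg (Equal (Reg 7) (Reg 5)))"
        then have "regs s' 6 \<noteq> l" using l by auto
        with J have "regs s' 6 < l" by simp
        with J l w show "fits_prog w (Assign 7 (Cell 9 (Reg 7)) ;; inc 6) s' \<and> ?J (run (Assign 7 (Cell 9 (Reg 7)) ;; inc 6) s') \<and>
            l - regs (run (Assign 7 (Cell 9 (Reg 7)) ;; inc 6) s') 6 < l - regs s' 6" by simp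
      qed simp_all
      then have loop: "runs w I ?while ?s5 (\<lambda>s'. ?J s' \<and> regs s' 6 = l)"
      proof (rule runs_mono)
        fix s' assume "?J s' \<and> \<not> eval_test s' (Neg (Equal (Reg 7) (Reg 5)))"
        then have J: "?J s'" and eq: "(f ^^ regs s' 6) x = (f ^^ 0) x" by auto
        have "regs s' 6 = l"
        proof (rule ccontr)
          assume "regs s' 6 \<noteq> l"
          with J have "regs s' 6 < l" by simp
          then have "regs s' 6 = 0" by (intro inj_onD[OF l(4) eq]) (use l(1) in auto)
          with J show False by simp
        qed
        with J show "?J s' \<and> regs s' 6 = l" by blast
      qed
      show "runs w I ?rest s4 ?Q"
      proof (rule runs_Seq_straight, simp, use w in simp, rule runs_Seq_straight, simp, simp, rule runs_Seq[OF loop])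
        fix s6 assume 6: "?J s6 \<and> regs s6 6 = l"
        show "runs w I (For 6 ?p ;; Store 1 (Num 0) (Num 4) ;; Assign 0 (Add (Reg 6) (Num 1))) s6 ?Q"
        proof (rule runs_Seq[OF runs_For[where L = l and
              J = "\<lambda>k s'. regs s' 7 = (f ^^ k) x \<and> (\<forall>i<k. arrs s' 1 (l - i) = (f ^^ i) x)"]])
          show "regs s6 7 = (f ^^ 0) x \<and> (\<forall>i<0. arrs s6 1 (l - i) = (f ^^ i) x)" using 6 l by simp
          fix k s' assume k: "k < l" and J: "regs s' 7 = (f ^^ k) x \<and> (\<forall>i<k. arrs s' 1 (l - i) = (f ^^ i) x)"
            and 3: "regs s' 3 = k" "regs s' 6 = l" and ag: "agree (insert 3 (written_regs ?p)) (written_arrs ?p) s6 s'"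
          have 9: "arrs s' 9 = f" using agree_arrs[OF ag, of 9] 6 by simp
          have "l - i \<noteq> l - k" if "i < k" for i using that k by simp
          then show "fits_prog w ?p s' \<and> regs (run ?p s') 7 = (f ^^ Suc k) x \<and>
              (\<forall>i<Suc k. arrs (run ?p s') 1 (l - i) = (f ^^ i) x)"
            using J 3 9 by (simp add: less_Suc_eq)
        next
          fix s7 assume J: "regs s7 7 = (f ^^ l) x \<and> (\<forall>i<l. arrs s7 1 (l - i) = (f ^^ i) x)"
            and ag: "agree (written_regs (For 6 ?p)) (written_arrs (For 6 ?p)) s6 s7"
          have 6: "regs s7 6 = l" using agree_regs[OF ag, of 6] 6 by simp
          let ?s8 = "run (Assign 0 (Add (Reg 6) (Num 1))) (run (Store 1 (Num 0) (Num 4)) s7)"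
          have "output_of ?s8 = map (arrs ?s8 1) [0..<Suc l]" using 6 by (simp add: output_of_def)
          also have "\<dots> = arrs ?s8 1 0 # map (\<lambda>i. arrs ?s8 1 (Suc i)) [0..<l]"
            by (simp only: upt_conv_Cons[OF zero_less_Suc] list.map map_Suc_upt[symmetric] map_map comp_def)
          also have "\<dots> = 4 # vs"
          proof -
            \<comment> \<open>Round \<open>k\<close> of the writing loop fills cell
              \<open>l - k\<close>, so cell \<open>Suc i\<close> stems from round
              \<open>l - 1 - i\<close>.\<close>
            have "arrs s7 1 (Suc i) = (f ^^ (l - 1 - i)) x" if "i < l" for i
              using J[THEN conjunct2, rule_format, of "l - 1 - i"] that by simp
            then show ?thesis by (simp add: vs_def)
          qed
          finally have out: "output_of ?s8 = 4 # vs" .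
          show "runs w I (Store 1 (Num 0) (Num 4) ;; Assign 0 (Add (Reg 6) (Num 1))) s7 ?Q"
          proof (rule runs_straight)
            show "fits_prog w (Store 1 (Num 0) (Num 4) ;; Assign 0 (Add (Reg 6) (Num 1))) s7"
              using w 6 l by simp
            show "?Q (run (Store 1 (Num 0) (Num 4) ;; Assign 0 (Add (Reg 6) (Num 1))) s7)"
              using out cyc set vs len l2 unfolding run.simps(4) by (intro exI[of _ vs]) simp
          qed simp
        qed (use 6 l w I in auto)
      qed
    qed (use graphD[OF g3] w I in auto)
  qed (use graphD[OF g1] w I \<open>arrs s1 7 = arrs s 7\<close> in \<open>auto simp: agree_arrs\<close>)
qed

end

end

section \<open>Degrees and classes on the machine\<close>

text \<open>\<open>Write\<close> fills array 1 while it evaluates its list of expressions. Their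
  values are stable only if none of them reads that array.\<close>

primrec reads :: "expr \<Rightarrow> nat set" where
  "reads (Num n) = {}"
| "reads (Reg x) = {}"
| "reads (Cell a e) = insert a (reads e)"
| "reads (Add e f) = reads e \<union> reads f"
| "reads (Sub e f) = reads e \<union> reads f"

lemma eval_expr_store:
  "a \<notin> reads e \<Longrightarrow> eval_expr (s\<lparr>arrs := (arrs s)(a := g)\<rparr>) e = eval_expr s e"
  "a \<notin> reads e \<Longrightarrow> fits_expr w (s\<lparr>arrs := (arrs s)(a := g)\<rparr>) e = fits_expr w s e"
  by (induction e) auto

lemma straight_Write [simp]: "straight (Write i es)"
  by (induction es arbitrary: i) auto

lemma run_Write:
  "\<forall>e\<in>set es. fits_expr w s e \<and> 1 \<notin> reads e \<Longrightarrow> i + length es \<le> w \<Longrightarrow>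
    fits_prog w (Write i es) s \<and> regs (run (Write i es) s) 0 = i + length es \<and>
    (\<forall>j. arrs (run (Write i es) s) 1 j =
      (if i \<le> j \<and> j < i + length es then eval_expr s (es ! (j - i)) else arrs s 1 j))"
proof (induction es arbitrary: i s)
  case (Cons e es)
  let ?s = "run (Store 1 (Num i) e) s"
  have ev: "eval_expr ?s e' = eval_expr s e'" "fits_expr w ?s e' = fits_expr w s e'" if "1 \<notin> reads e'" for e'
    using eval_expr_store[OF that] by simp_all
  have "\<forall>e\<in>set es. fits_expr w ?s e \<and> 1 \<notin> reads e" "Suc i + length es \<le> w"
    using Cons.prems ev by auto
  note IH = Cons.IH[OF this]
  have "arrs (run (Write i (e # es)) s) 1 j =
      (if i \<le> j \<and> j < i + length (e # es) then eval_expr s ((e # es) ! (j - i)) else arrs s 1 j)" for j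
  proof -
    have "arrs (run (Write i (e # es)) s) 1 j = arrs (run (Write (Suc i) es) ?s) 1 j" by simp
    also have "\<dots> = (if Suc i \<le> j \<and> j < Suc i + length es then eval_expr ?s (es ! (j - Suc i)) else arrs ?s 1 j)"
      using IH by blast
    also have "\<dots> = (if i \<le> j \<and> j < i + length (e # es) then eval_expr s ((e # es) ! (j - i)) else arrs s 1 j)"
    proof (cases "Suc i \<le> j \<and> j < Suc i + length es")
      case True
      then have "es ! (j - Suc i) \<in> set es" by (intro nth_mem) linarith
      then have "1 \<notin> reads (es ! (j - Suc i))" using Cons.prems(1) by simp
      moreover have "j - i = Suc (j - Suc i)" using True by linarith
      ultimately show ?thesis using True ev by simp
    qed auto
    finally show ?thesis .
  qed
  moreover have "fits_prog w (Write i (e # es)) s" using IH Cons.prems by simp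
  moreover have "regs (run (Write i (e # es)) s) 0 = i + length (e # es)" using IH by simp
  ultimately show ?case by blast
qed simp

abbreviation answered :: "nat pair_pre_digraph \<Rightarrow> store \<Rightarrow> bool" where
  "answered D s \<equiv> \<exists>ans. output_of s = encode_answer ans \<and> correct_answer D ans"

lemma runs_Write:
  assumes "\<forall>e\<in>set es. fits_expr w s e \<and> 1 \<notin> reads e" "length es \<le> w"
    and "correct_answer D ans" "map (eval_expr s) es = encode_answer ans"
  shows "runs w I (Write 0 es) s (answered D)"
proof (rule runs_straight)
  have len: "0 + length es \<le> w" using assms(2) by simp
  note W = run_Write[OF assms(1) len]
  show "fits_prog w (Write 0 es) s" using W by blast
  have "output_of (run (Write 0 es) s) = map (eval_expr s) es"
    using W by (auto simp: output_of_def intro: nth_equalityI)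
  with assms(3,4) show "answered D (run (Write 0 es) s)" by auto
qed simp

abbreviation "Independent e \<equiv> Neg (Equal (Cell 10 (Cell 8 e)) (Reg 9))"
abbreviation "Kept e \<equiv> Conj (Independent e) (Neg (Equal e (Reg 8)))"
abbreviation "Mirror \<equiv> Sub (Sub (Reg 1) (Num 1)) (Reg 3)"

definition compute_degrees :: prog where
  "compute_degrees = Assign 9 (Sub (Reg 1) (Num 1)) ;;
    For 2 (Cond (Equal Source Target) Skip
      (Store 10 Source (Add (Cell 10 Source) (Num 1)) ;; Store 10 Target (Add (Cell 10 Target) (Num 1)))) ;;
    Find 2 (Conj (Neg (Equal Source Target))
      (Conj (Neg (Equal (Cell 10 Source) (Reg 9))) (Neg (Equal (Cell 10 Target) (Reg 9))))) 5"

definition Mark :: "nat \<Rightarrow> nat \<Rightarrow> prog" where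
  "Mark r a = For 2 (Cond (Equal Source (Reg r)) (Store a Target (Num 1)) Skip ;;
    Cond (Equal Target (Reg r)) (Store a Source (Num 1)) Skip)"

definition output_non_split :: prog where
  "output_non_split = Assign 5 (Sub (Reg 5) (Num 1)) ;; Assign 6 (Cell 2 (Reg 5)) ;; Assign 7 (Cell 3 (Reg 5)) ;;
    Mark 6 11 ;; Mark 7 12 ;;
    Find 1 (Equal (Cell 11 (Reg 3)) (Num 0)) 8 ;; Assign 8 (Sub (Reg 8) (Num 1)) ;;
    Find 1 (Equal (Cell 12 (Reg 3)) (Num 0)) 10 ;; Assign 10 (Sub (Reg 10) (Num 1)) ;;
    Mark 8 13 ;;
    Cond (Equal (Cell 12 (Reg 8)) (Num 0)) (Write 0 [Num 2, Reg 8, Reg 6, Reg 7])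
      (Cond (Equal (Cell 11 (Reg 10)) (Num 0)) (Write 0 [Num 2, Reg 10, Reg 6, Reg 7])
        (Cond (Equal (Cell 13 (Reg 10)) (Num 0)) (Write 0 [Num 2, Reg 10, Reg 7, Reg 8])
          (Write 0 [Num 3, Reg 6, Reg 7, Reg 8, Reg 10])))"

lemma K1_plus_K2_answer:
  assumes "{x, u, v} \<subseteq> pverts D" "adjacent D u v" "x \<noteq> u" "x \<noteq> v" "\<not> adjacent D x u" "\<not> adjacent D x v"
  shows "correct_answer D (No (Induced_K1_plus_K2 [x, u, v]))"
  using induces_K1_plus_K2[OF assms] reflexive_multipartite_tournamentD(4)[of D u v x] assms by auto

lemma C4_answer:
  assumes "{a, b, c, d} \<subseteq> pverts D" "adjacent D a b" "adjacent D b c" "adjacent D c d" "adjacent D d a"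
    "a \<noteq> c" "b \<noteq> d" "\<not> adjacent D a c" "\<not> adjacent D b d"
  shows "correct_answer D (No (Induced_C4 [a, b, c, d]))"
  using induces_C4[OF assms] no_strong_ordering_C4[of D a b c d] assms by auto

context arc_machine
begin

lemma card_incident_Suc:
  "card (incident {..<Suc k} v) =
    card (incident {..<k} v) + (if sr k \<noteq> ds k \<and> (sr k = v \<or> ds k = v) then 1 else 0)"
proof -
  have "incident {..<Suc k} v =
      (if sr k \<noteq> ds k \<and> (sr k = v \<or> ds k = v) then insert k (incident {..<k} v) else incident {..<k} v)"
    by (auto simp: incident_def less_Suc_eq)
  moreover have "k \<notin> incident {..<k} v" "finite (incident {..<k} v)" by (simp_all add: incident_def)
  ultimately show ?thesis by simp
qed

definition inner_arc :: "nat \<Rightarrow> bool" where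
  "inner_arc e \<longleftrightarrow> sr e \<noteq> ds e \<and> degree (sr e) \<noteq> n - 1 \<and> degree (ds e) \<noteq> n - 1"

lemma compute_degrees:
  assumes s: "graph s" "\<And>v. arrs s 10 v = 0"
  shows "runs w I compute_degrees s (\<lambda>s'. arrs s' 10 = degree \<and> regs s' 9 = n - 1 \<and>
    (regs s' 5 = 0 \<and> (\<forall>e<m. \<not> inner_arc e) \<or> (\<exists>e<m. regs s' 5 = Suc e \<and> inner_arc e)))"
  unfolding compute_degrees_def
proof (rule runs_Seq_straight, simp, use w in simp)
  let ?p = "Cond (Equal Source Target) Skip
      (Store 10 Source (Add (Cell 10 Source) (Num 1)) ;; Store 10 Target (Add (Cell 10 Target) (Num 1)))"
  let ?b = "Conj (Neg (Equal Source Target))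
      (Conj (Neg (Equal (Cell 10 Source) (Reg 9))) (Neg (Equal (Cell 10 Target) (Reg 9))))"
  let ?s = "run (Assign 9 (Sub (Reg 1) (Num 1))) s"
  let ?J = "\<lambda>k (s' :: store). \<forall>v. arrs s' 10 v = card (incident {..<k} v)"
  have g: "graph ?s" by (rule graph_agree[OF run_agree s(1)]) simp_all
  have For: "runs w I (For 2 ?p) ?s (?J m)"
  proof (rule runs_For[where J = ?J])
    show "?J 0 ?s" using s by (simp add: incident_def)
    fix k s' assume k: "k < m" and J: "?J k s'" and 3: "regs s' 3 = k"
      and ag: "agree (insert 3 (written_regs ?p)) (written_arrs ?p) ?s s'"
    have g': "graph s'" by (rule graph_agree[OF ag g]) simp_all
    have fits: "card (incident {..<k} v) + 1 \<le> w" for v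
    proof -
      have "card (incident {..<k} v) \<le> k"
        using card_mono[of "{..<k}" "incident {..<k} v"] by (auto simp: incident_def)
      also note less_imp_le[OF k]
      finally have "card (incident {..<k} v) + 1 \<le> m + 1" by simp
      also have "\<dots> \<le> w" using w by simp
      finally show ?thesis .
    qed
    show "fits_prog w ?p s' \<and> ?J (Suc k) (run ?p s')"
      using J 3 graphD(4,5)[OF g' k] w fits[of "sr k"] fits[of "ds k"] by (auto simp: card_incident_Suc)
  qed (use graphD[OF g] w I in simp_all)
  show "runs w I (For 2 ?p ;; Find 2 ?b 5) ?s (\<lambda>s'. arrs s' 10 = degree \<and> regs s' 9 = n - 1 \<and>
    (regs s' 5 = 0 \<and> (\<forall>e<m. \<not> inner_arc e) \<or> (\<exists>e<m. regs s' 5 = Suc e \<and> inner_arc e)))"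
  proof (rule runs_Seq[OF For])
    fix s' assume J: "?J m s'" and ag: "agree (written_regs (For 2 ?p)) (written_arrs (For 2 ?p)) ?s s'"
    have deg: "arrs s' 10 = degree" using J by (auto simp: degree_def)
    have g': "graph s'" by (rule graph_agree[OF ag g]) simp_all
    have 9: "regs s' 9 = n - 1" using agree_regs[OF ag, of 9] graphD[OF s(1)] by simp
    have "runs w I (Find 2 ?b 5) s' (\<lambda>s'. regs s' 5 = 0 \<and> (\<forall>e<m. \<not> inner_arc e) \<or> (\<exists>e<m. regs s' 5 = Suc e \<and> inner_arc e))"
      by (rule runs_Find) (use graphD[OF g'] w I deg 9 in \<open>auto simp: agree_arrs agree_regs inner_arc_def\<close>)
    from runs_frame[OF this] show "runs w I (Find 2 ?b 5) s' (\<lambda>s'. arrs s' 10 = degree \<and> regs s' 9 = n - 1 \<and>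
        (regs s' 5 = 0 \<and> (\<forall>e<m. \<not> inner_arc e) \<or> (\<exists>e<m. regs s' 5 = Suc e \<and> inner_arc e)))"
      by (rule runs_mono) (use deg 9 in \<open>auto simp: agree_arrs agree_regs\<close>)
  qed
qed

lemma written_Mark [simp]: "written_regs (Mark r a) = {3}" "written_arrs (Mark r a) = {a}"
  by (auto simp: Mark_def)

lemma Mark:
  assumes s: "graph s" "\<And>v. arrs s a v = 0" and "r \<noteq> 3" "a \<notin> {2, 3, 4, 5}" "regs s r = x"
  shows "runs w I (Mark r a) s (\<lambda>s'. \<forall>y. arrs s' a y = 0 \<longleftrightarrow> (x, y) \<notin> parcs D \<and> (y, x) \<notin> parcs D)"
  unfolding Mark_def
proof (rule runs_mono)
  let ?p = "Cond (Equal Source (Reg r)) (Store a Target (Num 1)) Skip ;;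
    Cond (Equal Target (Reg r)) (Store a Source (Num 1)) Skip"
  let ?J = "\<lambda>k (s' :: store). \<forall>y. arrs s' a y = 0 \<longleftrightarrow> \<not> (\<exists>e<k. sr e = x \<and> ds e = y \<or> ds e = x \<and> sr e = y)"
  show "runs w I (For 2 ?p) s (?J m)"
  proof (rule runs_For[where J = ?J])
    show "?J 0 s" using s by simp
    fix k s' assume k: "k < m" and J: "?J k s'" and 3: "regs s' 3 = k"
      and ag: "agree (insert 3 (written_regs ?p)) (written_arrs ?p) s s'"
    have g: "graph s'" by (rule graph_agree[OF ag s(1)]) (use assms(4) in simp_all)
    have r: "regs s' r = x" using agree_regs[OF ag, of r] assms by simp
    have upd: "arrs (run ?p s') a y = 0 \<longleftrightarrow> \<not> (sr k = x \<and> ds k = y \<or> ds k = x \<and> sr k = y) \<and> arrs s' a y = 0" for y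
      using 3 r graphD(4,5)[OF g k] assms(4) by auto
    have "?J (Suc k) (run ?p s')"
      unfolding upd using J by (simp add: less_Suc_eq) blast
    moreover have "fits_prog w ?p s'" using w by simp
    ultimately show "fits_prog w ?p s' \<and> ?J (Suc k) (run ?p s')" by blast
  qed (use graphD[OF s(1)] w I in simp_all)
  show "\<forall>y. arrs s' a y = 0 \<longleftrightarrow> (x, y) \<notin> parcs D \<and> (y, x) \<notin> parcs D" if "?J m s'" for s'
    using that by (auto simp: arcs image_iff)
qed

text \<open>Let the arc join \<open>u\<close> and \<open>v\<close>, let \<open>x\<close> miss
  \<open>u\<close> and let \<open>y\<close> miss \<open>v\<close>. If \<open>x\<close> misses
  \<open>v\<close> or \<open>y\<close> misses \<open>u\<close>, that vertex is isolated from the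
  edge \<open>u v\<close>. Otherwise \<open>v x\<close> and \<open>u y\<close> are edges: if
  \<open>x\<close> and \<open>y\<close> are not adjacent, \<open>y\<close> is isolated from the edge
  \<open>v x\<close>, and else \<open>u, v, x, y\<close> is an induced four-cycle.\<close>

lemma output_non_split:
  assumes s: "graph s" "\<And>v. arrs s 11 v = 0" "\<And>v. arrs s 12 v = 0" "\<And>v. arrs s 13 v = 0"
    and e: "e < m" "regs s 5 = Suc e" "inner_arc e"
    and loops: "\<And>v. v < n \<Longrightarrow> (v, v) \<in> parcs D"
    and antisym: "\<And>u v. (u, v) \<in> parcs D \<Longrightarrow> (v, u) \<in> parcs D \<Longrightarrow> u = v"
  shows "runs w I output_non_split s (answered D)"
    (is "runs w I _ s ?Q")
proof -
  define u v where "u = sr e" and "v = ds e"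
  have uv: "u < n" "v < n" "adjacent D u v" "u \<noteq> v"
    using e arc[OF e(1)] sr_less[OF e(1)] ds_less[OF e(1)] by (auto simp: u_def v_def adjacent_def inner_arc_def)
  \<comment> \<open>The loop at \<open>x\<close> marks \<open>x\<close> itself, so the unmarked
    vertices are exactly the other vertices that are not adjacent to \<open>x\<close>.\<close>
  have marked: "(x, y) \<notin> parcs D \<and> (y, x) \<notin> parcs D \<longleftrightarrow> x \<noteq> y \<and> \<not> adjacent D x y" if "x < n" for x y
    using loops that by (auto simp: adjacent_def)
  have ex: "\<exists>x<n. x \<noteq> y \<and> \<not> adjacent D y x" if "degree y \<noteq> n - 1" "y < n" for y
    using degree_universal[OF antisym that(2)] that(1) by blast
  have deg: "degree u \<noteq> n - 1" "degree v \<noteq> n - 1" using e(3) by (simp_all add: u_def v_def inner_arc_def)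
  note adj = adjacent_sym[of D]
  let ?end = "Cond (Equal (Cell 12 (Reg 8)) (Num 0)) (Write 0 [Num 2, Reg 8, Reg 6, Reg 7])
      (Cond (Equal (Cell 11 (Reg 10)) (Num 0)) (Write 0 [Num 2, Reg 10, Reg 6, Reg 7])
        (Cond (Equal (Cell 13 (Reg 10)) (Num 0)) (Write 0 [Num 2, Reg 10, Reg 7, Reg 8])
          (Write 0 [Num 3, Reg 6, Reg 7, Reg 8, Reg 10])))"
  have last: "runs w I ?end s' ?Q"
    if 6: "regs s' 6 = u" and 7: "regs s' 7 = v" and 8: "regs s' 8 = x" and 10: "regs s' 10 = y"
      and x: "x < n" "x \<noteq> u" "\<not> adjacent D u x" and y: "y < n" "y \<noteq> v" "\<not> adjacent D v y"
      and 11: "arrs s' 11 y = 0 \<longleftrightarrow> u \<noteq> y \<and> \<not> adjacent D u y"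
      and 12: "arrs s' 12 x = 0 \<longleftrightarrow> v \<noteq> x \<and> \<not> adjacent D v x"
      and 13: "arrs s' 13 y = 0 \<longleftrightarrow> x \<noteq> y \<and> \<not> adjacent D x y" for s' x y
  proof -
    have vx: "v \<noteq> x" using x uv by auto
    have uy: "u \<noteq> y" using y uv adj[of u v] by auto
    have adj': "\<not> adjacent D x u" "\<not> adjacent D y v" using x y adj by auto
    have V: "{u, v, x, y} \<subseteq> pverts D" using uv x y verts by auto
    show ?thesis
    proof (rule runs_Cond)
      assume "eval_test s' (Equal (Cell 12 (Reg 8)) (Num 0))"
      then have "\<not> adjacent D x v" using 8 12 adj[of x v] by simp
      then have "correct_answer D (No (Induced_K1_plus_K2 [x, u, v]))"
        using V uv x vx adj' by (intro K1_plus_K2_answer) auto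
      then show "runs w I (Write 0 [Num 2, Reg 8, Reg 6, Reg 7]) s' ?Q"
        by (intro runs_Write[where ans = "No (Induced_K1_plus_K2 [x, u, v])"])
          (use w 6 7 8 in auto)
    next
      assume "\<not> eval_test s' (Equal (Cell 12 (Reg 8)) (Num 0))"
      then have vx': "adjacent D v x" using 8 12 vx by simp
      show "runs w I (Cond (Equal (Cell 11 (Reg 10)) (Num 0)) (Write 0 [Num 2, Reg 10, Reg 6, Reg 7])
        (Cond (Equal (Cell 13 (Reg 10)) (Num 0)) (Write 0 [Num 2, Reg 10, Reg 7, Reg 8])
          (Write 0 [Num 3, Reg 6, Reg 7, Reg 8, Reg 10]))) s' ?Q"
      proof (rule runs_Cond)
        assume "eval_test s' (Equal (Cell 11 (Reg 10)) (Num 0))"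
        then have "\<not> adjacent D y u" using 10 11 adj[of y u] by simp
        then have "correct_answer D (No (Induced_K1_plus_K2 [y, u, v]))"
          using V uv y uy adj' by (intro K1_plus_K2_answer) auto
        then show "runs w I (Write 0 [Num 2, Reg 10, Reg 6, Reg 7]) s' ?Q"
          by (intro runs_Write[where ans = "No (Induced_K1_plus_K2 [y, u, v])"])
            (use w 6 7 10 in auto)
      next
        assume "\<not> eval_test s' (Equal (Cell 11 (Reg 10)) (Num 0))"
        then have uy': "adjacent D u y" using 10 11 uy by simp
        then have xy: "x \<noteq> y" using x by auto
        show "runs w I (Cond (Equal (Cell 13 (Reg 10)) (Num 0)) (Write 0 [Num 2, Reg 10, Reg 7, Reg 8])
          (Write 0 [Num 3, Reg 6, Reg 7, Reg 8, Reg 10])) s' ?Q"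
        proof (rule runs_Cond)
          assume "eval_test s' (Equal (Cell 13 (Reg 10)) (Num 0))"
          then have "\<not> adjacent D y x" using 10 13 adj[of y x] by simp
          then have "correct_answer D (No (Induced_K1_plus_K2 [y, v, x]))"
            using V vx' y xy adj' by (intro K1_plus_K2_answer) auto
          then show "runs w I (Write 0 [Num 2, Reg 10, Reg 7, Reg 8]) s' ?Q"
            by (intro runs_Write[where ans = "No (Induced_K1_plus_K2 [y, v, x])"])
              (use w 7 8 10 in auto)
        next
          assume "\<not> eval_test s' (Equal (Cell 13 (Reg 10)) (Num 0))"
          then have "adjacent D x y" using 10 13 xy by simp
          then have "correct_answer D (No (Induced_C4 [u, v, x, y]))"
            using V uv vx' x y uy' adj[of y u] by (intro C4_answer) auto
          then show "runs w I (Write 0 [Num 3, Reg 6, Reg 7, Reg 8, Reg 10]) s' ?Q"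
            by (intro runs_Write[where ans = "No (Induced_C4 [u, v, x, y])"])
              (use w 6 7 8 10 in auto)
        qed (use w in simp)
      qed (use w in simp)
    qed (use w in simp)
  qed
  let ?s1 = "run (Assign 7 (Cell 3 (Reg 5))) (run (Assign 6 (Cell 2 (Reg 5))) (run (Assign 5 (Sub (Reg 5) (Num 1))) s))"
  have ag1: "agree {5, 6, 7} {} s ?s1" by (simp add: agree_def)
  have g1: "graph ?s1" by (rule graph_agree[OF ag1 s(1)]) simp_all
  have 6: "regs ?s1 6 = u" and 7: "regs ?s1 7 = v" using e graphD(4,5)[OF s(1) e(1)] by (simp_all add: u_def v_def)
  have z1: "arrs ?s1 11 y = 0" "arrs ?s1 12 y = 0" "arrs ?s1 13 y = 0" for y using s by simp_all
  show ?thesis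
    unfolding output_non_split_def
  proof (rule runs_Seq_straight, simp, use w in simp, rule runs_Seq_straight, simp, simp,
      rule runs_Seq_straight, simp, simp, rule runs_Seq[OF Mark[OF g1 z1(1) _ _ 6]], simp, simp)
    fix s2 assume 11: "\<forall>y. arrs s2 11 y = 0 \<longleftrightarrow> (u, y) \<notin> parcs D \<and> (y, u) \<notin> parcs D"
      and ag: "agree (written_regs (Mark 6 11)) (written_arrs (Mark 6 11)) ?s1 s2"
    have g2: "graph s2" by (rule graph_agree[OF ag g1]) simp_all
    have r2: "regs s2 6 = u" "regs s2 7 = v" using agree_regs[OF ag] 6 7 by simp_all
    have z2: "arrs s2 12 y = 0" "arrs s2 13 y = 0" for y using agree_arrs[OF ag] s by simp_all
    show "runs w I (Mark 7 12 ;; Find 1 (Equal (Cell 11 (Reg 3)) (Num 0)) 8 ;; Assign 8 (Sub (Reg 8) (Num 1)) ;;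
      Find 1 (Equal (Cell 12 (Reg 3)) (Num 0)) 10 ;; Assign 10 (Sub (Reg 10) (Num 1)) ;; Mark 8 13 ;; ?end) s2 ?Q"
    proof (rule runs_Seq[OF Mark[OF g2 z2(1) _ _ r2(2)]], simp, simp)
      fix s3 assume 12: "\<forall>y. arrs s3 12 y = 0 \<longleftrightarrow> (v, y) \<notin> parcs D \<and> (y, v) \<notin> parcs D"
        and ag: "agree (written_regs (Mark 7 12)) (written_arrs (Mark 7 12)) s2 s3"
      have g3: "graph s3" by (rule graph_agree[OF ag g2]) simp_all
      have r3: "regs s3 6 = u" "regs s3 7 = v" using agree_regs[OF ag] r2 by simp_all
      have z3: "arrs s3 13 y = 0" for y using agree_arrs[OF ag] z2 by simp
      have a3: "arrs s3 11 y = 0 \<longleftrightarrow> u \<noteq> y \<and> \<not> adjacent D u y" "arrs s3 12 y = 0 \<longleftrightarrow> v \<noteq> y \<and> \<not> adjacent D v y" for y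
        using agree_arrs[OF ag, of 11] 11 12 marked uv by simp_all
      show "runs w I (Find 1 (Equal (Cell 11 (Reg 3)) (Num 0)) 8 ;; Assign 8 (Sub (Reg 8) (Num 1)) ;;
        Find 1 (Equal (Cell 12 (Reg 3)) (Num 0)) 10 ;; Assign 10 (Sub (Reg 10) (Num 1)) ;; Mark 8 13 ;; ?end) s3 ?Q"
      proof (rule runs_Seq[OF runs_Find[where P = "\<lambda>y. u \<noteq> y \<and> \<not> adjacent D u y" and L = n]])
        fix s4 assume "regs s4 8 = 0 \<and> (\<forall>y<n. \<not> (u \<noteq> y \<and> \<not> adjacent D u y)) \<or>
            (\<exists>y<n. regs s4 8 = Suc y \<and> u \<noteq> y \<and> \<not> adjacent D u y)"
          and ag: "agree (written_regs (Find 1 (Equal (Cell 11 (Reg 3)) (Num 0)) 8))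
            (written_arrs (Find 1 (Equal (Cell 11 (Reg 3)) (Num 0)) 8)) s3 s4"
        then obtain x where x: "regs s4 8 = Suc x" "x < n" "u \<noteq> x" "\<not> adjacent D u x"
          using ex[OF deg(1) uv(1)] by auto
        let ?s5 = "run (Assign 8 (Sub (Reg 8) (Num 1))) s4"
        have ag5: "agree {3, 8} {} s3 ?s5" using ag by (simp add: agree_def)
        have g5: "graph ?s5" by (rule graph_agree[OF ag5 g3]) simp_all
        have r5: "regs ?s5 6 = u" "regs ?s5 7 = v" "regs ?s5 8 = x"
          using agree_regs[OF ag5, of 6] agree_regs[OF ag5, of 7] r3 x by simp_all
        have a5: "arrs ?s5 a = arrs s3 a" for a using agree_arrs[OF ag5] by simp
        show "runs w I (Assign 8 (Sub (Reg 8) (Num 1)) ;;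
          Find 1 (Equal (Cell 12 (Reg 3)) (Num 0)) 10 ;; Assign 10 (Sub (Reg 10) (Num 1)) ;; Mark 8 13 ;; ?end) s4 ?Q"
        proof (rule runs_Seq_straight, simp, use w in simp,
            rule runs_Seq[OF runs_Find[where P = "\<lambda>y. v \<noteq> y \<and> \<not> adjacent D v y" and L = n]])
          fix s6 assume "regs s6 10 = 0 \<and> (\<forall>y<n. \<not> (v \<noteq> y \<and> \<not> adjacent D v y)) \<or>
              (\<exists>y<n. regs s6 10 = Suc y \<and> v \<noteq> y \<and> \<not> adjacent D v y)"
            and ag: "agree (written_regs (Find 1 (Equal (Cell 12 (Reg 3)) (Num 0)) 10))
              (written_arrs (Find 1 (Equal (Cell 12 (Reg 3)) (Num 0)) 10)) ?s5 s6"
          then obtain y where y: "regs s6 10 = Suc y" "y < n" "v \<noteq> y" "\<not> adjacent D v y"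
            using ex[OF deg(2) uv(2)] by auto
          let ?s7 = "run (Assign 10 (Sub (Reg 10) (Num 1))) s6"
          have ag7: "agree {3, 10} {} ?s5 ?s7" using ag by (simp add: agree_def)
          have g7: "graph ?s7" by (rule graph_agree[OF ag7 g5]) simp_all
          have r7: "regs ?s7 6 = u" "regs ?s7 7 = v" "regs ?s7 8 = x" "regs ?s7 10 = y"
            using agree_regs[OF ag7, of 6] agree_regs[OF ag7, of 7] agree_regs[OF ag7, of 8] r5 y by simp_all
          have a7: "arrs ?s7 a = arrs s3 a" for a using agree_arrs[OF ag7] a5 by simp
          have z7: "arrs ?s7 13 z = 0" for z using a7[of 13] z3[of z] by simp
          show "runs w I (Assign 10 (Sub (Reg 10) (Num 1)) ;; Mark 8 13 ;; ?end) s6 ?Q"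
          proof (rule runs_Seq_straight, simp, use w in simp, rule runs_Seq[OF Mark[OF g7 z7 _ _ r7(3)]], simp, simp)
            fix s8 assume 13: "\<forall>y. arrs s8 13 y = 0 \<longleftrightarrow> (x, y) \<notin> parcs D \<and> (y, x) \<notin> parcs D"
              and ag: "agree (written_regs (Mark 8 13)) (written_arrs (Mark 8 13)) ?s7 s8"
            have r8: "regs s8 6 = u" "regs s8 7 = v" "regs s8 8 = x" "regs s8 10 = y"
              using agree_regs[OF ag, of 6] agree_regs[OF ag, of 7] agree_regs[OF ag, of 8]
                agree_regs[OF ag, of 10] r7 by simp_all
            have a8: "arrs s8 11 = arrs s3 11" "arrs s8 12 = arrs s3 12"
              using agree_arrs[OF ag, of 11] agree_arrs[OF ag, of 12] a7[of 11] a7[of 12] by simp_all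
            show "runs w I ?end s8 ?Q"
              by (rule last[OF r8]) (use x y a8 a3 13 marked[OF x(2)] in auto)
          qed
        qed (use graphD[OF g5] w I a5 a3 in \<open>auto simp: agree_arrs\<close>)
      qed (use graphD[OF g3] w I a3 in \<open>auto simp: agree_arrs\<close>)
    qed
  qed
qed

end

section \<open>Orderings and directed obstructions on the machine\<close>

definition collect_classes :: prog where
  "collect_classes = Assign 4 (Num 0) ;; Assign 5 (Num 0) ;;
    For 1 (Cond (Independent (Reg 3))
      (Store 15 (Reg 4) (Reg 3) ;; Store 16 (Reg 4) (Reg 5) ;; inc 4)
      (Store 14 (Reg 5) (Reg 3) ;; inc 5))"

abbreviation "First \<equiv> Cell 15 (Num 0)"
abbreviation "Last \<equiv> Cell 15 (Sub (Reg 4) (Num 1))"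

definition output_forward :: prog where
  "output_forward = Assign 7 First ;; Assign 8 Last ;; Store 1 (Num 0) (Num 0) ;; Assign 0 (Num 1) ;;
    Emit 1 (Kept (Reg 3)) (Cell 8 (Reg 3)) ;;
    Emit 1 (Conj (Neg (Kept (Reg 3))) (Neg (Less (Reg 3) (Reg 7))))
      (Cell 8 (Reg 3)) ;;
    Emit 1 (Less Mirror (Reg 7)) (Cell 8 Mirror)"

definition output_backward :: prog where
  "output_backward = Assign 7 Last ;; Assign 8 First ;; Store 1 (Num 0) (Num 0) ;; Assign 0 (Num 1) ;;
    Emit 1 (Kept Mirror) (Cell 8 Mirror) ;;
    Emit 1 (Conj (Neg (Kept Mirror)) (Neg (Less (Reg 7) Mirror)))
      (Cell 8 Mirror) ;;
    Emit 1 (Less (Reg 7) (Reg 3)) (Cell 8 (Reg 3))"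

abbreviation "S_elem e \<equiv> Cell 8 (Cell 15 e)"
abbreviation "T_elem e \<equiv> Cell 8 (Cell 14 e)"
abbreviation "class_elem e \<equiv> Cell 16 e"

definition output_T202 :: prog where
  "output_T202 = Write 0 [Num 5, S_elem (Num 0), S_elem (Num 1), T_elem (class_elem (Num 1)),
    T_elem (Add (class_elem (Num 1)) (Num 1)), S_elem (Sub (Reg 4) (Num 2)), S_elem (Sub (Reg 4) (Num 1))]"

definition output_T10101 :: prog where
  "output_T10101 = Write 0 [Num 7, S_elem (Num 0), T_elem (class_elem (Num 0)),
    T_elem (Add (class_elem (Num 0)) (Num 1)), S_elem (Num 1), T_elem (class_elem (Num 1)),
    T_elem (Add (class_elem (Num 1)) (Num 1)), S_elem (Sub (Reg 4) (Num 1))]"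

definition output_T1111 :: prog where
  "output_T1111 = Write 0 [Num 6, S_elem (Num 0), T_elem (class_elem (Num 0)), S_elem (Num 1),
    T_elem (class_elem (Num 1)), S_elem (Sub (Reg 4) (Num 2)), T_elem (class_elem (Sub (Reg 4) (Num 2))),
    S_elem (Sub (Reg 4) (Num 1))]"

text \<open>If the first test fails, \<open>S\<close> has at least three elements; only then do the
  cells read by the later tests hold classes of actual elements.\<close>

definition output_split :: prog where
  "output_split = collect_classes ;;
    Cond (Less (class_elem (Sub (Reg 4) (Num 2))) (Add (class_elem (Num 0)) (Num 2))) output_forward
      (Cond (Less (class_elem (Sub (Reg 4) (Num 1))) (Add (class_elem (Num 1)) (Num 2))) output_backward
        (Cond (Less (Add (class_elem (Num 1)) (Num 1)) (class_elem (Sub (Reg 4) (Num 2)))) output_T202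
          (Cond (Equal (class_elem (Num 1)) (class_elem (Sub (Reg 4) (Num 2)))) output_T10101 output_T1111)))"

text \<open>By \<open>len\<close> at most \<open>n + 1\<close> cells are filled when the third pass
  begins, which may raise the counter by \<open>n\<close> more; hence the bound
  \<open>2 * n + 2\<close>.\<close>

lemma runs_Emit3:
  assumes s: "regs s 1 = n" "output_of s = [0]" "n \<le> I" "2 * n + 2 \<le> w"
    and b: "\<And>k s'. k < n \<Longrightarrow> regs s' 3 = k \<Longrightarrow> agree {0, 3} {1} s s' \<Longrightarrow>
      fits_test w s' b1 \<and> (eval_test s' b1 \<longleftrightarrow> P1 k) \<and> fits_expr w s' e1 \<and> eval_expr s' e1 = f1 k \<and>
      fits_test w s' b2 \<and> (eval_test s' b2 \<longleftrightarrow> P2 k) \<and> fits_expr w s' e2 \<and> eval_expr s' e2 = f2 k \<and>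
      fits_test w s' b3 \<and> (eval_test s' b3 \<longleftrightarrow> P3 k) \<and> fits_expr w s' e3 \<and> eval_expr s' e3 = f3 k"
    and len: "length (filter P1 [0..<n]) + length (filter P2 [0..<n]) \<le> n"
  shows "runs w I (Emit 1 b1 e1 ;; Emit 1 b2 e2 ;; Emit 1 b3 e3) s (\<lambda>s'. output_of s' =
    0 # map f1 (filter P1 [0..<n]) @ map f2 (filter P2 [0..<n]) @ map f3 (filter P3 [0..<n]))"
proof -
  have reg0: "regs s' 0 = length (output_of s')" for s' by (simp add: output_of_def)
  show ?thesis
  proof (rule runs_Seq[OF runs_Emit[where L = n and P = P1 and f = f1]])
    show "regs s 0 + n < w" using reg0[of s] s by simp
    fix s1 assume o1: "output_of s1 = output_of s @ map f1 (filter P1 [0..<n])"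
      and "agree (written_regs (Emit 1 b1 e1)) (written_arrs (Emit 1 b1 e1)) s s1"
    then have ag1: "agree {0, 3} {1} s s1" by simp
    have n1: "regs s1 1 = n" using agree_regs[OF ag1, of 1] s by simp
    show "runs w I (Emit 1 b2 e2 ;; Emit 1 b3 e3) s1 (\<lambda>s'. output_of s' =
      0 # map f1 (filter P1 [0..<n]) @ map f2 (filter P2 [0..<n]) @ map f3 (filter P3 [0..<n]))"
    proof (rule runs_Seq[OF runs_Emit[where L = n and P = P2 and f = f2]])
      show "regs s1 0 + n < w" using reg0[of s1] o1 s len by simp
      show "fits_test w s' b2 \<and> (eval_test s' b2 \<longleftrightarrow> P2 k) \<and> fits_expr w s' e2 \<and> eval_expr s' e2 = f2 k"
        if "k < n" "regs s' 3 = k" "agree {0, 3} {1} s1 s'" for k s'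
        using b[OF that(1,2) agree_trans[OF ag1 that(3)]] by blast
      fix s2 assume o2: "output_of s2 = output_of s1 @ map f2 (filter P2 [0..<n])"
        and "agree (written_regs (Emit 1 b2 e2)) (written_arrs (Emit 1 b2 e2)) s1 s2"
      then have ag2: "agree {0, 3} {1} s s2" using agree_trans[OF ag1] by simp
      have n2: "regs s2 1 = n" using agree_regs[OF ag2, of 1] s by simp
      show "runs w I (Emit 1 b3 e3) s2 (\<lambda>s'. output_of s' =
        0 # map f1 (filter P1 [0..<n]) @ map f2 (filter P2 [0..<n]) @ map f3 (filter P3 [0..<n]))"
      proof (rule runs_mono[OF runs_Emit[where L = n and P = P3 and f = f3]])
        show "regs s2 0 + n < w" using reg0[of s2] o1 o2 s len by simp
        show "fits_test w s' b3 \<and> (eval_test s' b3 \<longleftrightarrow> P3 k) \<and> fits_expr w s' e3 \<and> eval_expr s' e3 = f3 k"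
          if "k < n" "regs s' 3 = k" "agree {0, 3} {1} s2 s'" for k s'
          using b[OF that(1,2) agree_trans[OF ag2 that(3)]] by blast
      qed (use n2 s o1 o2 in auto)
    qed (use n1 s in auto)
  qed (use s b in auto)
qed

lemma length_filter_disjoint:
  assumes "\<And>x. \<not> (P x \<and> Q x)"
  shows "length (filter P xs) + length (filter Q xs) \<le> length xs"
  using assms by (induction xs) (auto simp: le_SucI)

context arc_machine
begin

context
  fixes a :: "nat \<Rightarrow> nat" and S :: "nat \<Rightarrow> bool"
  assumes S: "S = (\<lambda>x. degree (a x) \<noteq> n - 1)" and layered: "layered D a n S"
begin

interpretation L: layered D a n S by (rule layered)

definition ready :: "store \<Rightarrow> bool" where
  "ready s \<longleftrightarrow> regs s 1 = n \<and> regs s 9 = n - 1 \<and> arrs s 8 = a \<and> arrs s 10 = degree"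

lemma ready_agree:
  "ready s \<Longrightarrow> agree X A s s' \<Longrightarrow> 1 \<notin> X \<Longrightarrow> 9 \<notin> X \<Longrightarrow> 8 \<notin> A \<Longrightarrow> 10 \<notin> A \<Longrightarrow> ready s'"
  by (simp add: ready_def agree_def)

definition collected :: "store \<Rightarrow> bool" where
  "collected s \<longleftrightarrow> ready s \<and> regs s 4 = length L.SL \<and> (\<forall>j<length L.SL. arrs s 15 j = L.SL ! j \<and> arrs s 16 j = L.class_of j) \<and>
    (\<forall>c<length L.TL. arrs s 14 c = L.TL ! c) \<and> (L.SL = [] \<longrightarrow> arrs s 16 0 = 0)"

lemma collect_classes:
  assumes s: "ready s" "arrs s 16 0 = 0"
  shows "runs w I collect_classes s collected"
  unfolding collect_classes_def
proof (rule runs_Seq_straight, simp, use w in simp, rule runs_Seq_straight, simp, use w in simp)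
  let ?p = "Cond (Independent (Reg 3))
      (Store 15 (Reg 4) (Reg 3) ;; Store 16 (Reg 4) (Reg 5) ;; inc 4)
      (Store 14 (Reg 5) (Reg 3) ;; inc 5)"
  let ?s = "run (Assign 5 (Num 0)) (run (Assign 4 (Num 0)) s)"
  let ?T = "\<lambda>x. \<not> S x"
  \<comment> \<open>Register 5 counts the tournament vertices met so far, which is the class of an
    element of \<open>S\<close> met at this moment.\<close>
  let ?J = "\<lambda>k (s' :: store). regs s' 4 = length (filter S [0..<k]) \<and> regs s' 5 = length (filter ?T [0..<k]) \<and>
    (\<forall>j<length (filter S [0..<k]). arrs s' 15 j = filter S [0..<k] ! j \<and>
      arrs s' 16 j = length (filter ?T [0..<filter S [0..<k] ! j])) \<and>
    (\<forall>c<length (filter ?T [0..<k]). arrs s' 14 c = filter ?T [0..<k] ! c) \<and>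
    (filter S [0..<k] = [] \<longrightarrow> arrs s' 16 0 = 0)"
  have "agree {4, 5} {} s ?s" by (simp add: agree_def)
  then have r: "ready ?s" by (rule ready_agree[OF s(1)]) simp_all
  have "runs w I (For 1 ?p) ?s (\<lambda>s'. ?J n s' \<and> agree (written_regs (For 1 ?p)) (written_arrs (For 1 ?p)) ?s s')"
  proof (rule runs_frame, rule runs_For[where J = ?J])
    show "?J 0 ?s" using s by simp
    fix k s' assume k: "k < n" and J: "?J k s'" and 3: "regs s' 3 = k"
      and ag: "agree (insert 3 (written_regs ?p)) (written_arrs ?p) ?s s'"
    have r': "ready s'" by (rule ready_agree[OF r ag]) simp_all
    have test: "eval_test s' (Independent (Reg 3)) \<longleftrightarrow> S k" using r' 3 by (simp add: ready_def S)
    have len: "length (filter P [0..<k]) \<le> k" for P using length_filter_le[of P "[0..<k]"] by simp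
    have "regs s' 4 \<le> k" "regs s' 5 \<le> k" using J len[of S] len[of ?T] by simp_all
    moreover have "n + 1 \<le> w" using w by simp
    ultimately have fits: "regs s' 4 + 1 \<le> w" "regs s' 5 + 1 \<le> w" using k by linarith+
    show "fits_prog w ?p s' \<and> ?J (Suc k) (run ?p s')"
    proof (cases "S k")
      case True
      have "filter S [0..<Suc k] = filter S [0..<k] @ [k]" "filter ?T [0..<Suc k] = filter ?T [0..<k]"
        using True by simp_all
      then show ?thesis
        using J 3 test True fits w by (auto simp: nth_append less_Suc_eq simp del: upt_Suc)
    next
      case False
      have "filter S [0..<Suc k] = filter S [0..<k]" "filter ?T [0..<Suc k] = filter ?T [0..<k] @ [k]"
        using False by simp_all
      then show ?thesis
        using J 3 test False fits w by (auto simp: nth_append less_Suc_eq simp del: upt_Suc)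
    qed
  qed (use r w I in \<open>auto simp: ready_def\<close>)
  then show "runs w I (For 1 ?p) ?s collected"
  proof (rule runs_mono)
    fix s' assume J: "?J n s' \<and> agree (written_regs (For 1 ?p)) (written_arrs (For 1 ?p)) ?s s'"
    then have "ready s'" by (intro ready_agree[OF r, of "written_regs (For 1 ?p)" "written_arrs (For 1 ?p)"]) simp_all
    then show "collected s'" using J by (simp add: collected_def L.SL_def L.TL_def L.class_of_def)
  qed
qed

lemma answered_Yes: "strong_ordering D (map a ps) \<Longrightarrow> output_of s = 0 # map a ps \<Longrightarrow> answered D s"
  using L.rmt by (intro exI[of _ "Yes (map a ps)"]) (auto simp: strongly_chordal_def)

lemma output_forward:
  assumes s: "collected s" and cl: "L.SL \<noteq> [] \<Longrightarrow> L.class_of (length L.SL - 2) < L.class_of 0 + 2"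
  shows "runs w I output_forward s (answered D)"
proof -
  define b l where "b = arrs s 15 0" and "l = arrs s 15 (length L.SL - 1)"
  let ?s = "run (Assign 0 (Num 1)) (run (Store 1 (Num 0) (Num 0)) (run (Assign 8 Last) (run (Assign 7 First) s)))"
  have r: "ready ?s" and r7: "regs ?s 7 = b" and r8: "regs ?s 8 = l"
    using s by (auto simp: collected_def ready_def b_def l_def)
  have out: "output_of ?s = [0]" by (simp add: output_of_def)
  let ?P = "\<lambda>x. S x \<and> x \<noteq> l"
  have "runs w I (Emit 1 (Kept (Reg 3)) (Cell 8 (Reg 3)) ;;
    Emit 1 (Conj (Neg (Kept (Reg 3))) (Neg (Less (Reg 3) (Reg 7))))
      (Cell 8 (Reg 3)) ;;
    Emit 1 (Less Mirror (Reg 7)) (Cell 8 Mirror)) ?s (\<lambda>s'. output_of s' = 0 # map a (filter ?P [0..<n]) @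
      map a (filter (\<lambda>x. \<not> ?P x \<and> b \<le> x) [0..<n]) @ map (\<lambda>x. a (n - 1 - x)) (filter (\<lambda>x. n - 1 - x < b) [0..<n]))"
  proof (rule runs_Emit3)
    show "length (filter ?P [0..<n]) + length (filter (\<lambda>x. \<not> ?P x \<and> b \<le> x) [0..<n]) \<le> n"
      using length_filter_disjoint[of ?P "\<lambda>x. \<not> ?P x \<and> b \<le> x" "[0..<n]"] by simp
    fix k s' assume k: "regs s' 3 = k" and ag: "agree {0, 3} {1} ?s s'"
    have r': "ready s'" by (rule ready_agree[OF r ag]) simp_all
    have "regs s' 7 = b" "regs s' 8 = l" using agree_regs[OF ag, of 7] agree_regs[OF ag, of 8] r7 r8 by simp_all
    then show "fits_test w s' (Kept (Reg 3)) \<and>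
        (eval_test s' (Kept (Reg 3)) \<longleftrightarrow> ?P k) \<and>
        fits_expr w s' (Cell 8 (Reg 3)) \<and> eval_expr s' (Cell 8 (Reg 3)) = a k \<and>
        fits_test w s' (Conj (Neg (Kept (Reg 3))) (Neg (Less (Reg 3) (Reg 7)))) \<and>
        (eval_test s' (Conj (Neg (Kept (Reg 3))) (Neg (Less (Reg 3) (Reg 7)))) \<longleftrightarrow>
          \<not> ?P k \<and> b \<le> k) \<and>
        fits_expr w s' (Cell 8 (Reg 3)) \<and> eval_expr s' (Cell 8 (Reg 3)) = a k \<and>
        fits_test w s' (Less Mirror (Reg 7)) \<and> (eval_test s' (Less Mirror (Reg 7)) \<longleftrightarrow> n - 1 - k < b) \<and>
        fits_expr w s' (Cell 8 Mirror) \<and> eval_expr s' (Cell 8 Mirror) = a (n - 1 - k)"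
      using r' k w by (simp add: ready_def S not_less)
  qed (use r out w I in \<open>auto simp: ready_def\<close>)
  then have "runs w I (Emit 1 (Kept (Reg 3)) (Cell 8 (Reg 3)) ;;
    Emit 1 (Conj (Neg (Kept (Reg 3))) (Neg (Less (Reg 3) (Reg 7))))
      (Cell 8 (Reg 3)) ;;
    Emit 1 (Less Mirror (Reg 7)) (Cell 8 Mirror)) ?s (answered D)"
  proof (rule runs_mono)
    have bl: "0 < length L.SL \<Longrightarrow> b = L.SL ! 0 \<and> l = L.SL ! (length L.SL - 1) \<and> L.class_of (length L.SL - 2) < L.class_of 0 + 2"
      using s cl by (auto simp: collected_def b_def l_def)
    show "answered D s'" if "output_of s' = 0 # map a (filter ?P [0..<n]) @
      map a (filter (\<lambda>x. \<not> ?P x \<and> b \<le> x) [0..<n]) @ map (\<lambda>x. a (n - 1 - x)) (filter (\<lambda>x. n - 1 - x < b) [0..<n])" for s'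
      by (rule answered_Yes[OF L.strong_ordering_forward_SL[OF bl]]) (use that in \<open>simp_all add: comp_def\<close>)
  qed
  note emits = this
  show ?thesis
    unfolding output_forward_def
    by (rule runs_Seq_straight, simp, use w in simp, rule runs_Seq_straight, simp, use w in simp,
        rule runs_Seq_straight, simp, use w in simp, rule runs_Seq_straight, simp, use w in simp, rule emits)
qed

lemma output_backward:
  assumes s: "collected s" and cl: "2 \<le> length L.SL" "L.class_of (length L.SL - 1) < L.class_of 1 + 2"
  shows "runs w I output_backward s (answered D)"
proof -
  define b l where "b = arrs s 15 (length L.SL - 1)" and "l = arrs s 15 0"
  let ?s = "run (Assign 0 (Num 1)) (run (Store 1 (Num 0) (Num 0)) (run (Assign 8 First) (run (Assign 7 Last) s)))"
  have r: "ready ?s" and r7: "regs ?s 7 = b" and r8: "regs ?s 8 = l"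
    using s by (auto simp: collected_def ready_def b_def l_def)
  have out: "output_of ?s = [0]" by (simp add: output_of_def)
  let ?m = "\<lambda>x. n - 1 - x"
  let ?P = "\<lambda>x. S (?m x) \<and> ?m x \<noteq> l"
  let ?emits = "Emit 1 (Kept Mirror) (Cell 8 Mirror) ;;
    Emit 1 (Conj (Neg (Kept Mirror)) (Neg (Less (Reg 7) Mirror)))
      (Cell 8 Mirror) ;;
    Emit 1 (Less (Reg 7) (Reg 3)) (Cell 8 (Reg 3))"
  have "runs w I ?emits ?s (\<lambda>s'. output_of s' = 0 # map (\<lambda>x. a (?m x)) (filter ?P [0..<n]) @
      map (\<lambda>x. a (?m x)) (filter (\<lambda>x. \<not> ?P x \<and> ?m x \<le> b) [0..<n]) @ map a (filter (\<lambda>x. b < x) [0..<n]))"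
  proof (rule runs_Emit3)
    show "length (filter ?P [0..<n]) + length (filter (\<lambda>x. \<not> ?P x \<and> ?m x \<le> b) [0..<n]) \<le> n"
      using length_filter_disjoint[of ?P "\<lambda>x. \<not> ?P x \<and> ?m x \<le> b" "[0..<n]"] by simp
    fix k s' assume k: "regs s' 3 = k" and ag: "agree {0, 3} {1} ?s s'"
    have r': "ready s'" by (rule ready_agree[OF r ag]) simp_all
    have "regs s' 7 = b" "regs s' 8 = l" using agree_regs[OF ag, of 7] agree_regs[OF ag, of 8] r7 r8 by simp_all
    then show "fits_test w s' (Kept Mirror) \<and>
        (eval_test s' (Kept Mirror) \<longleftrightarrow> ?P k) \<and>
        fits_expr w s' (Cell 8 Mirror) \<and> eval_expr s' (Cell 8 Mirror) = a (?m k) \<and>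
        fits_test w s' (Conj (Neg (Kept Mirror)) (Neg (Less (Reg 7) Mirror))) \<and>
        (eval_test s' (Conj (Neg (Kept Mirror)) (Neg (Less (Reg 7) Mirror))) \<longleftrightarrow>
          \<not> ?P k \<and> ?m k \<le> b) \<and>
        fits_expr w s' (Cell 8 Mirror) \<and> eval_expr s' (Cell 8 Mirror) = a (?m k) \<and>
        fits_test w s' (Less (Reg 7) (Reg 3)) \<and> (eval_test s' (Less (Reg 7) (Reg 3)) \<longleftrightarrow> b < k) \<and>
        fits_expr w s' (Cell 8 (Reg 3)) \<and> eval_expr s' (Cell 8 (Reg 3)) = a k"
      using r' k w by (simp add: ready_def S not_less)
  qed (use r out w I in \<open>auto simp: ready_def\<close>)
  then have "runs w I ?emits ?s (answered D)"
  proof (rule runs_mono)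
    have bl: "b = L.SL ! (length L.SL - 1)" "l = L.SL ! 0"
      using s cl(1) by (cases "L.SL = []"; auto simp: collected_def b_def l_def)+
    show "answered D s'" if "output_of s' = 0 # map (\<lambda>x. a (?m x)) (filter ?P [0..<n]) @
      map (\<lambda>x. a (?m x)) (filter (\<lambda>x. \<not> ?P x \<and> ?m x \<le> b) [0..<n]) @ map a (filter (\<lambda>x. b < x) [0..<n])" for s'
      by (rule answered_Yes[OF L.strong_ordering_backward_SL[OF cl bl]]) (use that in \<open>simp add: comp_def\<close>)
  qed
  note emits = this
  show ?thesis
    unfolding output_backward_def
    by (rule runs_Seq_straight, simp, use w in simp, rule runs_Seq_straight, simp, use w in simp,
        rule runs_Seq_straight, simp, use w in simp, rule runs_Seq_straight, simp, use w in simp, rule emits)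
qed

lemma output_split:
  assumes s: "ready s" "arrs s 16 0 = 0"
  shows "runs w I output_split s (answered D)"
  unfolding output_split_def
proof (rule runs_Seq[OF collect_classes[OF s]])
  let ?\<sigma> = "length L.SL"
  fix s' assume c: "collected s'"
  then have 4: "regs s' 4 = ?\<sigma>" and 8: "arrs s' 8 = a"
    and S_nth: "\<And>j. j < ?\<sigma> \<Longrightarrow> arrs s' 15 j = L.SL ! j" and cl: "\<And>j. j < ?\<sigma> \<Longrightarrow> arrs s' 16 j = L.class_of j"
    and T_nth: "\<And>c. c < length L.TL \<Longrightarrow> arrs s' 14 c = L.TL ! c"
    and empty: "L.SL = [] \<Longrightarrow> arrs s' 16 0 = 0"
    by (auto simp: collected_def ready_def)
  have TLn: "length L.TL \<le> n" using length_filter_le[of "\<lambda>x. \<not> S x" "[0..<n]"] by (simp add: L.TL_def)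
  have cl_le: "arrs s' 16 j + 2 \<le> w" if "j < ?\<sigma>" for j
  proof -
    have "n + 2 \<le> w" using w by simp
    then show ?thesis using L.class_of_le[OF that] TLn cl[OF that] by linarith
  qed
  \<comment> \<open>If \<open>S\<close> is empty, cell 0 of array 16 still holds its initial 0 and
    both truncated indices of the first test are 0, so the forward ordering is chosen.\<close>
  have cl0: "arrs s' 16 0 + 2 \<le> w" using cl_le[of 0] empty w by (cases "L.SL = []") auto
  let ?Ts = "Cond (Less (Add (class_elem (Num 1)) (Num 1)) (class_elem (Sub (Reg 4) (Num 2)))) output_T202
          (Cond (Equal (class_elem (Num 1)) (class_elem (Sub (Reg 4) (Num 2)))) output_T10101 output_T1111)"
  let ?bwd = "Less (class_elem (Sub (Reg 4) (Num 1))) (Add (class_elem (Num 1)) (Num 2))"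
  let ?fwd = "Less (class_elem (Sub (Reg 4) (Num 2))) (Add (class_elem (Num 0)) (Num 2))"
  show "runs w I (Cond ?fwd output_forward (Cond ?bwd output_backward ?Ts)) s' (answered D)"
  proof (rule runs_Cond)
    show "fits_test w s' ?fwd" using cl0 w by simp
    assume "eval_test s' ?fwd"
    then show "runs w I output_forward s' (answered D)"
      using 4 cl by (intro output_forward[OF c]) simp
  next
    assume "\<not> eval_test s' ?fwd"
    then have 1: "arrs s' 16 0 + 2 \<le> arrs s' 16 (?\<sigma> - 2)" using 4 by simp
    then have "?\<sigma> - 2 \<noteq> 0" by (metis add_le_same_cancel1 not_numeral_le_zero)
    then have \<sigma>: "3 \<le> ?\<sigma>" by simp
    then have ne: "L.SL \<noteq> []" by auto
    have cls: "arrs s' 16 0 = L.class_of 0" "arrs s' 16 1 = L.class_of 1" "arrs s' 16 (Suc 0) = L.class_of 1"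
      "arrs s' 16 (?\<sigma> - 2) = L.class_of (?\<sigma> - 2)"
      "arrs s' 16 (?\<sigma> - 1) = L.class_of (?\<sigma> - 1)" "arrs s' 16 (?\<sigma> - Suc 0) = L.class_of (?\<sigma> - 1)"
      using cl \<sigma> ne by simp_all
    have nf: "L.class_of 0 + 2 \<le> L.class_of (?\<sigma> - 2)" using 1 cls by simp
    have elems: "arrs s' 15 0 = L.SL ! 0" "arrs s' 15 (Suc 0) = L.SL ! 1"
      "arrs s' 15 (?\<sigma> - 2) = L.SL ! (?\<sigma> - 2)" "arrs s' 15 (?\<sigma> - Suc 0) = L.SL ! (?\<sigma> - 1)"
      using S_nth \<sigma> ne by simp_all
    have clT: "L.class_of j \<le> length L.TL" if "j < ?\<sigma>" for j using L.class_of_le[OF that] .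
    have cl1: "arrs s' 16 1 + 2 \<le> w" using cl_le \<sigma> by simp
    show "runs w I (Cond ?bwd output_backward ?Ts) s' (answered D)"
    proof (rule runs_Cond)
      show "fits_test w s' ?bwd" using cl1 w by simp
      assume "eval_test s' ?bwd"
      then show "runs w I output_backward s' (answered D)"
        using 4 cls \<sigma> by (intro output_backward[OF c]) simp_all
    next
      assume "\<not> eval_test s' ?bwd"
      then have nb: "L.class_of 1 + 2 \<le> L.class_of (?\<sigma> - 1)" using 4 cls by simp
      have T: "arrs s' 14 (L.class_of 1) = L.TL ! L.class_of 1" "arrs s' 14 (L.class_of 1 + 1) = L.TL ! (L.class_of 1 + 1)"
        "arrs s' 14 (L.class_of 0) = L.TL ! L.class_of 0" "arrs s' 14 (L.class_of 0 + 1) = L.TL ! (L.class_of 0 + 1)"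
        using nf nb clT[of "?\<sigma> - 1"] clT[of "?\<sigma> - 2"] \<sigma> ne by (auto intro!: T_nth)
      have neT: "\<not> (reflexive_multipartite_tournament D \<and> strongly_chordal D)" if "\<not> strongly_chordal D" using that by simp
      show "runs w I ?Ts s' (answered D)"
      proof (rule runs_Cond)
        show "fits_test w s' (Less (Add (class_elem (Num 1)) (Num 1)) (class_elem (Sub (Reg 4) (Num 2))))"
          using cl1 w by simp
        assume "eval_test s' (Less (Add (class_elem (Num 1)) (Num 1)) (class_elem (Sub (Reg 4) (Num 2))))"
        then have "L.class_of 1 + 1 < L.class_of (?\<sigma> - 2)" using 4 cls by simp
        note pos = L.T202_positions[OF nf nb ne this]
        show "runs w I output_T202 s' (answered D)"
            unfolding output_T202_def
          by (rule runs_Write[where ans = "No (Induced_T202 (map a [L.SL ! 0, L.SL ! 1, L.TL ! L.class_of 1, L.TL ! (L.class_of 1 + 1),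
              L.SL ! (?\<sigma> - 2), L.SL ! (?\<sigma> - 1)]))"])
            (use pos 4 8 cls elems T cl1 w in simp_all)
      next
        assume "\<not> eval_test s' (Less (Add (class_elem (Num 1)) (Num 1)) (class_elem (Sub (Reg 4) (Num 2))))"
        then have n202: "\<not> L.class_of 1 + 1 < L.class_of (?\<sigma> - 2)" using 4 cls by simp
        show "runs w I (Cond (Equal (class_elem (Num 1)) (class_elem (Sub (Reg 4) (Num 2)))) output_T10101 output_T1111) s' (answered D)"
        proof (rule runs_Cond)
          show "fits_test w s' (Equal (class_elem (Num 1)) (class_elem (Sub (Reg 4) (Num 2))))" using w by simp
          assume "eval_test s' (Equal (class_elem (Num 1)) (class_elem (Sub (Reg 4) (Num 2))))"
          then have "L.class_of 1 = L.class_of (?\<sigma> - 2)" using 4 cls by simp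
          note pos = L.T10101_positions[OF nf nb ne this]
          show "runs w I output_T10101 s' (answered D)"
            unfolding output_T10101_def
            by (rule runs_Write[where ans = "No (Induced_T10101 (map a [L.SL ! 0, L.TL ! L.class_of 0, L.TL ! (L.class_of 0 + 1),
                L.SL ! 1, L.TL ! L.class_of 1, L.TL ! (L.class_of 1 + 1), L.SL ! (?\<sigma> - 1)]))"])
              (use pos 4 8 cls elems T cl0 cl1 w in simp_all)
        next
          assume "\<not> eval_test s' (Equal (class_elem (Num 1)) (class_elem (Sub (Reg 4) (Num 2))))"
          then have ne2: "L.class_of 1 \<noteq> L.class_of (?\<sigma> - 2)" using 4 cls by simp
          note pos = L.T1111_positions[OF nf nb ne n202 ne2]
          have T2: "arrs s' 14 (L.class_of (?\<sigma> - 2)) = L.TL ! L.class_of (?\<sigma> - 2)"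
            using n202 nb clT[of "?\<sigma> - 1"] ne by (intro T_nth) simp
          show "runs w I output_T1111 s' (answered D)"
            unfolding output_T1111_def
            by (rule runs_Write[where ans = "No (Induced_T1111 (map a [L.SL ! 0, L.TL ! L.class_of 0, L.SL ! 1, L.TL ! L.class_of 1,
                L.SL ! (?\<sigma> - 2), L.TL ! L.class_of (?\<sigma> - 2), L.SL ! (?\<sigma> - 1)]))"])
              (use pos 4 8 cls elems T T2 cl0 cl1 w in simp_all)
        qed
      qed
    qed
  qed
qed

end

end

section \<open>Reading the input\<close>

lemma nth_concat_offset:
  assumes "u < length xss" "c < length (xss ! u)"
  shows "concat xss ! (length (concat (take u xss)) + c) = xss ! u ! c"
proof -
  have "concat xss = concat (take u xss) @ xss ! u @ concat (drop (Suc u) xss)"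
    by (subst id_take_nth_drop[OF assms(1)]) simp
  then show ?thesis using assms(2) by (simp add: nth_append)
qed

lemma concat_index:
  assumes "e < length (concat xss)"
  obtains u c where "u < length xss" "c < length (xss ! u)" "e = length (concat (take u xss)) + c"
proof -
  have "\<exists>u<length xss. \<exists>c<length (xss ! u). e = length (concat (take u xss)) + c"
    using assms
  proof (induction xss arbitrary: e)
    case (Cons xs xss)
    show ?case
    proof (cases "e < length xs")
      case True
      then show ?thesis by (intro exI[of _ 0]) auto
    next
      case False
      then have "e - length xs < length (concat xss)" using Cons.prems by simp
      from Cons.IH[OF this] obtain u c where "u < length xss" "c < length (xss ! u)"
        "e - length xs = length (concat (take u xss)) + c" by blast
      with False show ?thesis by (intro exI[of _ "Suc u"] conjI exI[of _ c]) auto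
    qed
  qed simp
  then show ?thesis using that by blast
qed

lemma length_concat_take_Suc:
  "u < length xss \<Longrightarrow> length (concat (take (Suc u) xss)) = length (concat (take u xss)) + length (xss ! u)"
  by (simp add: take_Suc_conv_app_nth)

lemma distinct_concat_Pair:
  "(\<And>u. u < k \<Longrightarrow> distinct (f u)) \<Longrightarrow> distinct (concat (map (\<lambda>u. map (Pair u) (f u)) [0..<k]))"
  by (induction k) (auto simp: distinct_map inj_on_def)

text \<open>A double loop in one again: a round copies one arc or closes the current list. Register
  4 holds the address of its length field, and on closing, the arc counter minus the length gives
  the first arc number of the list.\<close>

definition read_graph :: prog where
  "read_graph = Assign 1 (Cell 0 (Num 0)) ;; Assign 2 (Num 0) ;; Assign 4 (Num 1) ;; Assign 5 (Num 0) ;;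
    Assign 6 (Num 0) ;;
    While (Less (Reg 5) (Reg 1))
      (Cond (Less (Reg 6) (Cell 0 (Reg 4)))
        (Store 2 (Reg 2) (Reg 5) ;; Store 3 (Reg 2) (Cell 0 (Add (Add (Reg 4) (Num 1)) (Reg 6))) ;; inc 2 ;; inc 6)
        (Store 4 (Reg 5) (Sub (Reg 2) (Reg 6)) ;; Store 5 (Reg 5) (Reg 6) ;;
          Assign 4 (Add (Add (Reg 4) (Num 1)) (Reg 6)) ;; Assign 6 (Num 0) ;; inc 5))"

definition recognize :: prog where
  "recognize = read_graph ;; check_loops ;;
    Cond (Neg (Equal (Reg 4) (Num 0))) (Write 0 [Num 1, Sub (Reg 4) (Num 1)])
      (topsort ;;
        Cond (Less (Reg 4) (Reg 1)) output_cycle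
          (compute_degrees ;; Cond (Equal (Reg 5) (Num 0)) output_split output_non_split))"

text \<open>Before the length field of vertex \<open>u\<close> stand the number of vertices,
  \<open>u\<close> length fields and \<open>off u\<close> list entries; hence the address
  \<open>1 + u + off u\<close>.\<close>

locale arc_input = arc_machine +
  fixes inp :: "nat \<Rightarrow> nat"
  assumes inp_n: "inp 0 = n"
    and inp_len: "u < n \<Longrightarrow> inp (1 + u + off u) = len u"
    and inp_ds: "u < n \<Longrightarrow> c < len u \<Longrightarrow> inp (2 + u + off u + c) = ds (off u + c)"
    and off_0: "off 0 = 0"
    and off_Suc: "u < n \<Longrightarrow> off (Suc u) = off u + len u"
    and off_n: "off n = m"
begin

lemma off_le: "u \<le> n \<Longrightarrow> off u \<le> m"
proof (induction "n - u" arbitrary: u)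
  case (Suc k)
  then have "off (Suc u) \<le> m" by simp
  then show ?case using off_Suc[of u] Suc by simp
qed (simp add: off_n)

lemma read_graph:
  assumes s: "arrs s 0 = inp"
  shows "runs w I read_graph s graph"
proof -
  let ?s = "run (Assign 6 (Num 0)) (run (Assign 5 (Num 0)) (run (Assign 4 (Num 1)) (run (Assign 2 (Num 0))
    (run (Assign 1 (Cell 0 (Num 0))) s))))"
  let ?p = "Cond (Less (Reg 6) (Cell 0 (Reg 4)))
        (Store 2 (Reg 2) (Reg 5) ;; Store 3 (Reg 2) (Cell 0 (Add (Add (Reg 4) (Num 1)) (Reg 6))) ;; inc 2 ;; inc 6)
        (Store 4 (Reg 5) (Sub (Reg 2) (Reg 6)) ;; Store 5 (Reg 5) (Reg 6) ;;
          Assign 4 (Add (Add (Reg 4) (Num 1)) (Reg 6)) ;; Assign 6 (Num 0) ;; inc 5)"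
  let ?J = "\<lambda>s' :: store. arrs s' 0 = inp \<and> regs s' 1 = n \<and> regs s' 5 \<le> n \<and> regs s' 4 = 1 + regs s' 5 + off (regs s' 5) \<and>
    regs s' 2 = off (regs s' 5) + regs s' 6 \<and> (regs s' 5 < n \<longrightarrow> regs s' 6 \<le> len (regs s' 5)) \<and>
    (regs s' 5 = n \<longrightarrow> regs s' 6 = 0) \<and>
    (\<forall>e<regs s' 2. arrs s' 2 e = sr e \<and> arrs s' 3 e = ds e) \<and>
    (\<forall>v<regs s' 5. arrs s' 4 v = off v \<and> arrs s' 5 v = len v)"
  have "runs w I (While (Less (Reg 5) (Reg 1)) ?p) ?s (\<lambda>s'. ?J s' \<and> \<not> eval_test s' (Less (Reg 5) (Reg 1)))"
  \<comment> \<open>Arcs still to be copied plus lists still to be closed.\<close>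
  proof (rule runs_While[where \<mu> = "\<lambda>s'. (m - regs s' 2) + (n - regs s' 5)"])
    show "?J ?s" using s inp_n off_0 by simp
    show "(m - regs ?s 2) + (n - regs ?s 5) \<le> I" using I by simp
    fix s' assume J: "?J s'" and "eval_test s' (Less (Reg 5) (Reg 1))"
    then have less: "regs s' 5 < n" by simp
    define u c where "u = regs s' 5" and "c = regs s' 6"
    have u: "u < n" "regs s' 5 = u" and c: "c \<le> len u" "regs s' 6 = c"
      and 4: "regs s' 4 = Suc (u + off u)" and 2: "regs s' 2 = off u + c"
      and 0: "arrs s' 0 = inp" and 1: "regs s' 1 = n" "regs s' (Suc 0) = n"
      and arrs: "\<And>e. e < off u + c \<Longrightarrow> arrs s' 2 e = sr e \<and> arrs s' 3 e = ds e"
      and lists': "\<And>v. v < u \<Longrightarrow> arrs s' 4 v = off v \<and> arrs s' 5 v = len v"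
      using J less by (simp_all add: u_def c_def)
    have next_off: "off (Suc u) = off u + len u" by (rule off_Suc[OF u(1)])
    have le_m: "off u + len u \<le> m" using off_le[of "Suc u"] u(1) next_off by simp
    have len: "inp (Suc (u + off u)) = len u" using inp_len[OF u(1)] by simp
    have bounds: "u + m + 5 \<le> w" "m + 5 \<le> w" using w u(1) by simp_all
    show "fits_prog w ?p s' \<and> ?J (run ?p s') \<and>
        (m - regs (run ?p s') 2) + (n - regs (run ?p s') 5) < (m - regs s' 2) + (n - regs s' 5)"
    proof (cases "c < len u")
      case True
      have e: "sr (off u + c) = u" "off u + c < m" using lists[OF u(1), of "off u + c"] True by auto
      have in_ds: "inp (Suc (Suc (u + off u + c))) = ds (off u + c)" using inp_ds[OF u(1) True] by simp
      have fits: "fits_prog w ?p s'" using True u c 4 2 0 len bounds e by simp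
      have upd: "arrs (run ?p s') 0 = inp" "regs (run ?p s') 1 = n" "regs (run ?p s') 5 = u" "regs (run ?p s') 6 = Suc c"
        "regs (run ?p s') 4 = Suc (u + off u)" "regs (run ?p s') 2 = Suc (off u + c)"
        "arrs (run ?p s') 2 = (arrs s' 2)(off u + c := u)" "arrs (run ?p s') 3 = (arrs s' 3)(off u + c := ds (off u + c))"
        "arrs (run ?p s') 4 = arrs s' 4" "arrs (run ?p s') 5 = arrs s' 5"
        using True u c 4 2 0 1 len in_ds by simp_all
      have "?J (run ?p s')" unfolding upd using u True arrs lists' e by (auto simp: less_Suc_eq)
      moreover have "(m - regs (run ?p s') 2) + (n - regs (run ?p s') 5) < (m - regs s' 2) + (n - regs s' 5)"
        unfolding upd 2 u(2) using e(2) by simp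
      ultimately show ?thesis using fits by blast
    next
      case False
      then have cl: "c = len u" using c by simp
      have fits: "fits_prog w ?p s'" using cl u c 4 2 0 len bounds le_m by simp
      have upd: "arrs (run ?p s') 0 = inp" "regs (run ?p s') 1 = n" "regs (run ?p s') 5 = Suc u" "regs (run ?p s') 6 = 0"
        "regs (run ?p s') 4 = Suc (Suc (u + off u + len u))" "regs (run ?p s') 2 = off u + len u"
        "arrs (run ?p s') 2 = arrs s' 2" "arrs (run ?p s') 3 = arrs s' 3"
        "arrs (run ?p s') 4 = (arrs s' 4)(u := off u)" "arrs (run ?p s') 5 = (arrs s' 5)(u := len u)"
        using cl u c 4 2 0 1 len by simp_all
      have "?J (run ?p s')" unfolding upd using u arrs lists' next_off cl by (auto simp: less_Suc_eq)
      moreover have "(m - regs (run ?p s') 2) + (n - regs (run ?p s') 5) < (m - regs s' 2) + (n - regs s' 5)"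
        unfolding upd 2 u(2) using u(1) cl by simp
      ultimately show ?thesis using fits by blast
    qed
  qed simp_all
  then have loop: "runs w I (While (Less (Reg 5) (Reg 1)) ?p) ?s graph"
  proof (rule runs_mono)
    fix s' assume J: "?J s' \<and> \<not> eval_test s' (Less (Reg 5) (Reg 1))"
    then have "regs s' 5 = n" by simp
    with J off_n show "graph s'" by (simp add: graph_def)
  qed
  show ?thesis
    unfolding read_graph_def
    by (rule runs_Seq_straight, simp, simp, rule runs_Seq_straight, simp, simp, rule runs_Seq_straight, simp,
        use w in simp, rule runs_Seq_straight, simp, simp, rule runs_Seq_straight, simp, simp, rule loop)
qed

text \<open>On a cycle of length at least two each vertex has another one as successor, so its
  vertex set meets the hypothesis of the bypassing argument. Two-cycles are included.\<close>

lemma cycle_answer: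
  assumes "directed_nonloop_cycle D vs" "set vs \<subseteq> {..<n}" "2 \<le> length vs" "distinct vs"
    and arcs: "\<forall>i<length vs. (vs ! i, vs ! (Suc i mod length vs)) \<in> parcs D"
  shows "correct_answer D (No (Directed_Cycle vs))"
proof -
  have "\<not> (reflexive_multipartite_tournament D \<and> strongly_chordal D)"
  proof
    assume *: "reflexive_multipartite_tournament D \<and> strongly_chordal D"
    show False
    proof (rule no_strong_ordering_if_all_have_successor[of D "set vs"])
      show "\<exists>y\<in>set vs. y \<noteq> x \<and> (x, y) \<in> parcs D" if x: "x \<in> set vs" for x
      proof -
        obtain i where i: "i < length vs" "x = vs ! i" using x by (metis in_set_conv_nth)
        have "Suc i mod length vs \<noteq> i" using i(1) assms(3) by (cases "Suc i = length vs") auto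
        moreover have "Suc i mod length vs < length vs" using assms(3) by (intro mod_less_divisor) linarith
        ultimately show ?thesis using arcs i assms(4) by (metis nth_eq_iff_index_eq nth_mem)
      qed
    qed (use * assms(2,3) verts in auto)
  qed
  with assms(1) show ?thesis by simp
qed

lemma recognize:
  assumes s: "arrs s 0 = inp" "\<And>a v. a \<noteq> 0 \<Longrightarrow> arrs s a v = 0"
  shows "runs w I recognize s (answered D)"
    (is "runs w I _ s ?Q")
  unfolding recognize_def
proof (rule runs_Seq[OF read_graph[OF s(1)]])
  fix s1 assume g1: "graph s1" and "agree (written_regs read_graph) (written_arrs read_graph) s s1"
  then have z1: "arrs s1 a v = 0" if "5 < a" for a v
    using s(2) that by (simp add: agree_def read_graph_def)
  let ?rest3 = "compute_degrees ;; Cond (Equal (Reg 5) (Num 0)) output_split output_non_split"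
  let ?rest2 = "topsort ;; Cond (Less (Reg 4) (Reg 1)) output_cycle ?rest3"
  let ?rest1 = "Cond (Neg (Equal (Reg 4) (Num 0))) (Write 0 [Num 1, Sub (Reg 4) (Num 1)]) ?rest2"
  have z16: "arrs s1 6 v = 0" for v by (rule z1) simp
  show "runs w I (check_loops ;; ?rest1) s1 ?Q"
  proof (rule runs_Seq[OF check_loops[OF g1 z16]])
    fix s2 assume loops: "regs s2 4 = 0 \<and> (\<forall>v<n. (v, v) \<in> parcs D) \<or> (\<exists>v<n. regs s2 4 = Suc v \<and> (v, v) \<notin> parcs D)"
      and "agree (written_regs check_loops) (written_arrs check_loops) s1 s2"
    then have ag: "agree {3, 4} {6} s1 s2" by (auto simp: agree_def check_loops_def)
    have g2: "graph s2" by (rule graph_agree[OF ag g1]) simp_all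
    have z2: "arrs s2 a v = 0" if "6 < a" for a v using z1[of a v] agree_arrs[OF ag, of a] that by simp
    show "runs w I ?rest1 s2 ?Q"
    proof (rule runs_Cond)
      assume "eval_test s2 (Neg (Equal (Reg 4) (Num 0)))"
      then obtain v where v: "v < n" "regs s2 4 = Suc v" "(v, v) \<notin> parcs D" using loops by auto
      then have "correct_answer D (No (Missing_Loop v))"
        using reflexive_multipartite_tournamentD(1)[of D v] verts by auto
      then show "runs w I (Write 0 [Num 1, Sub (Reg 4) (Num 1)]) s2 ?Q"
        by (intro runs_Write[where ans = "No (Missing_Loop v)"]) (use v w in auto)
    next
      assume "\<not> eval_test s2 (Neg (Equal (Reg 4) (Num 0)))"
      then have loops: "\<And>v. v < n \<Longrightarrow> (v, v) \<in> parcs D" using loops by auto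
      have z27: "arrs s2 7 v = 0" for v by (rule z2) simp
      show "runs w I ?rest2 s2 ?Q"
      proof (rule runs_Seq[OF topsort[OF g2 z27]])
        fix s3 assume "\<exists>c. kahn (arrs s3 8) (arrs s3 7) (regs s3 4) (regs s3 4) c"
          and "agree (written_regs topsort) (written_arrs topsort) s2 s3"
        then obtain c where k: "kahn (arrs s3 8) (arrs s3 7) (regs s3 4) (regs s3 4) c"
          and ag: "agree {3, 4, 5, 6, 7, 8} {7, 8} s2 s3"
          by (auto simp: agree_def topsort_def count_entering_def queue_sources_def process_queue_def)
        have g3: "graph s3" by (rule graph_agree[OF ag g2]) simp_all
        have z3: "arrs s3 a v = 0" if "8 < a" for a v using z2[of a v] agree_arrs[OF ag, of a] that by simp
        show "runs w I (Cond (Less (Reg 4) (Reg 1)) output_cycle ?rest3) s3 ?Q"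
        proof (rule runs_Cond)
          assume "eval_test s3 (Less (Reg 4) (Reg 1))"
          then have less: "regs s3 4 < n" using graphD[OF g3] by simp
          show "runs w I output_cycle s3 ?Q"
          proof (rule runs_mono[OF output_cycle[OF g3 k less]])
            show "?Q s'" if "\<exists>vs. output_of s' = 4 # vs \<and> directed_nonloop_cycle D vs \<and> set vs \<subseteq> {..<n} \<and>
              2 \<le> length vs \<and> (\<forall>i<length vs. (vs ! i, vs ! (Suc i mod length vs)) \<in> parcs D) \<and> distinct vs" for s'
              using that cycle_answer by (metis encode_answer.simps(2) encode_obstruction.simps(4))
          qed
        next
          assume "\<not> eval_test s3 (Less (Reg 4) (Reg 1))"
          then have n: "regs s3 4 = n" using graphD[OF g3] kahn_length[OF k] by simp
          note k = k[unfolded n]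
          note antisym = kahn_topological(3)[OF k]
          have z310: "arrs s3 10 v = 0" for v by (rule z3) simp
          show "runs w I ?rest3 s3 ?Q"
          proof (rule runs_Seq[OF compute_degrees[OF g3 z310]])
            fix s4 assume 4: "arrs s4 10 = degree \<and> regs s4 9 = n - 1 \<and>
                (regs s4 5 = 0 \<and> (\<forall>e<m. \<not> inner_arc e) \<or> (\<exists>e<m. regs s4 5 = Suc e \<and> inner_arc e))"
              and "agree (written_regs compute_degrees) (written_arrs compute_degrees) s3 s4"
            then have ag: "agree {3, 5, 9} {10} s3 s4" by (auto simp: agree_def compute_degrees_def)
            have g4: "graph s4" by (rule graph_agree[OF ag g3]) simp_all
            have z4: "arrs s4 a v = 0" if "10 < a" for a v using z3[of a v] agree_arrs[OF ag, of a] that by simp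
            show "runs w I (Cond (Equal (Reg 5) (Num 0)) output_split output_non_split) s4 ?Q"
            proof (rule runs_Cond)
              assume "eval_test s4 (Equal (Reg 5) (Num 0))"
              then have indep: "\<And>e. e < m \<Longrightarrow> sr e \<noteq> ds e \<Longrightarrow> degree (sr e) = n - 1 \<or> degree (ds e) = n - 1"
                using 4 by (auto simp: inner_arc_def)
              have L: "layered D (arrs s3 8) n (\<lambda>x. degree (arrs s3 8 x) \<noteq> n - 1)"
                by (rule layered[OF k loops indep])
              have "ready (arrs s3 8) s4"
                using graphD[OF g4] 4 agree_arrs[OF ag, of 8] by (simp add: ready_def[OF refl L])
              then show "runs w I output_split s4 ?Q"
                by (rule output_split[OF refl L]) (rule z4, simp)
            next
              assume "\<not> eval_test s4 (Equal (Reg 5) (Num 0))"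
              then obtain e where "e < m" "regs s4 5 = Suc e" "inner_arc e" using 4 by auto
              moreover have "arrs s4 11 v = 0" "arrs s4 12 v = 0" "arrs s4 13 v = 0" for v
                by (rule z4, simp)+
              ultimately show "runs w I output_non_split s4 ?Q"
                by (intro output_non_split[OF g4 _ _ _ _ _ _ loops antisym])
            qed (use w in simp)
          qed
        qed simp
      qed
    qed simp
  qed
qed

end

section \<open>From adjacency lists to arrays\<close>

text \<open>Two concatenations of the same lists are compared: \<open>L\<close> pairs every entry
  with its source and thereby numbers the arcs, while \<open>E\<close> carries the length fields of
  the input. The list of \<open>u\<close> starts at \<open>off u\<close> in the former and, its
  length field included, at \<open>u + off u\<close> in the latter.\<close>

lemma arc_input:
  assumes D: "pair_fin_digraph D" and adj: "adjacency_lists D adj"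
    and w: "w = 3 * (card (pverts D) + card (parcs D)) + 20" and I: "I = card (pverts D) + card (parcs D)"
  obtains n m sr ds off len where
    "arc_input D n m sr ds off len w I (\<lambda>i. if i < length (encode_input adj) then encode_input adj ! i else 0)"
    "\<forall>x\<in>set (encode_input adj). x \<le> w"
proof -
  interpret pair_fin_digraph D by (rule D)
  define n where "n = length adj"
  define L where "L = map (\<lambda>u. map (Pair u) (adj ! u)) [0..<n]"
  define E where "E = map (\<lambda>l. length l # l) adj"
  define off where "off u = length (concat (take u adj))" for u
  define len where "len u = length (adj ! u)" for u
  define m where "m = length (concat L)"
  define sr where "sr e = fst (concat L ! e)" for e
  define ds where "ds e = snd (concat L ! e)" for e
  let ?inp = "\<lambda>i. if i < length (encode_input adj) then encode_input adj ! i else 0"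
  have verts: "pverts D = {..<n}" and adj_u: "\<And>u. u < n \<Longrightarrow> distinct (adj ! u) \<and> set (adj ! u) = {v. (u, v) \<in> parcs D}"
    using adj by (auto simp: adjacency_lists_def n_def)
  have wf: "u < n \<and> v < n" if "(u, v) \<in> parcs D" for u v using wellformed'[OF that] verts by simp
  have set_L: "set (concat L) = parcs D"
  proof -
    have "set (concat L) = (\<Union>u<n. Pair u ` {v. (u, v) \<in> parcs D})"
      using adj_u by (simp add: L_def atLeast0LessThan)
    also have "\<dots> = parcs D"
    proof (intro equalityI subsetI)
      fix e assume e: "e \<in> parcs D"
      obtain u v where uv: "e = (u, v)" by fastforce
      then have "u < n" using wf e by blast
      with e uv show "e \<in> (\<Union>u<n. Pair u ` {v. (u, v) \<in> parcs D})" by blast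
    qed auto
    finally show ?thesis .
  qed
  have dist: "distinct (concat L)" unfolding L_def by (rule distinct_concat_Pair) (use adj_u in simp)
  have m: "m = card (parcs D)" unfolding m_def set_L[symmetric] distinct_card[OF dist] ..
  have n: "n = card (pverts D)" by (simp add: verts)
  have lenL: "length L = n" "length (L ! u) = len u" if "u < n" for u using that by (simp_all add: L_def len_def)
  have lenE: "length E = n" "length E = length adj" by (simp_all add: E_def n_def)
  have offL: "length (concat (take u L)) = off u" if "u \<le> n" for u
    using that
  proof (induction u)
    case (Suc u)
    then show ?case
      using length_concat_take_Suc[of u L] length_concat_take_Suc[of u adj]
      by (simp add: off_def L_def n_def)
  qed (simp add: off_def)
  have offE: "length (concat (take u E)) = u + off u" if "u \<le> n" for u
    using that
  proof (induction u)
    case (Suc u)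
    then show ?case
      using length_concat_take_Suc[of u E] length_concat_take_Suc[of u adj]
      by (simp add: off_def E_def n_def)
  qed (simp add: off_def)
  have off_Suc: "off (Suc u) = off u + len u" if "u < n" for u
    using length_concat_take_Suc[of u adj] that by (simp add: off_def len_def n_def)
  have off_n: "off n = m" using offL[of n] by (simp add: m_def L_def)
  have nthL: "concat L ! (off u + c) = (u, adj ! u ! c)" if "u < n" "c < len u" for u c
    using nth_concat_offset[of u L c] that offL[of u] by (simp add: L_def len_def)
  have off_le: "off u + len u \<le> m" if "u < n" for u
  proof -
    have "off (Suc u) \<le> off n" unfolding off_def
      using that by (metis Suc_leI append_take_drop_id concat_append le_add1 length_append min.absorb1 take_take)
    then show ?thesis using off_Suc[OF that] off_n by simp
  qed
  have enc: "encode_input adj = n # concat E" by (simp add: encode_input_def n_def E_def)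
  have lenC: "length (concat E) = n + m" using offE[of n] off_n lenE by simp
  have nthE: "?inp (1 + u + off u) = len u" if "u < n" for u
  proof -
    have "concat E ! (u + off u) = len u"
      using nth_concat_offset[of u E 0] that offE[of u] by (simp add: E_def n_def len_def)
    moreover have "u + off u < n + m" using off_le[OF that] that by simp
    ultimately show ?thesis using lenC by (simp add: enc)
  qed
  have nthE': "?inp (2 + u + off u + c) = ds (off u + c)" if "u < n" "c < len u" for u c
  proof -
    have "concat E ! (u + off u + Suc c) = adj ! u ! c"
      using nth_concat_offset[of u E "Suc c"] that offE[of u] by (simp add: E_def n_def len_def)
    moreover have "u + off u + Suc c < n + m" using off_le[OF that(1)] that by simp
    ultimately show ?thesis using lenC nthL[OF that] by (simp add: enc ds_def)
  qed
  have arc_nth: "(sr e, ds e) = concat L ! e" for e by (simp add: sr_def ds_def)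
  have arc_in: "(sr e, ds e) \<in> parcs D" if "e < m" for e
  proof -
    have "concat L ! e \<in> set (concat L)" using that by (intro nth_mem) (simp add: m_def)
    then show ?thesis unfolding set_L arc_nth .
  qed
  have "arc_input D n m sr ds off len w I ?inp"
  proof
    show "pverts D = {..<n}" by (rule verts)
    show "parcs D = (\<lambda>e. (sr e, ds e)) ` {..<m}"
      unfolding set_L[symmetric] arc_nth m_def by (simp add: set_conv_nth lessThan_def setcompr_eq_image)
    show "e = e'" if "e < m" "e' < m" "sr e = sr e'" "ds e = ds e'" for e e'
    proof -
      have "concat L ! e = concat L ! e'" using that arc_nth[of e] arc_nth[of e'] by simp
      then show ?thesis using nth_eq_iff_index_eq[OF dist] that by (simp add: m_def)
    qed
    show "sr e < n" "ds e < n" if "e < m" for e using wf[OF arc_in[OF that]] by simp_all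
    show "e < m \<and> sr e = u \<longleftrightarrow> off u \<le> e \<and> e < off u + len u" if "u < n" for u e
    proof
      assume e: "e < m \<and> sr e = u"
      then have "e < length (concat L)" by (simp add: m_def)
      then obtain x c where x: "x < length L" "c < length (L ! x)" "e = length (concat (take x L)) + c"
        by (rule concat_index)
      then have "x < n" by (simp add: L_def)
      with x offL lenL have "e = off x + c" "c < len x" by simp_all
      with e nthL[OF \<open>x < n\<close>, of c] show "off u \<le> e \<and> e < off u + len u" by (simp add: sr_def)
    next
      assume e: "off u \<le> e \<and> e < off u + len u"
      then obtain c where "e = off u + c" "c < len u" by (metis le_Suc_ex nat_add_left_cancel_less)
      with nthL[OF that, of c] off_le[OF that] show "e < m \<and> sr e = u" by (simp add: sr_def)
    qed
    show "3 * (n + m) + 20 \<le> w" "n + m \<le> I" using w I m n by simp_all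
    show "?inp 0 = n" by (simp add: enc)
    show "off 0 = 0" by (simp add: off_def)
  qed (use nthE nthE' off_Suc off_n in simp_all)
  moreover have "\<forall>x\<in>set (encode_input adj). x \<le> w"
  proof
    fix x assume "x \<in> set (encode_input adj)"
    then consider "x = n" | l where "l \<in> set adj" "x = length l" | l where "l \<in> set adj" "x \<in> set l"
      by (auto simp: enc E_def)
    then show "x \<le> w"
    proof cases
      case 1
      then show ?thesis using w n by simp
    next
      case 2
      then obtain u where u: "u < n" "x = len u" by (auto simp: in_set_conv_nth n_def len_def)
      then have "x \<le> m" using off_le[OF u(1)] by simp
      then show ?thesis using w m by simp
    next
      case 3
      then obtain u where "u < n" "x \<in> set (adj ! u)" by (auto simp: in_set_conv_nth n_def)
      then have "x < n" using adj_u wf by blast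
      then show ?thesis using w n by simp
    qed
  qed
  ultimately show ?thesis by (rule that)
qed

lemma linear_bigo: "(\<lambda>N. real (a * N + b)) \<in> O(\<lambda>N. real N)"
proof (rule bigoI[of _ "real (a + b)"])
  show "\<forall>\<^sub>F N in sequentially. norm (real (a * N + b)) \<le> real (a + b) * norm (real N)"
    using eventually_ge_at_top[of 1]
  proof eventually_elim
    case (elim N)
    then have "a * N + b \<le> (a + b) * N" by (simp add: distrib_right)
    then have "real (a * N + b) \<le> real ((a + b) * N)" by (rule of_nat_mono)
    then show ?case by simp
  qed
qed

theorem corollary33:
  shows "\<exists>(P :: prog) (T :: nat \<Rightarrow> nat) (W :: nat \<Rightarrow> nat).
    (\<lambda>N. real (T N)) \<in> O(\<lambda>N. real N) \<and>
    (\<lambda>N. real (W N)) \<in> O(\<lambda>N. real N) \<and>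
    (\<forall>(D :: nat pair_pre_digraph) adj.
       pair_fin_digraph D \<and> adjacency_lists D adj \<longrightarrow>
       (\<exists>ans. correct_answer D ans \<and>
          computes_within P (encode_input adj) (encode_answer ans)
            (T (card (pverts D) + card (parcs D))) (W (card (pverts D) + card (parcs D)))))"
proof -
  \<comment> \<open>\<open>K\<close> is obtained from the program before any input is fixed, so one
    constant serves all digraphs.\<close>
  obtain K where K: "\<And>I. time I recognize \<le> K * (I + 1)" using time_linear by blast
  show ?thesis
  proof (rule exI[of _ recognize], rule exI[of _ "\<lambda>N. K * N + K"], rule exI[of _ "\<lambda>N. 3 * N + 20"],
      intro conjI allI impI)
    show "(\<lambda>N. real (K * N + K)) \<in> O(\<lambda>N. real N)" "(\<lambda>N. real (3 * N + 20)) \<in> O(\<lambda>N. real N)"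
      by (rule linear_bigo)+
    fix D :: "nat pair_pre_digraph" and adj
    assume D: "pair_fin_digraph D \<and> adjacency_lists D adj"
    let ?N = "card (pverts D) + card (parcs D)"
    obtain n m sr ds off len where "arc_input D n m sr ds off len (3 * ?N + 20) ?N
        (\<lambda>i. if i < length (encode_input adj) then encode_input adj ! i else 0)"
      and le: "\<forall>x\<in>set (encode_input adj). x \<le> 3 * ?N + 20"
      using arc_input[of D adj "3 * ?N + 20" ?N] D by blast
    then interpret arc_input D n m sr ds off len "3 * ?N + 20" ?N
      "\<lambda>i. if i < length (encode_input adj) then encode_input adj ! i else 0" by simp
    have "runs (3 * ?N + 20) ?N recognize (initial_store (encode_input adj))
        (answered D)"
      by (rule recognize) (simp_all add: initial_store_def)
    then obtain t s' ans where "exec (3 * ?N + 20) recognize (initial_store (encode_input adj)) t s'"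
      "t \<le> time ?N recognize" "output_of s' = encode_answer ans" "correct_answer D ans"
      by (auto simp: runs_def)
    moreover have "time ?N recognize \<le> K * ?N + K" using K[of ?N] by simp
    ultimately show "\<exists>ans. correct_answer D ans \<and>
        computes_within recognize (encode_input adj) (encode_answer ans) (K * ?N + K) (3 * ?N + 20)"
      using le unfolding computes_within_def by (meson order_trans)
  qed
qed

end
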